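(* Let $0<\alpha\le 1$, $\theta<1$, $p=1-\theta$, $0\le a<T$, and $\Omega=\{(x,t):\ 0<x<1,\ a<t<T\}$. Assume: (i) $\tau\in C[0,1]$, $\tau(0)=\tau(1)=0$ and $\tau'\in L^2(0,1)$; (ii) $f(\cdot,t)\in C^3[0,1]$ for each $t$, $f(x,\cdot)\in C_\mu[a,T]$ for each $x$ (where $\mu\in\mathbb{R}$), $f(0,t)=f(1,t)=f_{xx}(0,t)=f_{xx}(1,t)=0$, and $\frac{\partial^4}{\partial x^4}f(\cdot,t)\in L^1(0,1)$. Then the problem of finding a solution $u$ in $\Omega$ of the equation $$ {}^{C}\Big(t^\theta\frac{\partial}{\partial t}\Big)^{\alpha}u(x,t)-u_{xx}(x,t)=f(x,t) $$ satisfying $$ u(0,t)=0,\quad u(1,t)=0\quad (a\le t\le T),\qquad u(x,a)=\tau(x)\quad (0\le x\le 1), $$ has a unique solution, and it is given by $$ u(x,t)=\sum_{k=1}^{\infty}\Big[\tau_k E_{\alpha,1}\Big(-\frac{(k\pi)^2}{p^\alpha}(t^p-a^p)^\alpha\Big)+G_k(t)\Big]\sin(k\pi x), $$ where $$ G_k(t)=\frac{1}{p^\alpha\Gamma(\alpha)}\int_a^t (t^p-\tau^p)^{\alpha-1}f_k(\tau)\,d(\tau^p)-\frac{(k\pi)^2}{p^{2\alpha}}\int_a^t (t^p-\tau^p)^{2\alpha-1}E_{\alpha,2\alpha}\Big[-\frac{(k\pi)^2}{p^\alpha}(t^p-\tau^p)^\alpha\Big]f_k(\tau)\,d(\tau^p),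 $$ $$ \tau_k=2\int_0^1\tau(x)\sin(k\pi x)\,dx,\qquad f_k(t)=2\int_0^1 f(x,t)\sin(k\pi x)\,dx,\qquad k=1,2,3,\dots $$ (inside the integrals defining $G_k$, $\tau$ denotes the integration variable).
   Context: Mittag-Leffler function: $E_{\alpha,\beta}(z)=\sum_{k=0}^\infty \frac{z^k}{\Gamma(\alpha k+\beta)}$, $\alpha>0$, $\beta\in\mathbb{R}$. The notation $d(\tau^\beta)$ means $\beta\tau^{\beta-1}d\tau$. Erdelyi-Kober fractional integral with parameters $\delta>0$, $\gamma\in\mathbb{R}$, $\beta>0$: $$ I^{\gamma,\delta}_{\beta;a+}g(t)=\frac{t^{-\beta(\gamma+\delta)}}{\Gamma(\delta)}\int_a^t (t^\beta-\tau^\beta)^{\delta-1}\tau^{\beta\gamma}g(\tau)\,d(\tau^\beta), $$ with $I^{\gamma,0}_{\beta;a+}$ the identity. Erdelyi-Kober fractional derivative for $n-1<\delta\le n$, $n\in\mathbb{N}$: $$ D^{\gamma,\delta}_{\beta,a+}g(t)=\prod_{j=1}^n\Big(\gamma+j+\frac{t}{\beta}\frac{d}{dt}\Big)\big(I^{\gamma+\delta,n-\delta}_{\beta;a+}g(t)\big). $$ Regularized Caputo-like counterpart of the hyper-Bessel fractional differential operator, for $\theta<1$, $0<\alpha\le1$, $t>a\ge 0$: $$ {}^{C}\Big(t^\theta\frac{d}{dt}\Big)^\alpha g(t)=(1-\theta)^\alpha t^{-\alpha(1-\theta)}D^{-\alpha,\alpha}_{1-\theta,a+}\big(g(t)-g(a)\big).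 $$ For functions of $(x,t)$ it acts in the variable $t$. Weighted space: $C_\mu[a,T]$ is the space of functions $g(t)=t^q\tilde g(t)$ with $q>\mu$ and $\tilde g\in C[a,T]$. A solution is a function $u$ continuous on $[0,1]\times[a,T]$ such that $u_{xx}$ and ${}^{C}(t^\theta\partial/\partial t)^\alpha u$ are continuous in $\Omega$ and which satisfies the equation in $\Omega$ together with the boundary and initial conditions.
   Formalization: Two hypotheses are added, without which the claim fails: the L^1(0,1) norm of the fourth x-derivative of f(.,t) is at most M t^q for all t>0 in [a,T], for some constants M and q>mu; and, if a=0, mu is at least -alpha p. *)

theory Defs
  imports "HOL-Analysis.Analysis"
begin

(* Gamma is 0 at the nonpositive integers in HOL-Analysis and division by 0 is 0,
   which agrees with the usual convention 1 / Gamma = 0 at the poles. *)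
definition mittag_leffler :: "real \<Rightarrow> real \<Rightarrow> real \<Rightarrow> real" where
  "mittag_leffler \<alpha> \<beta> z = (\<Sum>k. z ^ k / Gamma (\<alpha> * real k + \<beta>))"

(* The factor \<beta> * s powr (\<beta> - 1) is the density of d(s^\<beta>). *)
definition EK_integral :: "real \<Rightarrow> real \<Rightarrow> real \<Rightarrow> real \<Rightarrow> (real \<Rightarrow> real) \<Rightarrow> real \<Rightarrow> real" where
  "EK_integral \<beta> a \<gamma> \<delta> g t =
     (if \<delta> = 0 then g t
      else t powr (- \<beta> * (\<gamma> + \<delta>)) / Gamma \<delta> *
        (LINT s:{a..t}|lborel.
           (t powr \<beta> - s powr \<beta>) powr (\<delta> - 1) * s powr (\<beta> * \<gamma>) * g s * (\<beta> * s powr (\<beta> - 1))))"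

(* EK_product \<beta> \<gamma> n h is the product over j = 1..n of the
   operators \<gamma> + j + (t / \<beta>) d/dt, applied to h. *)
primrec EK_product :: "real \<Rightarrow> real \<Rightarrow> nat \<Rightarrow> (real \<Rightarrow> real) \<Rightarrow> real \<Rightarrow> real" where
  "EK_product \<beta> \<gamma> 0 h = h"
| "EK_product \<beta> \<gamma> (Suc n) h =
     (\<lambda>t. (\<gamma> + real (Suc n)) * EK_product \<beta> \<gamma> n h t + t / \<beta> * deriv (EK_product \<beta> \<gamma> n h) t)"

(* For \<delta> > 0, n = nat \<lceil>\<delta>\<rceil> is the natural number with n - 1 < \<delta> \<le> n. *)
definition EK_derivative :: "real \<Rightarrow> real \<Rightarrow> real \<Rightarrow> real \<Rightarrow> (real \<Rightarrow> real) \<Rightarrow> real \<Rightarrow> real" where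
  "EK_derivative \<beta> a \<gamma> \<delta> g =
     (let n = nat \<lceil>\<delta>\<rceil>
      in EK_product \<beta> \<gamma> n (EK_integral \<beta> a (\<gamma> + \<delta>) (real n - \<delta>) g))"

(* deriv is total, so existence of all the derivatives occurring in EK_derivative at the
   points of the open set S has to be required separately. *)
definition EK_derivative_exists_on ::
  "real set \<Rightarrow> real \<Rightarrow> real \<Rightarrow> real \<Rightarrow> real \<Rightarrow> (real \<Rightarrow> real) \<Rightarrow> bool" where
  "EK_derivative_exists_on S \<beta> a \<gamma> \<delta> g \<longleftrightarrow>
     (let n = nat \<lceil>\<delta>\<rceil>
      in \<forall>j<n. \<forall>t\<in>S. EK_product \<beta> \<gamma> j (EK_integral \<beta> a (\<gamma> + \<delta>) (real n - \<delta>) g)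
                       differentiable (at t))"

definition caputo_hyper_bessel :: "real \<Rightarrow> real \<Rightarrow> real \<Rightarrow> (real \<Rightarrow> real) \<Rightarrow> real \<Rightarrow> real" where
  "caputo_hyper_bessel \<theta> \<alpha> a g t =
     (1 - \<theta>) powr \<alpha> * t powr (- \<alpha> * (1 - \<theta>)) *
     EK_derivative (1 - \<theta>) a (- \<alpha>) \<alpha> (\<lambda>s. g s - g a) t"

definition caputo_hyper_bessel_exists_on ::
  "real set \<Rightarrow> real \<Rightarrow> real \<Rightarrow> real \<Rightarrow> (real \<Rightarrow> real) \<Rightarrow> bool" where
  "caputo_hyper_bessel_exists_on S \<theta> \<alpha> a g \<longleftrightarrow>
     EK_derivative_exists_on S (1 - \<theta>) a (- \<alpha>) \<alpha> (\<lambda>s. g s - g a)"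

(* The point t = 0 (present only if a = 0) is excluded from the identity because
   t^q is not defined there for q < 0 (and 0 powr 0 = 0). *)
definition weighted_C :: "real \<Rightarrow> real \<Rightarrow> real \<Rightarrow> (real \<Rightarrow> real) set" where
  "weighted_C \<mu> a T =
     {g. \<exists>q>\<mu>. \<exists>h. continuous_on {a..T} h \<and> (\<forall>t\<in>{a..T}. 0 < t \<longrightarrow> g t = t powr q * h t)}"

(* One-sided derivatives are taken at the end points of [0,1]. *)
definition nderiv01 :: "nat \<Rightarrow> (real \<Rightarrow> real) \<Rightarrow> real \<Rightarrow> real" where
  "nderiv01 n g = ((\<lambda>h x. vector_derivative h (at x within {0..1})) ^^ n) g"

definition Ck01 :: "nat \<Rightarrow> (real \<Rightarrow> real) set" where
  "Ck01 n = {g. (\<forall>i<n. \<forall>x\<in>{0..1}. nderiv01 i g differentiable (at x within {0..1})) \<and>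
                (\<forall>i\<le>n. continuous_on {0..1} (nderiv01 i g))}"

(* g is absolutely continuous on [0,1] with (a.e. / weak) derivative g' in L^1(0,1);
   this is the meaning of a derivative that is only assumed to be an L^1 or L^2 function. *)
definition has_L1_derivative01 :: "(real \<Rightarrow> real) \<Rightarrow> (real \<Rightarrow> real) \<Rightarrow> bool" where
  "has_L1_derivative01 g g' \<longleftrightarrow>
     set_integrable lborel {0..1} g' \<and>
     (\<forall>x\<in>{0..1}. g x = g 0 + (LINT y:{0..x}|lborel. g' y))"

definition is_solution ::
  "real \<Rightarrow> real \<Rightarrow> real \<Rightarrow> real \<Rightarrow> (real \<Rightarrow> real \<Rightarrow> real) \<Rightarrow> (real \<Rightarrow> real) \<Rightarrow>
   (real \<Rightarrow> real \<Rightarrow> real) \<Rightarrow> bool" where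
  "is_solution \<theta> \<alpha> a T f \<tau> u \<longleftrightarrow>
     (let \<Omega> = {0<..<1} \<times> {a<..<T} in
      continuous_on ({0..1} \<times> {a..T}) (\<lambda>(x, t). u x t) \<and>
      (\<forall>(x, t)\<in>\<Omega>. (\<lambda>y. u y t) differentiable (at x) \<and>
                   deriv (\<lambda>y. u y t) differentiable (at x)) \<and>
      continuous_on \<Omega> (\<lambda>(x, t). deriv (deriv (\<lambda>y. u y t)) x) \<and>
      (\<forall>x\<in>{0<..<1}. caputo_hyper_bessel_exists_on {a<..<T} \<theta> \<alpha> a (u x)) \<and>
      continuous_on \<Omega> (\<lambda>(x, t). caputo_hyper_bessel \<theta> \<alpha> a (u x) t) \<and>
      (\<forall>(x, t)\<in>\<Omega>. caputo_hyper_bessel \<theta> \<alpha> a (u x) t - deriv (deriv (\<lambda>y. u y t)) x = f x t) \<and>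
      (\<forall>t\<in>{a..T}. u 0 t = 0 \<and> u 1 t = 0) \<and>
      (\<forall>x\<in>{0..1}. u x a = \<tau> x))"

definition sine_coeff :: "(real \<Rightarrow> real) \<Rightarrow> nat \<Rightarrow> real" where
  "sine_coeff g k = 2 * (LINT x:{0..1}|lborel. g x * sin (real k * pi * x))"

definition G_coeff :: "real \<Rightarrow> real \<Rightarrow> real \<Rightarrow> (real \<Rightarrow> real \<Rightarrow> real) \<Rightarrow> nat \<Rightarrow> real \<Rightarrow> real" where
  "G_coeff p \<alpha> a f k t =
     1 / (p powr \<alpha> * Gamma \<alpha>) *
       (LINT s:{a..t}|lborel.
          (t powr p - s powr p) powr (\<alpha> - 1) * sine_coeff (\<lambda>x. f x s) k * (p * s powr (p - 1)))
     - (real k * pi)\<^sup>2 / p powr (2 * \<alpha>) *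
       (LINT s:{a..t}|lborel.
          (t powr p - s powr p) powr (2 * \<alpha> - 1) *
          mittag_leffler \<alpha> (2 * \<alpha>) (- ((real k * pi)\<^sup>2 / p powr \<alpha>) * (t powr p - s powr p) powr \<alpha>) *
          sine_coeff (\<lambda>x. f x s) k * (p * s powr (p - 1)))"

end

theory Submission
  imports Defs
begin

text \<open>
  In the variable \<open>z = t powr p - a powr p\<close> the regularized operator is \<open>p powr \<alpha>\<close> times the Caputo
  derivative of order \<open>\<alpha>\<close>, that is the \<open>z\<close>-derivative of the Riemann--Liouville integral of order
  \<open>1 - \<alpha>\<close> of \<open>g - g a\<close> (\<open>caputo_from_rl_derivative\<close>, \<open>rl_differentiable_from_EK\<close>).  The problem
  thereby becomes a fractional diffusion equation with memory starting at \<open>z = 0\<close>, which the sine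
  system splits into scalar equations.  With \<open>k = pker \<alpha>\<close> the kernel of fractional integration of
  order \<open>\<alpha>\<close>, \<open>c = p powr (- \<alpha>)\<close> and \<open>lam\<close> an eigenvalue of \<open>- d\<^sup>2/dx\<^sup>2\<close>, each mode satisfies the
  Volterra equation \<open>U = U 0 + c k * (F - lam U)\<close>.

  It is solved by means of the resolvent kernel \<open>r = mlk \<alpha> l \<alpha>\<close>, \<open>l = c lam\<close>, characterized by
  \<open>r = k - l (k * r)\<close> and given by a Mittag-Leffler series (\<open>mlk_resolvent\<close>, \<open>mode_equation\<close>); \<open>G_coeff\<close>
  is \<open>c\<close> times the convolution of \<open>r\<close> with the source (\<open>G_coeff_eq_conv\<close>).  Everything quantitative rests on the positivity
  of the resolvent (\<open>mlk_resolvent_pos\<close>), a consequence of the log-convexity of \<open>k\<close>.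
  It gives \<open>0 \<le> r \<le> k\<close>, it makes the relaxation function \<open>E\<^sub>\<alpha>(- l z\<^sup>\<alpha>)\<close> decrease within \<open>{0..1}\<close>, and
  together with the Volterra equation it bounds this function by \<open>\<Gamma>(\<alpha> + 1) / (l z\<^sup>\<alpha>)\<close>.

  Existence follows by summing the modes.  The initial coefficients are absolutely summable because
  \<open>\<tau>'\<close> is square integrable (Bessel), and the decay of the relaxation function compensates the factor
  \<open>lam\<close> in \<open>u\<^sub>x\<^sub>x\<close> away from \<open>z = 0\<close>.  The source coefficient number \<open>n\<close> is of size \<open>n\<^sup>-\<^sup>4\<close> times the
  weight \<open>t powr q\<close>, by four integrations by parts.  Hence all series converge uniformly where they have
  to be continuous or differentiated term by term (\<open>sol_equation\<close>).  The sums of the sine series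
  of \<open>\<tau>\<close> and \<open>f\<close> are identified by completeness of the sine system (\<open>sine_complete\<close>), a
  corollary of Weierstrass' theorem.

  Uniqueness: a difference \<open>W\<close> of two solutions is tested with sines.  Since \<open>W\<^sub>x\<^sub>x\<close> is
  controlled only in the open rectangle, the test takes place on \<open>{\<epsilon>..1 - \<epsilon>}\<close>, where the boundary terms
  involve \<open>W\<close> alone and vanish as \<open>\<epsilon> \<rightarrow> 0\<close>.  The integral of a mode of \<open>W\<close> then satisfies a homogeneous
  Volterra equation and is zero (\<open>volterra_zero\<close>), so completeness gives \<open>W = 0\<close> (\<open>solutions_agree\<close>).
\<close>

section \<open>Convolution on the half-line\<close>

text \<open>Integrating over the open interval keeps the values of the kernels at \<open>0\<close>, where they may be
  singular, out of consideration.\<close>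

definition conv :: "(real \<Rightarrow> real) \<Rightarrow> (real \<Rightarrow> real) \<Rightarrow> real \<Rightarrow> real" where
  "conv A B z = (LINT s:{0<..<z}|lborel. A (z - s) * B s)"

definition conv_integrable :: "(real \<Rightarrow> real) \<Rightarrow> (real \<Rightarrow> real) \<Rightarrow> real \<Rightarrow> bool" where
  "conv_integrable A B z \<longleftrightarrow> set_integrable lborel {0<..<z} (\<lambda>s. A (z - s) * B s)"

lemma conv_cong:
  assumes "\<And>s. \<lbrakk>0 < s; s < z\<rbrakk> \<Longrightarrow> A s = A' s" "\<And>s. \<lbrakk>0 < s; s < z\<rbrakk> \<Longrightarrow> B s = B' s"
  shows "conv A B z = conv A' B' z"
  unfolding conv_def by (intro set_lebesgue_integral_cong) (use assms in auto)

lemma conv_integrable_cong: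
  assumes "\<And>s. \<lbrakk>0 < s; s < z\<rbrakk> \<Longrightarrow> A s = A' s" "\<And>s. \<lbrakk>0 < s; s < z\<rbrakk> \<Longrightarrow> B s = B' s"
  shows "conv_integrable A B z \<longleftrightarrow> conv_integrable A' B' z"
  unfolding conv_integrable_def by (intro set_integrable_cong) (use assms in auto)

lemma conv_at_0 [simp]: "z \<le> 0 \<Longrightarrow> conv A B z = 0"
  by (simp add: conv_def set_lebesgue_integral_def)

lemma conv_nonneg:
  assumes "\<And>s. \<lbrakk>0 < s; s < z\<rbrakk> \<Longrightarrow> 0 \<le> A s" "\<And>s. \<lbrakk>0 < s; s < z\<rbrakk> \<Longrightarrow> 0 \<le> B s"
  shows "0 \<le> conv A B z"
  unfolding conv_def set_lebesgue_integral_def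
  by (intro integral_nonneg_AE AE_I2) (use assms in \<open>auto simp: indicator_def\<close>)

lemma conv_mono:
  assumes "conv_integrable A B z" "conv_integrable A' B' z"
    and "\<And>s. \<lbrakk>0 < s; s < z\<rbrakk> \<Longrightarrow> A (z - s) * B s \<le> A' (z - s) * B' s"
  shows "conv A B z \<le> conv A' B' z"
  unfolding conv_def by (rule set_integral_mono) (use assms in \<open>auto simp: conv_integrable_def\<close>)

lemma conv_add_right:
  assumes "conv_integrable A B z" "conv_integrable A B' z"
  shows "conv_integrable A (\<lambda>s. B s + B' s) z"
    and "conv A (\<lambda>s. B s + B' s) z = conv A B z + conv A B' z"
  using set_integral_add[OF assms[unfolded conv_integrable_def]]
  by (simp_all add: conv_def conv_integrable_def distrib_left)

lemma conv_diff_right: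
  assumes "conv_integrable A B z" "conv_integrable A B' z"
  shows "conv_integrable A (\<lambda>s. B s - B' s) z"
    and "conv A (\<lambda>s. B s - B' s) z = conv A B z - conv A B' z"
  using set_integral_diff[OF assms[unfolded conv_integrable_def]]
  by (simp_all add: conv_def conv_integrable_def right_diff_distrib)

lemma conv_diff_left:
  assumes "conv_integrable A B z" "conv_integrable A' B z"
  shows "conv_integrable (\<lambda>s. A s - A' s) B z"
    and "conv (\<lambda>s. A s - A' s) B z = conv A B z - conv A' B z"
  using set_integral_diff[OF assms[unfolded conv_integrable_def]]
  by (simp_all add: conv_def conv_integrable_def left_diff_distrib)

lemma conv_cmult_right:
  "conv A (\<lambda>s. c * B s) z = c * conv A B z"
  "conv_integrable A B z \<Longrightarrow> conv_integrable A (\<lambda>s. c * B s) z"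
  using set_integrable_mult_right[of c lborel "{0<..<z}" "\<lambda>s. A (z - s) * B s"]
  by (simp_all add: conv_def conv_integrable_def mult.left_commute[of _ c])

lemma conv_cmult_left:
  "conv (\<lambda>s. c * A s) B z = c * conv A B z"
  "conv_integrable A B z \<Longrightarrow> conv_integrable (\<lambda>s. c * A s) B z"
  using set_integrable_mult_right[of c lborel "{0<..<z}" "\<lambda>s. A (z - s) * B s"]
  by (simp_all add: conv_def conv_integrable_def mult.assoc)

lemma conv_dominated:
  assumes A[measurable]: "A \<in> borel_measurable borel"
    and B: "set_borel_measurable borel {0<..<z} B"
    and bd: "\<And>s. \<lbrakk>0 < s; s < z\<rbrakk> \<Longrightarrow> \<bar>A s\<bar> \<le> A' s" "\<And>s. \<lbrakk>0 < s; s < z\<rbrakk> \<Longrightarrow> \<bar>B s\<bar> \<le> B' s"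
    and int: "conv_integrable A' B' z"
  shows "conv_integrable A B z" and "\<bar>conv A B z\<bar> \<le> conv A' B' z"
proof -
  have [measurable]: "(\<lambda>s. indicator {0<..<z} s * B s) \<in> borel_measurable borel"
    using B by (simp add: set_borel_measurable_def)
  have meas: "(\<lambda>s. indicator {0<..<z} s *\<^sub>R (A (z - s) * B s)) \<in> borel_measurable lborel"
  proof -
    have "(\<lambda>s. A (z - s) * (indicator {0<..<z} s * B s)) \<in> borel_measurable lborel"
      by measurable
    also have "(\<lambda>s. A (z - s) * (indicator {0<..<z} s * B s))
        = (\<lambda>s. indicator {0<..<z} s *\<^sub>R (A (z - s) * B s))" by (auto simp: fun_eq_iff)
    finally show ?thesis .
  qed
  have le: "norm (indicator {0<..<z} s *\<^sub>R (A (z - s) * B s))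
      \<le> indicator {0<..<z} s *\<^sub>R (A' (z - s) * B' s)" for s
    using bd(1)[of "z - s"] bd(2)[of s]
    by (auto simp: indicator_def abs_mult intro!: mult_mono)
  show i: "conv_integrable A B z"
    unfolding conv_integrable_def set_integrable_def
    by (rule Bochner_Integration.integrable_bound[OF int[unfolded conv_integrable_def set_integrable_def] meas])
       (use order_trans[OF le abs_ge_self] in auto)
  have "norm (conv A B z) \<le> (LINT s|lborel. norm (indicator {0<..<z} s *\<^sub>R (A (z - s) * B s)))"
    unfolding conv_def set_lebesgue_integral_def by (rule integral_norm_bound)
  also have "\<dots> \<le> conv A' B' z"
    unfolding conv_def set_lebesgue_integral_def
    by (intro integral_mono le integrable_norm)
       (use i int in \<open>auto simp: conv_integrable_def set_integrable_def\<close>)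
  finally show "\<bar>conv A B z\<bar> \<le> conv A' B' z" by simp
qed

text \<open>Fubini on the triangle \<open>0 < r < s < z\<close>.  The kernels are nonnegative, so absolute
  integrability of the double integral can be read off from the convolution \<open>C\<close> of the kernels.\<close>

lemma conv_assoc:
  assumes [measurable]: "A \<in> borel_measurable borel" "B \<in> borel_measurable borel"
    and g: "set_borel_measurable borel {0<..<z} g"
    and nonneg: "\<And>x. \<lbrakk>0 < x; x < z\<rbrakk> \<Longrightarrow> 0 \<le> A x" "\<And>x. \<lbrakk>0 < x; x < z\<rbrakk> \<Longrightarrow> 0 \<le> B x"
    and C: "\<And>x. \<lbrakk>0 < x; x < z\<rbrakk> \<Longrightarrow> conv_integrable A B x"
           "\<And>x. \<lbrakk>0 < x; x < z\<rbrakk> \<Longrightarrow> conv A B x = C x"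
    and int: "conv_integrable C (\<lambda>s. \<bar>g s\<bar>) z"
  shows "conv_integrable A (conv B g) z" and "conv A (conv B g) z = conv C g z"
proof -
  define g' where "g' r = indicator {0<..<z} r * g r" for r
  define H where "H r s = (if r < s \<and> s < z then A (z - s) * B (s - r) * g' r else 0)" for r s
  have [measurable]: "g' \<in> borel_measurable borel"
    using g by (simp add: set_borel_measurable_def g'_def[abs_def])
  have meas [measurable]: "case_prod H \<in> borel_measurable (lborel \<Otimes>\<^sub>M lborel)"
    unfolding H_def by measurable
  have inner: "integrable lborel (\<lambda>s. if r < s \<and> s < z then A (z - s) * B (s - r) else 0) \<and>
     (LINT s|lborel. (if r < s \<and> s < z then A (z - s) * B (s - r) else 0)) = C (z - r)"
    if r: "0 < r" "r < z" for r
  proof -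
    have eq: "(\<lambda>x. if r < r + 1 * x \<and> r + 1 * x < z then A (z - (r + 1 * x)) * B (r + 1 * x - r) else 0)
      = (\<lambda>x. indicator {0<..<z - r} x *\<^sub>R (A (z - r - x) * B x))"
      by (auto simp: fun_eq_iff indicator_def algebra_simps)
    have "conv_integrable A B (z - r)" using C r by auto
    then show ?thesis
      using lborel_integrable_real_affine_iff[of 1 "\<lambda>s. if r < s \<and> s < z then A (z - s) * B (s - r) else 0" r]
        lborel_integral_real_affine[of 1 "\<lambda>s. if r < s \<and> s < z then A (z - s) * B (s - r) else 0" r]
        C(2)[of "z - r"] r
      unfolding eq by (auto simp: conv_integrable_def set_integrable_def conv_def set_lebesgue_integral_def)
  qed
  have int_s: "integrable lborel (H r)" "(LINT s|lborel. H r s) = indicator {0<..<z} r *\<^sub>R (C (z - r) * g r)"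
    "(LINT s|lborel. norm (H r s)) = indicator {0<..<z} r *\<^sub>R (C (z - r) * \<bar>g r\<bar>)" for r
  proof -
    have *: "H r = (\<lambda>s. g' r * (if r < s \<and> s < z then A (z - s) * B (s - r) else 0))"
      by (auto simp: H_def fun_eq_iff)
    have **: "(\<lambda>s. norm (H r s)) = (\<lambda>s. \<bar>g' r\<bar> * (if r < s \<and> s < z then A (z - s) * B (s - r) else 0))"
      using nonneg by (auto simp: H_def fun_eq_iff abs_mult g'_def indicator_def)
    show "integrable lborel (H r)" "(LINT s|lborel. H r s) = indicator {0<..<z} r *\<^sub>R (C (z - r) * g r)"
      unfolding * using inner[of r] by (cases "0 < r \<and> r < z"; auto simp: g'_def)+
    show "(LINT s|lborel. norm (H r s)) = indicator {0<..<z} r *\<^sub>R (C (z - r) * \<bar>g r\<bar>)"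
      unfolding ** using inner[of r] by (cases "0 < r \<and> r < z"; auto simp: g'_def)
  qed
  have H: "integrable (lborel \<Otimes>\<^sub>M lborel) (case_prod H)"
    by (rule lborel_pair.Fubini_integrable)
      (use int int_s in \<open>simp_all add: conv_integrable_def set_integrable_def del: real_norm_def\<close>)
  have int_r: "(LINT r|lborel. H r s) = indicator {0<..<z} s *\<^sub>R (A (z - s) * conv B g s)" for s
  proof (cases "0 < s \<and> s < z")
    case True
    have "(LINT r|lborel. H r s) = (LINT r|lborel. A (z - s) * (indicator {0<..<s} r *\<^sub>R (B (s - r) * g r)))"
      by (rule Bochner_Integration.integral_cong) (use True in \<open>auto simp: H_def g'_def indicator_def\<close>)
    then show ?thesis using True by (simp add: conv_def set_lebesgue_integral_def)
  next
    case False
    then have "H r s = 0" for r by (auto simp: H_def g'_def indicator_def)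
    then show ?thesis using False by auto
  qed
  show "conv A (conv B g) z = conv C g z"
    using lborel_pair.Fubini_integral[OF H]
    by (simp add: int_r int_s(2) conv_def[of A] conv_def[of C] set_lebesgue_integral_def)
  have "integrable lborel (\<lambda>s. LINT r|lborel. H r s)"
    using lborel_pair.integrable_snd[OF H] by simp
  then show "conv_integrable A (conv B g) z"
    by (simp add: int_r conv_integrable_def set_integrable_def)
qed

text \<open>Rescaling to the unit interval turns the dependence on \<open>z\<close> of the domain into a dependence of
  the integrand, to which dominated convergence applies.\<close>

lemma conv_scaled:
  assumes z: "0 < z"
  shows "conv A B z = z * (LINT \<sigma>:{0<..<1}|lborel. A (z * (1 - \<sigma>)) * B (z * \<sigma>))"
    and "conv_integrable A B z \<longleftrightarrow> set_integrable lborel {0<..<1} (\<lambda>\<sigma>. A (z * (1 - \<sigma>)) * B (z * \<sigma>))"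
proof -
  have eq: "(\<lambda>x. indicator {0<..<z} (0 + z * x) *\<^sub>R (A (z - (0 + z * x)) * B (0 + z * x)))
     = (\<lambda>\<sigma>. indicator {0<..<1} \<sigma> *\<^sub>R (A (z * (1 - \<sigma>)) * B (z * \<sigma>)))"
    using z by (auto simp: fun_eq_iff indicator_def algebra_simps zero_less_mult_iff)
  show "conv A B z = z * (LINT \<sigma>:{0<..<1}|lborel. A (z * (1 - \<sigma>)) * B (z * \<sigma>))"
    using lborel_integral_real_affine[of z "\<lambda>s. indicator {0<..<z} s *\<^sub>R (A (z - s) * B s)" 0] z
    unfolding eq by (simp add: conv_def set_lebesgue_integral_def)
  show "conv_integrable A B z \<longleftrightarrow> set_integrable lborel {0<..<1} (\<lambda>\<sigma>. A (z * (1 - \<sigma>)) * B (z * \<sigma>))"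
    using lborel_integrable_real_affine_iff[of z "\<lambda>s. indicator {0<..<z} s *\<^sub>R (A (z - s) * B s)" 0] z
    unfolding eq by (simp add: conv_integrable_def set_integrable_def)
qed

section \<open>The power kernels of fractional integration\<close>

definition pker :: "real \<Rightarrow> real \<Rightarrow> real" where
  "pker b z = z powr (b - 1) / Gamma b"

lemma pker_measurable [measurable]: "pker b \<in> borel_measurable borel"
  unfolding pker_def by measurable

lemma pker_nonneg [simp]: "0 < b \<Longrightarrow> 0 \<le> pker b z"
  by (simp add: pker_def less_imp_le)

lemma pker_pos: "\<lbrakk>0 < b; 0 < z\<rbrakk> \<Longrightarrow> 0 < pker b z"
  by (simp add: pker_def)

lemma pker_1: "0 < z \<Longrightarrow> pker 1 z = 1"
  by (simp add: pker_def)

text \<open>The semigroup law of fractional integration: after rescaling to the unit interval the convolution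
  is a Beta integral.\<close>

lemma conv_pker_pker:
  assumes ab: "0 < a" "0 < b" and z: "0 < z"
  shows "conv_integrable (pker a) (pker b) z" and "conv (pker a) (pker b) z = pker (a + b) z"
proof -
  define K where "K = z powr (a - 1) * z powr (b - 1) / (Gamma a * Gamma b)"
  have eq: "pker a (z * (1 - \<sigma>)) * pker b (z * \<sigma>) = K * (\<sigma> powr (b - 1) * (1 - \<sigma>) powr (a - 1))"
    if "\<sigma> \<in> {0<..<1}" for \<sigma>
    using that z by (simp add: pker_def K_def powr_mult)
  have int: "set_integrable lborel {0<..<1} (\<lambda>\<sigma>. \<sigma> powr (b - 1) * (1 - \<sigma>) powr (a - 1))"
    by (rule set_integrable_subset[OF integrable_Beta[OF ab(2,1)]]) auto
  have "(LINT \<sigma>:{0<..<1}|lborel. \<sigma> powr (b - 1) * (1 - \<sigma>) powr (a - 1))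
      = integral {0<..<1} (\<lambda>\<sigma>. \<sigma> powr (b - 1) * (1 - \<sigma>) powr (a - 1))"
    by (rule set_borel_integral_eq_integral(2)[OF int])
  also have "\<dots> = Beta b a"
    using has_integral_Beta_real[OF ab(2,1)]
    by (metis box_real(1) box_real(2) has_integral_Icc_iff_Ioo integral_unique)
  finally have B: "(LINT \<sigma>:{0<..<1}|lborel. \<sigma> powr (b - 1) * (1 - \<sigma>) powr (a - 1)) = Beta b a" .
  show "conv_integrable (pker a) (pker b) z"
    unfolding conv_scaled(2)[OF z]
    by (subst set_integrable_cong[OF refl refl eq]) (use int in auto)
  have "conv (pker a) (pker b) z = z * (LINT \<sigma>:{0<..<1}|lborel. K * (\<sigma> powr (b - 1) * (1 - \<sigma>) powr (a - 1)))"
    unfolding conv_scaled(1)[OF z] using eq by (intro arg_cong[of _ _ "\<lambda>x. z * x"] set_lebesgue_integral_cong) auto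
  also have "\<dots> = z * K * Beta b a" by (simp add: B)
  also have "\<dots> = pker (a + b) z"
  proof -
    have "z * (z powr (a - 1) * z powr (b - 1)) = z powr (a + b - 1)"
      using z by (simp add: powr_add[symmetric] powr_mult_base)
    moreover have "Gamma a \<noteq> 0" "Gamma b \<noteq> 0"
      using Gamma_real_pos[OF ab(1)] Gamma_real_pos[OF ab(2)] by linarith+
    ultimately show ?thesis
      by (simp add: K_def pker_def Beta_def add.commute)
  qed
  finally show "conv (pker a) (pker b) z = pker (a + b) z" .
qed

section \<open>Mittag-Leffler kernels\<close>

text \<open>Euler's integral restricted to \<open>{R..R + 1}\<close>.\<close>

lemma Gamma_ge_powr:
  fixes R x :: real
  assumes "1 \<le> R" "1 \<le> x"
  shows "R powr (x - 1) / exp (R + 1) \<le> Gamma x"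
proof -
  have G: "((\<lambda>t. t powr (x - 1) / exp t) has_integral Gamma x) {0..}"
    using Gamma_integral_real[of x] assms by simp
  have "(\<lambda>t. t powr (x - 1) / exp t) integrable_on {R..R + 1}"
    by (intro integrable_continuous_interval continuous_intros) (use assms in auto)
  then obtain I where I: "((\<lambda>t. t powr (x - 1) / exp t) has_integral I) {R..R + 1}"
    by blast
  have "R powr (x - 1) / exp (R + 1) \<le> I"
  proof (rule has_integral_le[OF _ I])
    show "((\<lambda>t. R powr (x - 1) / exp (R + 1)) has_integral R powr (x - 1) / exp (R + 1)) {R..R + 1}"
      using has_integral_const_real[of "R powr (x - 1) / exp (R + 1)" R "R + 1"] by simp
    fix t assume "t \<in> {R..R + 1}"
    then show "R powr (x - 1) / exp (R + 1) \<le> t powr (x - 1) / exp t"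
      using assms by (intro frac_le powr_mono2) auto
  qed
  also have "I \<le> Gamma x"
    by (rule has_integral_subset_le[OF _ I G]) (use assms in auto)
  finally show ?thesis .
qed

text \<open>Since \<open>\<Gamma>\<close> eventually dominates every exponential, the Mittag-Leffler series is compared with
  a geometric series of ratio at most \<open>1/2\<close>.\<close>

lemma summable_mittag_leffler:
  assumes "0 < \<alpha>" "0 < b"
  shows "summable (\<lambda>k. norm (x ^ k / Gamma (\<alpha> * real k + b)))" 
proof -
  \<comment> \<open>chosen so that consecutive terms of the majorant have ratio \<open>\<bar>x\<bar> / R powr \<alpha> \<le> 1 / 2\<close>\<close>
  define R where "R = max 1 ((2 * \<bar>x\<bar>) powr (1 / \<alpha>))"
  have R: "1 \<le> R" by (simp add: R_def)
  have "2 * \<bar>x\<bar> = ((2 * \<bar>x\<bar>) powr (1 / \<alpha>)) powr \<alpha>"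
    using assms by (simp add: powr_powr)
  also have "\<dots> \<le> R powr \<alpha>"
    using assms by (intro powr_mono2) (auto simp: R_def)
  finally have xR: "\<bar>x\<bar> / R powr \<alpha> \<le> 1 / 2"
    using R by (simp add: field_simps)
  define K where "K = exp (R + 1) / R powr (b - 1)"
  have "\<forall>\<^sub>F k in sequentially. norm (norm (x ^ k / Gamma (\<alpha> * real k + b))) \<le> K * (1 / 2) ^ k"
    using eventually_ge_at_top[of "nat \<lceil>1 / \<alpha>\<rceil>"]
  proof eventually_elim
    fix k assume "nat \<lceil>1 / \<alpha>\<rceil> \<le> k"
    then have "1 / \<alpha> \<le> real k" by linarith
    then have k: "1 \<le> \<alpha> * real k + b" using assms by (simp add: field_simps)
    have pos: "0 < R powr (\<alpha> * real k + b - 1) / exp (R + 1)" using R by simp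
    have "norm (norm (x ^ k / Gamma (\<alpha> * real k + b))) = \<bar>x\<bar> ^ k / Gamma (\<alpha> * real k + b)"
      using Gamma_real_pos[of "\<alpha> * real k + b"] k by (simp add: power_abs)
    also have "\<dots> \<le> \<bar>x\<bar> ^ k / (R powr (\<alpha> * real k + b - 1) / exp (R + 1))"
      using Gamma_ge_powr[OF R k] pos by (intro divide_left_mono mult_pos_pos) auto
    also have "\<dots> = K * (\<bar>x\<bar> / R powr \<alpha>) ^ k"
    proof -
      have "R powr (\<alpha> * real k + b - 1) = (R powr \<alpha>) ^ k * R powr (b - 1)"
        using R by (simp add: powr_add[symmetric] powr_power algebra_simps)
      then show ?thesis by (simp add: K_def power_divide mult.commute)
    qed
    also have "\<dots> \<le> K * (1 / 2) ^ k"
      using xR by (intro mult_left_mono power_mono) (auto simp: K_def)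
    finally show "norm (norm (x ^ k / Gamma (\<alpha> * real k + b))) \<le> K * (1 / 2) ^ k" .
  qed
  then show ?thesis
    by (rule summable_comparison_test_ev) (intro summable_mult summable_geometric, simp)
qed

lemma mittag_leffler_sums:
  assumes "0 < \<alpha>" "0 < b"
  shows "(\<lambda>k. x ^ k / Gamma (\<alpha> * real k + b)) sums mittag_leffler \<alpha> b x"
  using summable_norm_cancel[OF summable_mittag_leffler[OF assms]]
  by (simp add: mittag_leffler_def summable_sums)

lemma isCont_mittag_leffler:
  assumes "0 < \<alpha>" "0 < b"
  shows "isCont (mittag_leffler \<alpha> b) x"
proof -
  have "mittag_leffler \<alpha> b = (\<lambda>x. \<Sum>k. (1 / Gamma (\<alpha> * real k + b)) * x ^ k)"
    by (simp add: mittag_leffler_def fun_eq_iff)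
  moreover have "summable (\<lambda>k. (1 / Gamma (\<alpha> * real k + b)) * y ^ k)" for y
    using summable_norm_cancel[OF summable_mittag_leffler[OF assms, of y]] by simp
  ultimately show ?thesis
    using isCont_powser_converges_everywhere[of "\<lambda>k. 1 / Gamma (\<alpha> * real k + b)" x] by simp
qed

lemma continuous_on_mittag_leffler [continuous_intros]:
  assumes "0 < \<alpha>" "0 < b" "continuous_on S g"
  shows "continuous_on S (\<lambda>x. mittag_leffler \<alpha> b (g x))"
  by (rule continuous_on_compose2[OF _ assms(3), of UNIV])
     (use isCont_mittag_leffler[OF assms(1,2)] in \<open>auto simp: continuous_on_eq_continuous_at\<close>)

lemma mittag_leffler_0: "mittag_leffler \<alpha> b 0 = 1 / Gamma b"
proof -
  have "mittag_leffler \<alpha> b 0 = (\<Sum>k. (1 / Gamma (\<alpha> * real k + b)) * 0 ^ k)"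
    by (simp add: mittag_leffler_def)
  also have "\<dots> = 1 / Gamma b"
    by (subst powser_zero) simp
  finally show ?thesis .
qed

text \<open>The kernel with Laplace transform \<open>s powr (\<alpha> - b) / (s powr \<alpha> + l)\<close>.  For \<open>b = \<alpha>\<close> it is the
  resolvent of \<open>l * pker \<alpha>\<close> divided by \<open>l\<close>, for \<open>b = 1\<close> the relaxation function \<open>E\<^sub>\<alpha>(- l z\<^sup>\<alpha>)\<close>.\<close>

definition mlk :: "real \<Rightarrow> real \<Rightarrow> real \<Rightarrow> real \<Rightarrow> real" where
  "mlk \<alpha> l b z = z powr (b - 1) * mittag_leffler \<alpha> b (- l * z powr \<alpha>)"

lemma mlk_measurable:
  assumes "0 < \<alpha>" "0 < b"
  shows "mlk \<alpha> l b \<in> borel_measurable borel"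
proof -
  have [measurable]: "mittag_leffler \<alpha> b \<in> borel_measurable borel"
    by (intro borel_measurable_continuous_onI continuous_on_mittag_leffler assms continuous_on_id)
  show ?thesis unfolding mlk_def by measurable
qed

lemma continuous_on_mlk:
  assumes "0 < \<alpha>" "0 < b"
  shows "continuous_on {0<..} (mlk \<alpha> l b)"
  unfolding mlk_def by (intro continuous_intros assms) auto

lemma mlk_sums:
  assumes "0 < \<alpha>" "0 < b" "0 < z"
  shows "(\<lambda>n. (- l) ^ n * pker (\<alpha> * real n + b) z) sums mlk \<alpha> l b z"
    and "summable (\<lambda>n. \<bar>(- l) ^ n * pker (\<alpha> * real n + b) z\<bar>)"
proof -
  have eq: "z powr (b - 1) * ((- l * z powr \<alpha>) ^ n / Gamma (\<alpha> * real n + b))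
      = (- l) ^ n * pker (\<alpha> * real n + b) z" for n
  proof -
    have "z powr (\<alpha> * real n + b - 1) = z powr (b - 1) * (z powr \<alpha>) ^ n"
      using assms by (simp add: powr_add[symmetric] powr_power algebra_simps)
    then show ?thesis by (simp only: pker_def power_mult_distrib) (simp add: field_simps)
  qed
  show "(\<lambda>n. (- l) ^ n * pker (\<alpha> * real n + b) z) sums mlk \<alpha> l b z"
    using sums_mult[OF mittag_leffler_sums[OF assms(1,2)], of "z powr (b - 1)" "- l * z powr \<alpha>"]
    unfolding eq mlk_def .
  show "summable (\<lambda>n. \<bar>(- l) ^ n * pker (\<alpha> * real n + b) z\<bar>)"
    using summable_mult[OF summable_mittag_leffler[OF assms(1,2)], of "\<bar>z powr (b - 1)\<bar>" "- l * z powr \<alpha>"]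
    unfolding real_norm_def abs_mult[symmetric] eq .
qed

text \<open>A shift of the index in the Mittag-Leffler series.\<close>

lemma mlk_recurrence:
  assumes "0 < \<alpha>" "0 < b" "0 < z"
  shows "mlk \<alpha> l b z = pker b z - l * mlk \<alpha> l (b + \<alpha>) z"
proof -
  have "(\<lambda>n. (- l) ^ Suc n * pker (\<alpha> * real (Suc n) + b) z) sums (mlk \<alpha> l b z - pker b z)"
    using mlk_sums(1)[OF assms, of l] by (subst sums_Suc_iff) simp
  moreover have "(\<lambda>n. (- l) ^ Suc n * pker (\<alpha> * real (Suc n) + b) z) sums (- l * mlk \<alpha> l (b + \<alpha>) z)"
    using sums_mult[OF mlk_sums(1)[of \<alpha> "b + \<alpha>" z l], of "- l"] assms by (simp add: algebra_simps)
  ultimately have "mlk \<alpha> l b z - pker b z = - l * mlk \<alpha> l (b + \<alpha>) z"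
    using sums_unique2 by blast
  then show ?thesis by simp
qed

text \<open>Fractional integration acts on the series term by term through the Beta integral.\<close>

lemma conv_pker_mlk:
  assumes "0 < \<alpha>" and bg: "0 < b" "0 < g" and z: "0 < z"
  shows "conv_integrable (pker g) (mlk \<alpha> l b) z"
    and "conv (pker g) (mlk \<alpha> l b) z = mlk \<alpha> l (b + g) z"
proof -
  define f where "f n s = indicator {0<..<z} s *\<^sub>R (pker g (z - s) * ((- l) ^ n * pker (\<alpha> * real n + b) s))" for n s
  have pos: "0 < \<alpha> * real n + b" for n
    using assms by (intro add_nonneg_pos) auto
  have c: "conv_integrable (pker g) (pker (\<alpha> * real n + b)) z"
    "conv (pker g) (pker (\<alpha> * real n + b)) z = pker (\<alpha> * real n + (b + g)) z" for n
    using conv_pker_pker[OF bg(2) pos z, of n] by (simp_all add: algebra_simps)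
  have int: "integrable lborel (f n)" for n
    using conv_cmult_right(2)[OF c(1), of "(- l) ^ n" n]
    by (simp add: f_def[abs_def] conv_integrable_def set_integrable_def)
  have val: "(LINT s|lborel. f n s) = (- l) ^ n * pker (\<alpha> * real n + (b + g)) z" for n
    using conv_cmult_right(1)[of "pker g" "(- l) ^ n" "pker (\<alpha> * real n + b)" z]
    by (simp add: f_def conv_def set_lebesgue_integral_def flip: c(2))
  have norm_val: "(LINT s|lborel. norm (f n s)) = \<bar>(- l) ^ n * pker (\<alpha> * real n + (b + g)) z\<bar>" for n
  proof -
    have "(LINT s|lborel. norm (f n s)) = (LINT s|lborel. indicator {0<..<z} s *\<^sub>R (pker g (z - s) * (\<bar>l\<bar> ^ n * pker (\<alpha> * real n + b) s)))"
      by (rule Bochner_Integration.integral_cong)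
        (use pos[of n] bg in \<open>auto simp: f_def abs_mult power_abs indicator_def\<close>)
    also have "\<dots> = \<bar>l\<bar> ^ n * pker (\<alpha> * real n + (b + g)) z"
      using conv_cmult_right(1)[of "pker g" "\<bar>l\<bar> ^ n" "pker (\<alpha> * real n + b)" z]
      by (simp add: conv_def set_lebesgue_integral_def flip: c(2))
    also have "\<dots> = \<bar>(- l) ^ n * pker (\<alpha> * real n + (b + g)) z\<bar>"
      using pos[of n] bg by (simp add: abs_mult power_abs)
    finally show ?thesis .
  qed
  have sums: "(\<lambda>n. f n s) sums ((indicator {0<..<z} s *\<^sub>R (pker g (z - s) * mlk \<alpha> l b s)) :: real)" for s
    using sums_mult[OF mlk_sums(1)[OF assms(1,2), of s l], of "pker g (z - s)"]
    by (cases "s \<in> {0<..<z}") (auto simp: f_def)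
  have summ: "AE s in lborel. summable (\<lambda>n. norm (f n s))"
  proof (rule AE_I2)
    fix s show "summable (\<lambda>n. norm (f n s))"
      using summable_mult[OF mlk_sums(2)[OF assms(1,2), of s l], of "\<bar>pker g (z - s)\<bar>"]
      by (cases "s \<in> {0<..<z}") (auto simp: f_def abs_mult)
  qed
  have sumint: "summable (\<lambda>n. LINT s|lborel. norm (f n s))"
    unfolding norm_val using mlk_sums(2)[of \<alpha> "b + g" z l] assms by simp
  have eq: "(\<lambda>s. \<Sum>n. f n s) = (\<lambda>s. indicator {0<..<z} s *\<^sub>R (pker g (z - s) * mlk \<alpha> l b s))"
    using sums by (auto simp: sums_iff)
  show "conv_integrable (pker g) (mlk \<alpha> l b) z"
    using integrable_suminf[OF int summ sumint] by (simp add: eq conv_integrable_def set_integrable_def)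
  have "(\<lambda>n. LINT s|lborel. f n s) sums (LINT s|lborel. (\<Sum>n. f n s))"
    by (rule sums_integral[OF int summ sumint])
  moreover have "(\<lambda>n. LINT s|lborel. f n s) sums mlk \<alpha> l (b + g) z"
    unfolding val using mlk_sums(1)[of \<alpha> "b + g" z l] assms by simp
  ultimately show "conv (pker g) (mlk \<alpha> l b) z = mlk \<alpha> l (b + g) z"
    using sums_unique2 by (force simp: eq conv_def set_lebesgue_integral_def)
qed

subsection \<open>Positivity of the resolvent kernel\<close>

lemma mlk_resolvent:
  assumes "0 < \<alpha>" "0 < z"
  shows "mlk \<alpha> l \<alpha> z = pker \<alpha> z - l * conv (pker \<alpha>) (mlk \<alpha> l \<alpha>) z"
  using mlk_recurrence[of \<alpha> \<alpha> z l] conv_pker_mlk(2)[of \<alpha> \<alpha> \<alpha> z l] assms by simp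

lemma integral_pker_reflected:
  assumes "0 < a" "x < y"
  shows "set_integrable lborel {x<..<y} (\<lambda>s. pker a (y - s))"
    and "(LINT s:{x<..<y}|lborel. pker a (y - s)) = pker (a + 1) (y - x)"
proof -
  have eq: "(\<lambda>s. indicator {x<..<y} (x + 1 * s) *\<^sub>R pker a (y - (x + 1 * s)))
     = (\<lambda>s. indicator {0<..<y - x} s *\<^sub>R (pker a (y - x - s) * pker 1 s))"
    by (auto simp: fun_eq_iff indicator_def pker_1 algebra_simps)
  show "set_integrable lborel {x<..<y} (\<lambda>s. pker a (y - s))"
    using lborel_integrable_real_affine_iff[of 1 "\<lambda>s. indicator {x<..<y} s *\<^sub>R pker a (y - s)" x]
      conv_pker_pker(1)[of a 1 "y - x"] assms
    unfolding eq by (simp add: set_integrable_def conv_integrable_def)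
  show "(LINT s:{x<..<y}|lborel. pker a (y - s)) = pker (a + 1) (y - x)"
    using lborel_integral_real_affine[of 1 "\<lambda>s. indicator {x<..<y} s *\<^sub>R pker a (y - s)" x]
      conv_pker_pker(2)[of a 1 "y - x"] assms
    unfolding eq by (simp add: set_lebesgue_integral_def conv_def)
qed

text \<open>The solution \<open>r\<close> of \<open>r = k - l (k * r)\<close>, \<open>k = pker \<alpha>\<close>, is positive because \<open>k\<close> is
  log-convex.  At a first zero \<open>z\<^sub>0\<close> the equation would give
  \<open>k z\<^sub>0 \<le> l (k * r) z\<^sub>0\<close>.  Log-convexity bounds the part of this convolution over
  \<open>{0<..<z\<^sub>1}\<close> by \<open>k z\<^sub>0 / k z\<^sub>1\<close> times the convolution at \<open>z\<^sub>1\<close>, so \<open>l\<close> times this part is at most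
  \<open>k z\<^sub>0 - r z\<^sub>1 k z\<^sub>0 / k z\<^sub>1\<close>.  If \<open>z\<^sub>1\<close> maximises \<open>r\<close> on a short interval ending at
  \<open>z\<^sub>0\<close>, the remaining part is too small to make up for the term \<open>r z\<^sub>1 k z\<^sub>0 / k z\<^sub>1\<close>.\<close>

lemma mlk_resolvent_pos:
  assumes \<alpha>: "0 < \<alpha>" "\<alpha> \<le> 1" and l: "0 < l" and z: "0 < z"
  shows "0 < mlk \<alpha> l \<alpha> z"
proof (rule ccontr)
  assume neg: "\<not> 0 < mlk \<alpha> l \<alpha> z"
  define k r where "k = pker \<alpha>" and "r = mlk \<alpha> l \<alpha>"
  define \<rho> where "\<rho> x = mittag_leffler \<alpha> \<alpha> (- l * x powr \<alpha>)" for x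
  have r: "r x = x powr (\<alpha> - 1) * \<rho> x" for x by (simp add: r_def mlk_def \<rho>_def)
  have cont: "continuous_on {0..z} \<rho>"
    unfolding \<rho>_def by (intro continuous_intros continuous_on_powr' \<alpha>) (use \<alpha> in auto)
  define S where "S = {x \<in> {0..z}. \<rho> x \<le> 0}"
  have "closed S" unfolding S_def
    using continuous_closed_preimage[OF cont closed_atLeastAtMost closed_atMost[of 0]]
    by (simp add: vimage_def Int_def)
  then have "compact S"
    by (auto simp: compact_eq_bounded_closed S_def intro: bounded_subset[OF bounded_closed_interval[of 0 z]])
  moreover have "z \<in> S" using neg z by (auto simp: S_def mlk_def \<rho>_def zero_less_mult_iff)
  ultimately obtain z0 where z0: "z0 \<in> S" and least: "\<And>x. x \<in> S \<Longrightarrow> z0 \<le> x"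
    using compact_attains_inf[of S] by blast
  have "0 < \<rho> 0" using Gamma_real_pos[OF \<alpha>(1)] by (simp add: \<rho>_def mittag_leffler_0)
  then have "0 < z0" "z0 \<le> z" using z0 by (auto simp: S_def less_le)
  have pos: "0 < r x" if "0 < x" "x < z0" for x
    using least[of x] that \<open>z0 \<le> z\<close> by (force simp: S_def r not_le intro: mult_pos_pos)
  have rz0: "r z0 \<le> 0" using z0 by (auto simp: S_def r mult_nonneg_nonpos)
  have contr: "continuous_on {0<..} r"
    unfolding r_def by (rule continuous_on_mlk[OF \<alpha>(1) \<alpha>(1)])
  have ci: "conv_integrable k r x" if "0 < x" for x
    unfolding k_def r_def by (rule conv_pker_mlk(1)) (use \<alpha> that in auto)
  have req: "r x = k x - l * conv k r x" if "0 < x" for x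
    unfolding k_def r_def by (rule mlk_resolvent) (use \<alpha> that in auto)
  \<comment> \<open>\<open>h \<le> z0 / 2\<close> keeps the ratio \<open>k z0 / k z1\<close> above \<open>1 / 2\<close>; the other bound makes the mass
    \<open>l * pker (\<alpha> + 1) h\<close> of the kernel over the last interval smaller than \<open>1 / 2\<close>\<close>
  define h where "h = min (z0 / 2) ((Gamma (\<alpha> + 1) / (4 * l)) powr (1 / \<alpha>))"
  have G: "0 < Gamma (\<alpha> + 1)" using \<alpha> by simp
  have h: "0 < h" "h \<le> z0 / 2" using \<open>0 < z0\<close> G l by (auto simp: h_def)
  have "h powr \<alpha> \<le> ((Gamma (\<alpha> + 1) / (4 * l)) powr (1 / \<alpha>)) powr \<alpha>"
    using h \<alpha> by (intro powr_mono2) (auto simp: h_def)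
  also have "\<dots> = Gamma (\<alpha> + 1) / (4 * l)" using \<alpha> G l by (simp add: powr_powr)
  finally have hpow: "l * pker (\<alpha> + 1) h < 1 / 2"
    using G l by (simp add: pker_def field_simps)
  obtain z1 where z1: "z1 \<in> {z0 - h..z0}" and max: "\<And>x. x \<in> {z0 - h..z0} \<Longrightarrow> r x \<le> r z1"
  proof -
    have "continuous_on {z0 - h..z0} r"
      by (rule continuous_on_subset[OF contr]) (use h \<open>0 < z0\<close> in auto)
    then show thesis
      using continuous_attains_sup[of "{z0 - h..z0}" r] that h by force
  qed
  have rz1: "0 < r z1"
    using max[of "z0 - h"] pos[of "z0 - h"] h \<open>0 < z0\<close> by auto
  then have "z1 < z0" using rz0 z1 by (cases "z1 = z0") auto
  have z1h: "z0 / 2 \<le> z1" and "0 < z1" using z1 h \<open>0 < z0\<close> by auto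
  define q where "q = k z0 / k z1"
  have kpos: "0 < k x" if "0 < x" for x using pker_pos[OF \<alpha>(1) that] by (simp add: k_def)
  have q: "1 / 2 \<le> q"
  proof -
    have "q = (z0 / z1) powr (\<alpha> - 1)"
      using \<open>0 < z0\<close> \<open>0 < z1\<close> G Gamma_real_pos[OF \<alpha>(1)]
      by (simp add: q_def k_def pker_def powr_divide)
    also have "\<dots> \<ge> 2 powr (\<alpha> - 1)"
      using \<open>0 < z0\<close> \<open>0 < z1\<close> z1h \<alpha> by (intro powr_mono2') (auto simp: field_simps)
    finally have "2 powr (\<alpha> - 1) \<le> q" .
    moreover have "2 powr (-1) \<le> 2 powr (\<alpha> - 1 :: real)"
      using \<alpha> by (intro powr_mono) auto
    ultimately show ?thesis by (simp add: powr_minus)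
  qed
  \<comment> \<open>\<open>(u + h) / u\<close> decreases in \<open>u\<close>, so \<open>k (u + h) / k u\<close> increases and is largest at \<open>u = z1\<close>\<close>
  have logconv: "k (z0 - s) \<le> q * k (z1 - s)" if "0 < s" "s < z1" for s
  proof -
    have le: "z0 / z1 \<le> (z0 - s) / (z1 - s)"
    proof -
      have "z1 * s \<le> z0 * s" using \<open>z1 < z0\<close> that by simp
      then have "z0 * (z1 - s) \<le> (z0 - s) * z1" by (simp add: algebra_simps)
      then show ?thesis using that \<open>0 < z1\<close> by (simp add: divide_le_eq pos_le_divide_eq mult.commute)
    qed
    have "k (z0 - s) = ((z0 - s) / (z1 - s)) powr (\<alpha> - 1) * k (z1 - s)"
      using that \<open>z1 < z0\<close> by (simp add: k_def pker_def powr_divide)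
    also have "\<dots> \<le> (z0 / z1) powr (\<alpha> - 1) * k (z1 - s)"
      using le that \<open>0 < z0\<close> \<open>0 < z1\<close> \<alpha> kpos[of "z1 - s"] by (intro mult_right_mono powr_mono2') auto
    also have "(z0 / z1) powr (\<alpha> - 1) = q"
      using \<open>0 < z0\<close> \<open>0 < z1\<close> Gamma_real_pos[OF \<alpha>(1)]
      by (simp add: q_def k_def pker_def powr_divide)
    finally show ?thesis .
  qed
  have int0: "set_integrable lborel {0<..<z0} (\<lambda>s. k (z0 - s) * r s)"
    using ci[OF \<open>0 < z0\<close>] by (simp add: conv_integrable_def)
  have i1: "set_integrable lborel {0<..<z1} (\<lambda>s. k (z0 - s) * r s)"
    and i2: "set_integrable lborel {z1<..<z0} (\<lambda>s. k (z0 - s) * r s)"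
    by (rule set_integrable_subset[OF int0]; use \<open>0 < z1\<close> \<open>z1 < z0\<close> in auto)+
  have "conv k r z0 = (LINT s:{0<..<z1} \<union> {z1<..<z0}|lborel. k (z0 - s) * r s)"
    unfolding conv_def set_lebesgue_integral_def
    by (rule integral_cong_AE)
       (use int0 i1 i2 \<open>0 < z1\<close> \<open>z1 < z0\<close> AE_lborel_singleton[of z1] set_integrable_Un[OF i1 i2]
        in \<open>auto simp: set_integrable_def indicator_def elim!: eventually_mono\<close>)
  also have "\<dots> = (LINT s:{0<..<z1}|lborel. k (z0 - s) * r s) + (LINT s:{z1<..<z0}|lborel. k (z0 - s) * r s)"
    by (rule set_integral_Un[OF _ i1 i2]) auto
  also have "(LINT s:{0<..<z1}|lborel. k (z0 - s) * r s) \<le> (LINT s:{0<..<z1}|lborel. q * (k (z1 - s) * r s))"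
  proof (rule set_integral_mono[OF i1])
    show "set_integrable lborel {0<..<z1} (\<lambda>s. q * (k (z1 - s) * r s))"
      using ci[OF \<open>0 < z1\<close>] by (simp add: conv_integrable_def)
    fix s assume s: "s \<in> {0<..<z1}"
    then have "k (z0 - s) * r s \<le> (q * k (z1 - s)) * r s"
      using logconv[of s] pos[of s] \<open>z1 < z0\<close> by (intro mult_right_mono) auto
    then show "k (z0 - s) * r s \<le> q * (k (z1 - s) * r s)" by (simp add: mult.assoc)
  qed
  also have "(LINT s:{0<..<z1}|lborel. q * (k (z1 - s) * r s)) = q * conv k r z1"
    by (simp add: conv_def)
  also have "(LINT s:{z1<..<z0}|lborel. k (z0 - s) * r s) \<le> (LINT s:{z1<..<z0}|lborel. r z1 * k (z0 - s))"
  proof (rule set_integral_mono[OF i2])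
    show "set_integrable lborel {z1<..<z0} (\<lambda>s. r z1 * k (z0 - s))"
      using integral_pker_reflected(1)[OF \<alpha>(1) \<open>z1 < z0\<close>] by (simp add: k_def)
    fix s assume s: "s \<in> {z1<..<z0}"
    have "k (z0 - s) * r s \<le> k (z0 - s) * r z1"
      using s z1 kpos[of "z0 - s"] by (intro mult_left_mono max) auto
    then show "k (z0 - s) * r s \<le> r z1 * k (z0 - s)" by (simp add: mult.commute)
  qed
  also have "(LINT s:{z1<..<z0}|lborel. r z1 * k (z0 - s)) = r z1 * pker (\<alpha> + 1) (z0 - z1)"
    using integral_pker_reflected(2)[OF \<alpha>(1) \<open>z1 < z0\<close>] by (simp add: k_def)
  also have "pker (\<alpha> + 1) (z0 - z1) \<le> pker (\<alpha> + 1) h"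
    using z1 \<open>z1 < z0\<close> G \<alpha> unfolding pker_def by (intro divide_right_mono powr_mono2) auto
  finally have "conv k r z0 \<le> q * conv k r z1 + r z1 * pker (\<alpha> + 1) h"
    using rz1 by (simp add: mult_left_mono)
  then have "l * conv k r z0 \<le> q * (l * conv k r z1) + r z1 * (l * pker (\<alpha> + 1) h)"
    using mult_left_mono[OF _ less_imp_le[OF l]] by (fastforce simp: algebra_simps)
  also have "l * conv k r z1 = k z1 - r z1" using req[OF \<open>0 < z1\<close>] by simp
  also have "q * (k z1 - r z1) = k z0 - q * r z1"
    using kpos[OF \<open>0 < z1\<close>] by (simp add: q_def right_diff_distrib)
  also have "r z1 * (l * pker (\<alpha> + 1) h) < r z1 * (1 / 2)"
    using hpow rz1 by (intro mult_strict_left_mono) auto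
  also have "r z1 * (1 / 2) \<le> q * r z1" using q rz1 by (simp add: mult.commute)
  finally have "l * conv k r z0 < k z0" by simp
  then show False using req[OF \<open>0 < z0\<close>] rz0 by simp
qed

lemma mlk_resolvent_le:
  assumes \<alpha>: "0 < \<alpha>" "\<alpha> \<le> 1" and l: "0 < l" and z: "0 < z"
  shows "mlk \<alpha> l \<alpha> z \<le> pker \<alpha> z"
proof -
  have "0 \<le> conv (pker \<alpha>) (mlk \<alpha> l \<alpha>) z"
    by (rule conv_nonneg) (use mlk_resolvent_pos[OF \<alpha> l] \<alpha> in \<open>auto simp: less_imp_le\<close>)
  then show ?thesis using mlk_resolvent[OF \<alpha>(1) z] l by simp
qed

lemma mlk_Suc_nonneg:
  assumes \<alpha>: "0 < \<alpha>" "\<alpha> \<le> 1" and l: "0 < l" and z: "0 < z"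
  shows "0 \<le> mlk \<alpha> l (\<alpha> + 1) z"
proof -
  have "0 \<le> conv (pker 1) (mlk \<alpha> l \<alpha>) z"
    by (rule conv_nonneg) (use mlk_resolvent_pos[OF \<alpha> l] \<alpha> in \<open>auto simp: less_imp_le\<close>)
  then show ?thesis using conv_pker_mlk(2)[of \<alpha> \<alpha> 1 z l] assms by simp
qed

text \<open>Since \<open>pker \<alpha>\<close> is nonincreasing, \<open>pker \<alpha> z\<close> times the integral of the positive resolvent over
  \<open>{0<..<z}\<close> is at most its convolution with \<open>pker \<alpha>\<close>, which the resolvent equation bounds by
  \<open>pker \<alpha> z / l\<close>.  So \<open>l\<close> times this integral, which is \<open>1 - mlk \<alpha> l 1 z\<close>, lies in \<open>{0..1}\<close>.\<close>

lemma relaxation_bounds: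
  assumes \<alpha>: "0 < \<alpha>" "\<alpha> \<le> 1" and l: "0 < l" and z: "0 < z"
  shows "0 \<le> mlk \<alpha> l 1 z" and "mlk \<alpha> l 1 z \<le> 1"
proof -
  have e: "mlk \<alpha> l 1 z = 1 - l * mlk \<alpha> l (\<alpha> + 1) z"
    using mlk_recurrence[of \<alpha> 1 z l] assms by (simp add: pker_1 add.commute)
  then show "mlk \<alpha> l 1 z \<le> 1" using mlk_Suc_nonneg[OF assms] l by simp
  have "conv (\<lambda>_. pker \<alpha> z) (mlk \<alpha> l \<alpha>) z \<le> conv (pker \<alpha>) (mlk \<alpha> l \<alpha>) z"
  proof (rule conv_mono)
    have "conv_integrable (\<lambda>s. pker \<alpha> z * pker 1 s) (mlk \<alpha> l \<alpha>) z"
      by (rule conv_cmult_left(2)) (use conv_pker_mlk(1)[of \<alpha> \<alpha> 1 z l] assms in simp)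
    then show "conv_integrable (\<lambda>_. pker \<alpha> z) (mlk \<alpha> l \<alpha>) z"
      by (subst (asm) conv_integrable_cong[where A' = "\<lambda>_. pker \<alpha> z"]) (auto simp: pker_1)
    show "conv_integrable (pker \<alpha>) (mlk \<alpha> l \<alpha>) z"
      by (rule conv_pker_mlk(1)) (use assms in auto)
    fix s assume s: "0 < s" "s < z"
    have "pker \<alpha> z \<le> pker \<alpha> (z - s)"
      using s \<alpha> Gamma_real_pos[OF \<alpha>(1)] unfolding pker_def by (intro divide_right_mono powr_mono2') auto
    then show "pker \<alpha> z * mlk \<alpha> l \<alpha> s \<le> pker \<alpha> (z - s) * mlk \<alpha> l \<alpha> s"
      using mlk_resolvent_pos[OF \<alpha> l s(1)] by (intro mult_right_mono) auto
  qed
  also have "conv (\<lambda>_. pker \<alpha> z) (mlk \<alpha> l \<alpha>) z = conv (\<lambda>s. pker \<alpha> z * pker 1 s) (mlk \<alpha> l \<alpha>) z"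
    by (rule conv_cong) (auto simp: pker_1)
  also have "\<dots> = pker \<alpha> z * mlk \<alpha> l (\<alpha> + 1) z"
    using conv_cmult_left(1) conv_pker_mlk(2)[of \<alpha> \<alpha> 1 z l] assms by simp
  finally have "l * (pker \<alpha> z * mlk \<alpha> l (\<alpha> + 1) z) \<le> l * conv (pker \<alpha>) (mlk \<alpha> l \<alpha>) z"
    using l by simp
  also have "\<dots> \<le> pker \<alpha> z"
    using mlk_resolvent[OF \<alpha>(1) z, of l] mlk_resolvent_pos[OF assms] by simp
  finally have "pker \<alpha> z * (l * mlk \<alpha> l (\<alpha> + 1) z) \<le> pker \<alpha> z * 1" by (simp add: mult_ac)
  then have "l * mlk \<alpha> l (\<alpha> + 1) z \<le> 1"
    using pker_pos[OF \<alpha>(1) z] mult_le_cancel_left_pos by blast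
  then show "0 \<le> mlk \<alpha> l 1 z" using e by simp
qed

text \<open>\<open>1 - mlk \<alpha> l 1\<close> is \<open>l\<close> times the primitive of the positive resolvent.\<close>

lemma relaxation_decreasing:
  assumes \<alpha>: "0 < \<alpha>" "\<alpha> \<le> 1" and l: "0 < l" and xy: "0 < x" "x \<le> y"
  shows "mlk \<alpha> l 1 y \<le> mlk \<alpha> l 1 x"
proof -
  have int: "set_integrable lborel {0<..<u} (mlk \<alpha> l \<alpha>)"
    and val: "mlk \<alpha> l (\<alpha> + 1) u = (LINT s:{0<..<u}|lborel. mlk \<alpha> l \<alpha> s)" if "0 < u" for u
  proof -
    have eq: "pker 1 (u - s) * mlk \<alpha> l \<alpha> s = mlk \<alpha> l \<alpha> s" if "s \<in> {0<..<u}" for s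
      using that by (simp add: pker_1)
    show "set_integrable lborel {0<..<u} (mlk \<alpha> l \<alpha>)"
      using conv_pker_mlk(1)[of \<alpha> \<alpha> 1 u l] \<alpha> that unfolding conv_integrable_def
      by (subst (asm) set_integrable_cong[OF refl refl eq]) auto
    show "mlk \<alpha> l (\<alpha> + 1) u = (LINT s:{0<..<u}|lborel. mlk \<alpha> l \<alpha> s)"
      using conv_pker_mlk(2)[of \<alpha> \<alpha> 1 u l] \<alpha> that eq unfolding conv_def
      by (subst set_lebesgue_integral_cong[where g = "\<lambda>s. pker 1 (u - s) * mlk \<alpha> l \<alpha> s"]) auto
  qed
  have "mlk \<alpha> l (\<alpha> + 1) x \<le> mlk \<alpha> l (\<alpha> + 1) y"
    unfolding val[OF xy(1)] val[OF less_le_trans[OF xy]] set_lebesgue_integral_def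
    using int[OF xy(1)] int[OF less_le_trans[OF xy]] mlk_resolvent_pos[OF \<alpha> l] xy
    by (intro integral_mono) (auto simp: set_integrable_def indicator_def less_imp_le)
  then show ?thesis
    using mlk_recurrence[of \<alpha> 1 x l] mlk_recurrence[of \<alpha> 1 y l] \<alpha> xy l by (simp add: pker_1 add.commute)
qed

text \<open>Decay: \<open>1 - e = l (pker \<alpha> * e) \<ge> l e(z) pker (\<alpha> + 1) z\<close> for the decreasing function
  \<open>e = mlk \<alpha> l 1\<close>.\<close>

lemma relaxation_decay:
  assumes \<alpha>: "0 < \<alpha>" "\<alpha> \<le> 1" and l: "0 < l" and z: "0 < z"
  shows "l * mlk \<alpha> l 1 z \<le> Gamma (\<alpha> + 1) * z powr (- \<alpha>)"
proof -
  have c: "conv_integrable (pker \<alpha>) (pker 1) z" "conv (pker \<alpha>) (pker 1) z = pker (\<alpha> + 1) z"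
    by (rule conv_pker_pker; use assms in simp)+
  have "conv (pker \<alpha>) (\<lambda>s. mlk \<alpha> l 1 z * pker 1 s) z \<le> conv (pker \<alpha>) (mlk \<alpha> l 1) z"
  proof (rule conv_mono)
    show "conv_integrable (pker \<alpha>) (\<lambda>s. mlk \<alpha> l 1 z * pker 1 s) z"
      by (rule conv_cmult_right(2)[OF c(1)])
    show "conv_integrable (pker \<alpha>) (mlk \<alpha> l 1) z"
      by (rule conv_pker_mlk(1)) (use assms in auto)
    fix s assume s: "0 < s" "s < z"
    show "pker \<alpha> (z - s) * (mlk \<alpha> l 1 z * pker 1 s) \<le> pker \<alpha> (z - s) * mlk \<alpha> l 1 s"
      using relaxation_decreasing[OF \<alpha> l s(1), of z] s \<alpha> by (intro mult_left_mono) (auto simp: pker_1)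
  qed
  then have "mlk \<alpha> l 1 z * pker (\<alpha> + 1) z \<le> mlk \<alpha> l (\<alpha> + 1) z"
    using conv_cmult_right(1) c(2) conv_pker_mlk(2)[of \<alpha> 1 \<alpha> z l] assms by (simp add: add.commute)
  then have "l * (mlk \<alpha> l 1 z * pker (\<alpha> + 1) z) \<le> l * mlk \<alpha> l (\<alpha> + 1) z"
    using l by simp
  also have "\<dots> = 1 - mlk \<alpha> l 1 z"
    using mlk_recurrence[of \<alpha> 1 z l] assms by (simp add: pker_1 add.commute)
  also have "\<dots> \<le> 1" using relaxation_bounds[OF assms] by simp
  finally show ?thesis
    using Gamma_real_pos[of "\<alpha> + 1"] \<alpha> z by (simp add: pker_def powr_minus field_simps)
qed

section \<open>Erdelyi--Kober operators in the variable \<open>t powr p\<close>\<close>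

text \<open>The integrands differ only on a finite null set, which is enough even for a non-measurable \<open>F\<close>.  In
  this way the value of a source at the initial time is disregarded.\<close>

lemma set_integral_Icc_Ioo:
  fixes F :: "real \<Rightarrow> real"
  shows "(LINT s:{a..b}|lborel. F s) = (LINT s:{a<..<b}|lborel. F s)"
  unfolding set_lebesgue_integral_def
  by (rule integral_discrete_difference[of "{a, b}"]) (auto simp: indicator_def)

lemma set_integrable_lebesgue_imp_lborel:
  fixes F :: "real \<Rightarrow> real"
  assumes "F absolutely_integrable_on S" "set_borel_measurable borel S F"
  shows "set_integrable lborel S F"
  using assms by (simp add: set_integrable_def set_borel_measurable_def integrable_completion)

lemma set_integrable_lborel_imp_lebesgue:
  fixes F :: "real \<Rightarrow> real"
  assumes "set_integrable lborel S F"
  shows "F absolutely_integrable_on S"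
  using assms borel_measurable_integrable[OF assms[unfolded set_integrable_def]]
  by (simp add: set_integrable_def integrable_completion)

text \<open>The inverse of \<open>t \<mapsto> t powr p - a powr p\<close> on \<open>{a..}\<close>.\<close>

definition clock :: "real \<Rightarrow> real \<Rightarrow> real \<Rightarrow> real" where
  "clock p a z = (z + a powr p) powr (1 / p)"

lemma clock_inverse:
  assumes "0 < p" "0 \<le> a" "a \<le> t"
  shows "clock p a (t powr p - a powr p) = t"
  using assms by (simp add: clock_def powr_powr)

lemma clock_powr:
  assumes "0 < p" "0 \<le> z"
  shows "clock p a z powr p - a powr p = z"
  using assms by (simp add: clock_def powr_powr add_nonneg_nonneg)

lemma clock_greater:
  assumes "0 < p" "0 \<le> a" "0 < z"
  shows "a < clock p a z"
proof -
  have "a = (a powr p) powr (1 / p)" using assms by (simp add: powr_powr)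
  also have "\<dots> < (z + a powr p) powr (1 / p)"
    using assms by (intro powr_less_mono2) auto
  finally show ?thesis by (simp add: clock_def)
qed

lemma clock_0: "0 < p \<Longrightarrow> 0 \<le> a \<Longrightarrow> clock p a 0 = a"
  by (simp add: clock_def powr_powr)

lemma clock_mono:
  assumes "0 < p" "0 \<le> y" "y \<le> z"
  shows "clock p a y \<le> clock p a z"
  unfolding clock_def using assms by (intro powr_mono2) auto

lemma clock_strict_mono:
  assumes "0 < p" "0 \<le> y" "y < z"
  shows "clock p a y < clock p a z"
  unfolding clock_def using assms by (intro powr_less_mono2) auto

lemma continuous_on_clock: 
  assumes "0 < p"
  shows "continuous_on {0..} (clock p a)"
  unfolding clock_def by (intro continuous_on_powr' continuous_intros) (use assms in auto)

lemma clock_in: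
  assumes "0 < p" "0 \<le> a" "z \<in> {0..T powr p - a powr p}" "a \<le> T"
  shows "clock p a z \<in> {a..T}"
  using clock_mono[of p 0 z a] clock_mono[of p z "T powr p - a powr p" a] assms
  by (simp add: clock_0 clock_inverse)

lemma clock_in_open:
  assumes "0 < p" "0 \<le> a" "z \<in> {0<..<T powr p - a powr p}" "a \<le> T"
  shows "clock p a z \<in> {a<..<T}"
  using clock_greater[of p a z] clock_strict_mono[of p z "T powr p - a powr p" a] assms
  by (simp add: clock_inverse)

text \<open>The substitution rule concerns the completed measure; Borel measurability of the integrand
  leads back to \<open>lborel\<close>.\<close>

lemma time_substitution:
  assumes p: "0 < p" and a: "0 \<le> a" "a < t"
    and K[measurable]: "K \<in> borel_measurable borel"
    and g: "set_borel_measurable borel {a<..<t} g"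
    and int: "conv_integrable K (\<lambda>z. g (clock p a z)) (t powr p - a powr p)"
  shows "(LINT s:{a..t}|lborel. K (t powr p - s powr p) * g s * (p * s powr (p - 1)))
       = conv K (\<lambda>z. g (clock p a z)) (t powr p - a powr p)"
proof -
  define Z where "Z = t powr p - a powr p"
  define f where "f z = K (Z - z) * g (clock p a z)" for z
  define \<gamma> where "\<gamma> s = s powr p - a powr p" for s
  have der: "(\<gamma> has_field_derivative p * s powr (p - 1)) (at s within {a<..<t})" if "s \<in> {a<..<t}" for s
    unfolding \<gamma>_def using that a by (auto intro!: derivative_eq_intros)
  have mono: "\<gamma> s < \<gamma> s'" if "a \<le> s" "s < s'" for s s'
    using powr_less_mono2[of p s s'] that a p by (simp add: \<gamma>_def)
  have inj: "inj_on \<gamma> {a<..<t}"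
    by (rule inj_onI) (metis greaterThanLessThan_iff less_imp_le linorder_neqE_linordered_idom mono order_less_irrefl)
  have img: "\<gamma> ` {a<..<t} = {0<..<Z}"
  proof (intro equalityI subsetI)
    fix z assume "z \<in> {0<..<Z}"
    then have "clock p a z \<in> {a<..<t}" "\<gamma> (clock p a z) = z"
      using clock_in_open[of p a z t] p a by (auto simp: Z_def \<gamma>_def clock_powr)
    then show "z \<in> \<gamma> ` {a<..<t}" by (metis image_eqI)
  next
    fix z assume "z \<in> \<gamma> ` {a<..<t}"
    then obtain s where "a < s" "s < t" "z = \<gamma> s" by auto
    then show "z \<in> {0<..<Z}"
      using mono[of a s] mono[of s t] by (simp add: \<gamma>_def Z_def)
  qed
  have fint: "set_integrable lborel {0<..<Z} f"
    using int by (simp add: conv_integrable_def f_def[abs_def] Z_def)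
  have conv: "conv K (\<lambda>z. g (clock p a z)) Z = integral {0<..<Z} f"
    using set_borel_integral_eq_integral(2)[OF fint] by (simp add: conv_def f_def)
  define F where "F s = K (t powr p - s powr p) * g s * (p * s powr (p - 1))" for s
  have Feq: "\<bar>p * s powr (p - 1)\<bar> * f (\<gamma> s) = F s" if "s \<in> {a<..<t}" for s
    using that p a clock_inverse[OF p a(1), of s]
    by (simp add: f_def F_def \<gamma>_def Z_def mult_ac)
  have "(\<lambda>s. \<bar>p * s powr (p - 1)\<bar> * f (\<gamma> s)) absolutely_integrable_on {a<..<t} \<and>
      integral {a<..<t} (\<lambda>s. \<bar>p * s powr (p - 1)\<bar> * f (\<gamma> s)) = integral {0<..<Z} f"
    using has_absolute_integral_change_of_variables_1'[OF _ der inj, of f "integral {0<..<Z} f"]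
      set_integrable_lborel_imp_lebesgue[OF fint] by (simp add: img)
  note FI = this
  have F: "F absolutely_integrable_on {a<..<t}"
    using FI[THEN conjunct1] by (subst (asm) set_integrable_cong[OF refl refl Feq]) auto
  have FV: "integral {a<..<t} F = integral {0<..<Z} f"
    using FI[THEN conjunct2] Henstock_Kurzweil_Integration.integral_cong[OF Feq, of "{a<..<t}"] by simp
  have [measurable]: "(\<lambda>s. indicator {a<..<t} s * g s) \<in> borel_measurable borel"
    using g by (simp add: set_borel_measurable_def)
  have "(\<lambda>s. K (t powr p - s powr p) * (indicator {a<..<t} s * g s) * (p * s powr (p - 1))) \<in> borel_measurable borel"
    by measurable
  then have "set_borel_measurable borel {a<..<t} F"
    by (simp add: set_borel_measurable_def F_def mult_ac)
  from set_integrable_lebesgue_imp_lborel[OF F this]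
  have "(LINT s:{a<..<t}|lborel. F s) = integral {a<..<t} F"
    by (rule set_borel_integral_eq_integral)
  then show ?thesis
    using FV conv by (simp add: set_integral_Icc_Ioo F_def Z_def)
qed

subsection \<open>Riemann--Liouville integrals of continuous functions\<close>

text \<open>Order \<open>0\<close>, which occurs for \<open>\<alpha> = 1\<close>, is the identity, as for the Erdelyi--Kober integral.\<close>

definition rl_int :: "real \<Rightarrow> (real \<Rightarrow> real) \<Rightarrow> real \<Rightarrow> real" where
  "rl_int b g z = (if b = 0 then g z else conv (pker b) g z)"

lemma conv_pker_bounded:
  assumes b: "0 < b" and z: "0 < z"
    and g: "set_borel_measurable borel {0<..<z} g" and M: "\<And>s. \<lbrakk>0 < s; s < z\<rbrakk> \<Longrightarrow> \<bar>g s\<bar> \<le> M"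
  shows "conv_integrable (pker b) g z" and "\<bar>conv (pker b) g z\<bar> \<le> M * pker (b + 1) z"
proof -
  have c: "conv_integrable (pker b) (\<lambda>s. M * pker 1 s) z"
    "conv (pker b) (\<lambda>s. M * pker 1 s) z = M * pker (b + 1) z"
    using conv_pker_pker[OF b zero_less_one z] by (simp_all add: conv_cmult_right)
  have bd: "\<bar>pker b s\<bar> \<le> pker b s" "\<bar>g s\<bar> \<le> M * pker 1 s" if "0 < s" "s < z" for s
    using that b M by (auto simp: pker_1)
  show "conv_integrable (pker b) g z"
    by (rule conv_dominated(1)[OF pker_measurable g bd c(1)])
  show "\<bar>conv (pker b) g z\<bar> \<le> M * pker (b + 1) z"
    using conv_dominated(2)[OF pker_measurable g bd c(1)] c(2) by simp
qed

lemma continuous_imp_measurable: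
  fixes g :: "real \<Rightarrow> real"
  assumes "continuous_on {x<..<y} g"
  shows "set_borel_measurable borel {x<..<y} g"
  by (rule borel_measurable_continuous_on_indicator[OF _ assms, folded set_borel_measurable_def]) auto

lemma continuous_conv_pker:
  assumes b: "0 < b" and z: "0 < z" and g: "continuous_on {0..z} g"
  shows "conv_integrable (pker b) g z"
proof -
  obtain M where M: "\<And>s. s \<in> {0..z} \<Longrightarrow> \<bar>g s\<bar> \<le> M"
    using compact_imp_bounded[OF compact_continuous_image[OF g compact_Icc]]
    unfolding bounded_iff by (metis imageI real_norm_def)
  show ?thesis
    by (rule conv_pker_bounded(1)[OF b z continuous_imp_measurable, of g M])
       (use M in \<open>auto intro: continuous_on_subset[OF g]\<close>)
qed

lemma rl_int_cong:
  assumes "\<And>s. \<lbrakk>0 < s; s \<le> z\<rbrakk> \<Longrightarrow> g s = h s" "0 < z"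
  shows "rl_int b g z = rl_int b h z"
  using assms by (auto simp: rl_int_def intro!: conv_cong)

lemma rl_int_diff:
  assumes "0 \<le> b" "0 < z" "continuous_on {0..z} g" "continuous_on {0..z} h"
  shows "rl_int b (\<lambda>s. g s - h s) z = rl_int b g z - rl_int b h z"
  using assms continuous_conv_pker[of b z] by (auto simp: rl_int_def intro!: conv_diff_right)

lemma rl_int_add:
  assumes "0 \<le> b" "0 < z" "continuous_on {0..z} g" "continuous_on {0..z} h"
  shows "rl_int b (\<lambda>s. g s + h s) z = rl_int b g z + rl_int b h z"
  using assms continuous_conv_pker[of b z] by (auto simp: rl_int_def intro!: conv_add_right)

lemma rl_int_cmult: "rl_int b (\<lambda>s. c * g s) z = c * rl_int b g z"
  by (simp add: rl_int_def conv_cmult_right)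

text \<open>Valid also for order \<open>0\<close>, where \<open>pker 1 z = 1\<close>.\<close>

lemma rl_int_bound:
  assumes b: "0 \<le> b" and z: "0 < z" and g: "continuous_on {0..z} g"
    and M: "\<And>s. \<lbrakk>0 < s; s \<le> z\<rbrakk> \<Longrightarrow> \<bar>g s\<bar> \<le> M"
  shows "\<bar>rl_int b g z\<bar> \<le> M * pker (b + 1) z"
proof (cases "b = 0")
  case True
  then show ?thesis using M[of z] z by (simp add: rl_int_def pker_1)
next
  case False
  then show ?thesis
    using conv_pker_bounded(2)[of b z g M] b z M
    by (force simp: rl_int_def intro!: continuous_imp_measurable continuous_on_subset[OF g])
qed

subsection \<open>The regularized operator as a Caputo derivative\<close>

lemma EK_integral_eq_rl_int:
  assumes p: "0 < p" and b: "0 \<le> b" and a: "0 \<le> a" "a < t" and g: "continuous_on {a..t} g"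
  shows "EK_integral p a 0 b g t = t powr (- p * b) * rl_int b (\<lambda>z. g (clock p a z)) (t powr p - a powr p)"
proof (cases "b = 0")
  case True
  then show ?thesis using a p by (simp add: EK_integral_def rl_int_def clock_inverse)
next
  case False
  then have b: "0 < b" using b by simp
  define Z where "Z = t powr p - a powr p"
  have Z: "0 < Z" using powr_less_mono2[of p a t] p a by (simp add: Z_def)
  have contg: "continuous_on {0..Z} (\<lambda>z. g (clock p a z))"
    by (rule continuous_on_compose2[OF g continuous_on_subset[OF continuous_on_clock[OF p]]])
       (use clock_in[of p a _ t] p a in \<open>auto simp: Z_def\<close>)
  have sub: "(LINT s:{a..t}|lborel. pker b (t powr p - s powr p) * g s * (p * s powr (p - 1)))
       = conv (pker b) (\<lambda>z. g (clock p a z)) Z"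
    unfolding Z_def
    by (rule time_substitution[OF p a pker_measurable])
       (use b Z contg in \<open>auto intro!: continuous_imp_measurable continuous_conv_pker
          intro: continuous_on_subset[OF g] simp: Z_def\<close>)
  have "(LINT s:{a..t}|lborel. (t powr p - s powr p) powr (b - 1) * s powr (p * 0) * g s * (p * s powr (p - 1)))
      = (LINT s:{a<..<t}|lborel. Gamma b * (pker b (t powr p - s powr p) * g s * (p * s powr (p - 1))))"
    unfolding set_integral_Icc_Ioo
    using Gamma_real_pos[OF b] a
    by (intro set_lebesgue_integral_cong) (auto simp: pker_def)
  also have "\<dots> = Gamma b * conv (pker b) (\<lambda>z. g (clock p a z)) Z"
    using sub by (simp add: set_integral_Icc_Ioo)
  finally show ?thesis
    using b less_imp_neq[OF Gamma_real_pos[OF b]] by (simp add: EK_integral_def rl_int_def Z_def)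
qed

lemma nat_ceiling_order:
  assumes "0 < \<alpha>" "\<alpha> \<le> (1 :: real)"
  shows "nat \<lceil>\<alpha>\<rceil> = Suc 0"
proof -
  have "\<lceil>\<alpha>\<rceil> = 1" using assms by (intro ceiling_unique) auto
  then show ?thesis by simp
qed

lemma caputo_exists_on_iff:
  assumes "0 < \<alpha>" "\<alpha> \<le> 1"
  shows "caputo_hyper_bessel_exists_on S \<theta> \<alpha> a g \<longleftrightarrow>
    (\<forall>t\<in>S. EK_integral (1 - \<theta>) a (- \<alpha> + \<alpha>) (1 - \<alpha>) (\<lambda>s. g s - g a) differentiable (at t))"
  using nat_ceiling_order[OF assms]
  by (simp add: caputo_hyper_bessel_exists_on_def EK_derivative_exists_on_def)

text \<open>With \<open>z = t powr p - a powr p\<close>, the Erdelyi--Kober integral of order \<open>1 - \<alpha>\<close> is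
  \<open>t powr (- p * (1 - \<alpha>))\<close> times the Riemann--Liouville integral in \<open>z\<close>, and the first order factor
  \<open>1 - \<alpha> + (t / p) d/dt\<close> is built to annihilate the power in front.\<close>

lemma caputo_from_rl_derivative:
  assumes \<theta>: "\<theta> < 1" and p: "p = 1 - \<theta>" and \<alpha>: "0 < \<alpha>" "\<alpha> \<le> 1" and a: "0 \<le> a" "a < t" "t < T"
    and g: "continuous_on {a..T} g"
    and D: "(rl_int (1 - \<alpha>) (\<lambda>z. g (clock p a z) - g a) has_real_derivative D) (at (t powr p - a powr p))"
  shows "EK_integral (1 - \<theta>) a (- \<alpha> + \<alpha>) (1 - \<alpha>) (\<lambda>s. g s - g a) differentiable (at t)"
    and "caputo_hyper_bessel \<theta> \<alpha> a g t = p powr \<alpha> * D"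
proof -
  have p0: "0 < p" using \<theta> p by simp
  define b where "b = 1 - \<alpha>"
  have b: "0 \<le> b" using \<alpha> by (simp add: b_def)
  define J where "J = rl_int b (\<lambda>z. g (clock p a z) - g a)"
  define H where "H = EK_integral p a 0 b (\<lambda>s. g s - g a)"
  have H: "H s = s powr (- p * b) * J (s powr p - a powr p)" if "s \<in> {a<..<T}" for s
    unfolding H_def J_def
    by (rule EK_integral_eq_rl_int) (use that p0 b a in \<open>auto intro!: continuous_intros continuous_on_subset[OF g]\<close>)
  have J: "(J has_real_derivative D) (at (t powr p - a powr p))"
    using D by (simp add: J_def b_def)
  define H' where "H' = (- p * b) * t powr (- p * b - 1) * J (t powr p - a powr p)
      + (D * (p * t powr (p - 1))) * t powr (- p * b)"
  have t0: "0 < t" using a by simp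
  have "((\<lambda>s. J (s powr p - a powr p)) has_real_derivative D * (p * t powr (p - 1))) (at t)"
    by (rule DERIV_chain2[where f = J and g = "\<lambda>s. s powr p - a powr p", OF J]) (use t0 in \<open>auto intro!: derivative_eq_intros\<close>)
  then have "((\<lambda>s. s powr (- p * b) * J (s powr p - a powr p)) has_real_derivative H') (at t)"
    unfolding H'_def using t0 by (intro DERIV_mult) (auto intro!: derivative_eq_intros)
  then have HD: "(H has_real_derivative H') (at t)"
    by (rule has_field_derivative_transform_within_open[of _ _ _ "{a<..<T}"]) (use H a in auto)
  then show "EK_integral (1 - \<theta>) a (- \<alpha> + \<alpha>) (1 - \<alpha>) (\<lambda>s. g s - g a) differentiable (at t)"
    unfolding real_differentiable_def H_def p b_def by auto
  note n = nat_ceiling_order[OF \<alpha>]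
  have "EK_derivative p a (- \<alpha>) \<alpha> (\<lambda>s. g s - g a) t = b * H t + t / p * H'"
    using DERIV_imp_deriv[OF HD] by (simp add: EK_derivative_def n H_def b_def)
  also have "\<dots> = t powr (- p * b) * t powr p * D"
  proof -
    have "t * t powr (- p * b - 1) = t powr (- p * b)" "t * t powr (p - 1) = t powr p"
      using t0 by (simp_all add: powr_mult_base)
    moreover have "H t = t powr (- p * b) * J (t powr p - a powr p)" using H a by simp
    moreover have "t / p * H' = - b * (t * t powr (- p * b - 1)) * J (t powr p - a powr p)
       + D * (t * t powr (p - 1)) * t powr (- p * b)"
      using p0 by (simp add: H'_def field_simps)
    ultimately show ?thesis by (simp add: algebra_simps)
  qed
  finally have "caputo_hyper_bessel \<theta> \<alpha> a g t = p powr \<alpha> * (t powr (- \<alpha> * p) * t powr (- p * b) * t powr p) * D"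
    by (simp add: caputo_hyper_bessel_def p[symmetric])
  also have "t powr (- \<alpha> * p) * t powr (- p * b) * t powr p = 1"
    using t0 by (simp add: powr_add[symmetric] b_def algebra_simps)
  finally show "caputo_hyper_bessel \<theta> \<alpha> a g t = p powr \<alpha> * D" by simp
qed

text \<open>Conversely, the Riemann--Liouville integral is the Erdelyi--Kober integral at \<open>clock p a z\<close>, divided by
  the smooth positive power in front of it.\<close>

lemma rl_differentiable_from_EK:
  assumes p: "0 < p" and \<alpha>: "0 < \<alpha>" "\<alpha> \<le> 1" and a: "0 \<le> a" "a < t" "t < T"
    and g: "continuous_on {a..T} g"
    and D: "EK_integral p a 0 (1 - \<alpha>) (\<lambda>s. g s - g a) differentiable (at t)"
  shows "rl_int (1 - \<alpha>) (\<lambda>z. g (clock p a z) - g a) differentiable (at (t powr p - a powr p))"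
proof -
  define b where "b = 1 - \<alpha>"
  have b: "0 \<le> b" using \<alpha> by (simp add: b_def)
  define J where "J = rl_int b (\<lambda>z. g (clock p a z) - g a)"
  define H where "H = EK_integral p a 0 b (\<lambda>s. g s - g a)"
  define L where "L = T powr p - a powr p"
  define z where "z = t powr p - a powr p"
  have z: "z \<in> {0<..<L}"
    using powr_less_mono2[of p a t] powr_less_mono2[of p t T] p a by (simp add: z_def L_def)
  have zt: "clock p a z = t" using clock_inverse[of p a t] p a by (simp add: z_def)
  have J: "clock p a y powr (p * b) * H (clock p a y) = J y" if y: "y \<in> {0<..<L}" for y
  proof -
    define s where "s = clock p a y"
    have s: "s \<in> {a<..<T}" using clock_in_open[of p a y T] p a y by (simp add: s_def L_def)
    have sy: "s powr p - a powr p = y" using clock_powr[of p y a] p y by (simp add: s_def)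
    have "H s = s powr (- p * b) * J (s powr p - a powr p)"
      unfolding H_def J_def
      by (rule EK_integral_eq_rl_int) (use s p b a in \<open>auto intro!: continuous_intros continuous_on_subset[OF g]\<close>)
    then show ?thesis using s a by (simp add: sy powr_minus s_def[symmetric])
  qed
  obtain H' where H': "(H has_real_derivative H') (at t)"
    using D by (auto simp: H_def b_def real_differentiable_def)
  have apos: "0 < z + a powr p" using z by (simp add: add_pos_nonneg)
  have clk: "(clock p a has_real_derivative 1 / p * (z + a powr p) powr (1 / p - 1)) (at z)"
    unfolding clock_def using apos by (auto intro!: derivative_eq_intros)
  have 1: "((\<lambda>y. H (clock p a y)) has_real_derivative H' * (1 / p * (z + a powr p) powr (1 / p - 1))) (at z)"
    by (rule DERIV_chain2[OF _ clk]) (simp add: zt H')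
  have "((\<lambda>s. s powr (p * b)) has_real_derivative p * b * t powr (p * b - 1)) (at t)"
    using a by (auto intro!: derivative_eq_intros)
  then have 2: "((\<lambda>y. clock p a y powr (p * b)) has_real_derivative
      p * b * t powr (p * b - 1) * (1 / p * (z + a powr p) powr (1 / p - 1))) (at z)"
    by (intro DERIV_chain2[OF _ clk]) (simp add: zt)
  have "\<exists>D. ((\<lambda>y. clock p a y powr (p * b) * H (clock p a y)) has_real_derivative D) (at z)"
    using DERIV_mult[OF 2 1] by blast
  then obtain D where "((\<lambda>y. clock p a y powr (p * b) * H (clock p a y)) has_real_derivative D) (at z)"
    by blast
  then have "(J has_real_derivative D) (at z)"
    by (rule has_field_derivative_transform_within_open[of _ _ _ "{0<..<L}"]) (use J z in auto)
  then show ?thesis by (auto simp: J_def b_def z_def real_differentiable_def)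
qed

text \<open>The two kernels in the definition of \<open>G_coeff\<close> combine to the resolvent kernel by
  the recurrence of the Mittag-Leffler kernels.\<close>

lemma G_coeff_eq_conv:
  fixes f :: "real \<Rightarrow> real \<Rightarrow> real"
  assumes p: "0 < p" and \<alpha>: "0 < \<alpha>" "\<alpha> \<le> 1" and a: "0 \<le> a" "a < t" and k: "k \<noteq> 0"
  defines "l \<equiv> (real k * pi)\<^sup>2 / p powr \<alpha>"
    and "F \<equiv> \<lambda>z. sine_coeff (\<lambda>x. f x (clock p a z)) k"
  assumes meas: "set_borel_measurable borel {a<..<t} (\<lambda>s. sine_coeff (\<lambda>x. f x s) k)"
    and measF: "set_borel_measurable borel {0<..<t powr p - a powr p} F"
    and int: "conv_integrable (pker \<alpha>) (\<lambda>z. \<bar>F z\<bar>) (t powr p - a powr p)"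
  shows "G_coeff p \<alpha> a f k t = p powr (- \<alpha>) * conv (mlk \<alpha> l \<alpha>) F (t powr p - a powr p)"
proof -
  define Z where "Z = t powr p - a powr p"
  have Z: "0 < Z" using powr_less_mono2[of p a t] p a by (simp add: Z_def)
  have l: "0 < l" using k p by (simp add: l_def)
  have i1: "conv_integrable (pker \<alpha>) F Z"
    by (rule conv_dominated(1)[OF pker_measurable, where A' = "pker \<alpha>" and B' = "\<lambda>z. \<bar>F z\<bar>"])
       (use int measF \<alpha> in \<open>auto simp: Z_def\<close>)
  have le: "\<bar>mlk \<alpha> l (2 * \<alpha>) s\<bar> \<le> 1 / l * pker \<alpha> s" if "0 < s" for s
  proof -
    have "l * mlk \<alpha> l (2 * \<alpha>) s = pker \<alpha> s - mlk \<alpha> l \<alpha> s"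
      using mlk_recurrence[of \<alpha> \<alpha> s l] \<alpha> that by simp
    then have "0 \<le> l * mlk \<alpha> l (2 * \<alpha>) s" "l * mlk \<alpha> l (2 * \<alpha>) s \<le> pker \<alpha> s"
      using mlk_resolvent_le[OF \<alpha> l that] mlk_resolvent_pos[OF \<alpha> l that] by linarith+
    then show ?thesis using l by (simp add: zero_le_mult_iff pos_le_divide_eq mult.commute)
  qed
  have i2: "conv_integrable (mlk \<alpha> l (2 * \<alpha>)) F Z"
    by (rule conv_dominated(1)[where A' = "\<lambda>s. 1 / l * pker \<alpha> s" and B' = "\<lambda>z. \<bar>F z\<bar>"])
       (use mlk_measurable[of \<alpha> "2 * \<alpha>" l] \<alpha> measF le conv_cmult_left(2)[OF int, of "1 / l"] in \<open>auto simp: Z_def\<close>)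
  have 1: "(LINT s:{a..t}|lborel. (t powr p - s powr p) powr (\<alpha> - 1) * sine_coeff (\<lambda>x. f x s) k * (p * s powr (p - 1)))
     = Gamma \<alpha> * conv (pker \<alpha>) F Z"
  proof -
    have "(LINT s:{a..t}|lborel. (t powr p - s powr p) powr (\<alpha> - 1) * sine_coeff (\<lambda>x. f x s) k * (p * s powr (p - 1)))
      = (LINT s:{a..t}|lborel. Gamma \<alpha> * (pker \<alpha> (t powr p - s powr p) * sine_coeff (\<lambda>x. f x s) k * (p * s powr (p - 1))))"
      using Gamma_real_pos[OF \<alpha>(1)] by (intro set_lebesgue_integral_cong) (auto simp: pker_def)
    also have "\<dots> = Gamma \<alpha> * conv (pker \<alpha>) F Z"
      using time_substitution[OF p a pker_measurable meas, of \<alpha>] i1 by (simp add: F_def Z_def)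
    finally show ?thesis .
  qed
  have 2: "(LINT s:{a..t}|lborel. (t powr p - s powr p) powr (2 * \<alpha> - 1) *
          mittag_leffler \<alpha> (2 * \<alpha>) (- ((real k * pi)\<^sup>2 / p powr \<alpha>) * (t powr p - s powr p) powr \<alpha>) *
          sine_coeff (\<lambda>x. f x s) k * (p * s powr (p - 1)))
     = conv (mlk \<alpha> l (2 * \<alpha>)) F Z"
    using time_substitution[OF p a mlk_measurable[of \<alpha> "2 * \<alpha>" l] meas] i2 \<alpha>
    by (simp add: F_def Z_def mlk_def l_def)
  have "conv (mlk \<alpha> l \<alpha>) F Z = conv (\<lambda>s. pker \<alpha> s - l * mlk \<alpha> l (2 * \<alpha>) s) F Z"
    using mlk_recurrence[of \<alpha> \<alpha> _ l] \<alpha> by (intro conv_cong) auto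
  also have "\<dots> = conv (pker \<alpha>) F Z - l * conv (mlk \<alpha> l (2 * \<alpha>)) F Z"
    using conv_diff_left(2)[OF i1 conv_cmult_left(2)[OF i2, of l]] by (simp add: conv_cmult_left(1))
  finally have C: "conv (mlk \<alpha> l \<alpha>) F Z = conv (pker \<alpha>) F Z - l * conv (mlk \<alpha> l (2 * \<alpha>)) F Z" .
  have "(real k * pi)\<^sup>2 / p powr (2 * \<alpha>) = p powr (- \<alpha>) * l"
  proof -
    have "p powr (2 * \<alpha>) = p powr \<alpha> * p powr \<alpha>" by (simp add: powr_add[symmetric])
    then show ?thesis by (simp add: l_def powr_minus field_simps)
  qed
  moreover have "1 / (p powr \<alpha> * Gamma \<alpha>) * (Gamma \<alpha> * conv (pker \<alpha>) F Z) = p powr (- \<alpha>) * conv (pker \<alpha>) F Z"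
    using less_imp_neq[OF Gamma_real_pos[OF \<alpha>(1)]] by (simp add: powr_minus field_simps)
  ultimately show ?thesis
    unfolding G_coeff_def 1 2 Z_def[symmetric] C by (simp only: right_diff_distrib mult.assoc)
qed

section \<open>Sine series on the unit interval\<close>

abbreviation freq :: "nat \<Rightarrow> real" where "freq n \<equiv> real (Suc n) * pi"

lemma integral_cos_int:
  "((\<lambda>x. cos (of_int m * pi * x)) has_integral (if m = 0 then 1 else 0)) {0..1}"
proof (cases "m = 0")
  case True
  then show ?thesis using has_integral_const_real[of "1::real" 0 1] by simp
next
  case False
  have "((\<lambda>x. cos (of_int m * pi * x)) has_integral
      (sin (of_int m * pi * 1) / (of_int m * pi) - sin (of_int m * pi * 0) / (of_int m * pi))) {0..1}"
    by (rule fundamental_theorem_of_calculus)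
       (use False in \<open>auto intro!: derivative_eq_intros simp: has_real_derivative_iff_has_vector_derivative[symmetric]\<close>)
  moreover have "sin (of_int m * pi) = 0" by (simp add: sin_zero_iff_int2)
  ultimately show ?thesis using False by simp
qed

lemma sine_orthogonal:
  assumes "j \<noteq> 0" "k \<noteq> 0"
  shows "((\<lambda>x. sin (real j * pi * x) * sin (real k * pi * x)) has_integral (if j = k then 1/2 else 0)) {0..1}"
proof -
  have "((\<lambda>x. (cos (of_int (int j - int k) * pi * x) - cos (of_int (int j + int k) * pi * x)) / 2)
      has_integral (((if int j - int k = 0 then 1 else 0) - (if int j + int k = 0 then 1 else 0)) / 2)) {0..1}"
    by (intro has_integral_divide has_integral_diff integral_cos_int)
  moreover have "(cos (of_int (int j - int k) * pi * x) - cos (of_int (int j + int k) * pi * x)) / 2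
      = sin (real j * pi * x) * sin (real k * pi * x)" for x
    by (simp add: sin_times_sin algebra_simps)
  ultimately show ?thesis using assms by auto
qed

lemma cosine_orthogonal:
  assumes "j \<noteq> 0" "k \<noteq> 0"
  shows "((\<lambda>x. cos (real j * pi * x) * cos (real k * pi * x)) has_integral (if j = k then 1/2 else 0)) {0..1}"
proof -
  have "((\<lambda>x. (cos (of_int (int j - int k) * pi * x) + cos (of_int (int j + int k) * pi * x)) / 2)
      has_integral (((if int j - int k = 0 then 1 else 0) + (if int j + int k = 0 then 1 else 0)) / 2)) {0..1}"
    by (intro has_integral_divide has_integral_add integral_cos_int)
  moreover have "(cos (of_int (int j - int k) * pi * x) + cos (of_int (int j + int k) * pi * x)) / 2
      = cos (real j * pi * x) * cos (real k * pi * x)" for x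
    by (simp add: cos_times_cos algebra_simps)
  ultimately show ?thesis using assms by auto
qed

lemma sine_coeff_continuous:
  assumes "continuous_on {0..1} g"
  shows "sine_coeff g k = 2 * integral {0..1} (\<lambda>x. g x * sin (real k * pi * x))"
  unfolding sine_coeff_def
  by (subst set_borel_integral_eq_integral(2)[OF borel_integrable_atLeastAtMost'])
     (intro continuous_intros assms | simp)+

text \<open>Completeness of the sine system.  The functions \<open>sin (\<pi> x) * cos (\<pi> x) ^ i\<close> are combinations
  of sines, so \<open>h\<close> is orthogonal to \<open>sin (\<pi> x) * P (cos (\<pi> x))\<close> for every polynomial \<open>P\<close>.  As
  \<open>cos (\<pi> x)\<close> is injective on \<open>{0..1}\<close>, Weierstrass' theorem lets \<open>P (cos (\<pi> x))\<close> approximate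
  \<open>h x * sin (\<pi> x)\<close>.\<close>

lemma sine_complete:
  assumes h: "continuous_on {0..1} h"
    and orth: "\<And>k. integral {0..1} (\<lambda>x. h x * sin (freq k * x)) = 0"
    and x: "x \<in> {0..1}"
  shows "h x = 0"
proof -
  have int: "g integrable_on {0..1}" if "continuous_on {0..1} g" for g :: "real \<Rightarrow> real"
    using that by (rule integrable_continuous_interval)
  have pow: "integral {0..1} (\<lambda>x. h x * (sin (real k * pi * x) * cos (pi * x) ^ i)) = 0" for k i
  proof (induction i arbitrary: k)
    case 0
    then show ?case using orth[of "k - 1"] by (cases k) auto
  next
    case (Suc i)
    show ?case
    proof (cases k)
      case (Suc k')
      have "integral {0..1} (\<lambda>x. h x * (sin (real k * pi * x) * cos (pi * x) ^ Suc i))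
         = integral {0..1} (\<lambda>x. (h x * (sin (freq k * x) * cos (pi * x) ^ i)
              + h x * (sin (real k' * pi * x) * cos (pi * x) ^ i)) / 2)"
      proof (rule Henstock_Kurzweil_Integration.integral_cong)
        fix x :: real
        have "sin (real k * pi * x) * cos (pi * x) = (sin (freq k * x) + sin (real k' * pi * x)) / 2"
        proof -
          have "real k * pi * x = real k' * pi * x + pi * x"
            and "freq k * x = real k' * pi * x + pi * x + pi * x"
            by (simp_all add: Suc algebra_simps)
          then show ?thesis using sin_times_cos[of "real k' * pi * x + pi * x" "pi * x"] by simp
        qed
        then have "h x * (sin (real k * pi * x) * cos (pi * x) * cos (pi * x) ^ i)
          = h x * ((sin (freq k * x) + sin (real k' * pi * x)) / 2 * cos (pi * x) ^ i)"
          by simp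
        then show "h x * (sin (real k * pi * x) * cos (pi * x) ^ Suc i)
          = (h x * (sin (freq k * x) * cos (pi * x) ^ i)
              + h x * (sin (real k' * pi * x) * cos (pi * x) ^ i)) / 2"
          by (simp only: power_Suc) (simp only: mult_ac distrib_left distrib_right add_divide_distrib times_divide_eq_left times_divide_eq_right)
      qed
      also have "\<dots> = 0"
        by (subst integral_divide, subst Henstock_Kurzweil_Integration.integral_add)
           (intro int continuous_intros h | simp only: Suc.IH | simp)+
      finally show ?thesis .
    qed simp
  qed
  define q where "q x = h x * sin (pi * x)" for x
  have q: "continuous_on {0..1} q" unfolding q_def by (intro continuous_intros h)
  define K where "K = integral {0..1} (\<lambda>x. \<bar>q x\<bar>)"
  have K: "0 \<le> K" unfolding K_def by (intro integral_nonneg int continuous_intros q) auto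
  have le: "integral {0..1} (\<lambda>x. (q x)\<^sup>2) \<le> e * K" if e: "0 < e" for e
  proof -
    have "continuous_on {-1..1} (\<lambda>y. q (arccos y / pi))"
      by (rule continuous_on_compose2[OF q])
         (auto intro!: continuous_intros continuous_on_arccos' simp: arccos_lbound arccos_ubound divide_le_eq)
    then obtain P where P: "real_polynomial_function P" "\<And>y. y \<in> {-1..1} \<Longrightarrow> \<bar>q (arccos y / pi) - P y\<bar> < e"
      using Stone_Weierstrass_real_polynomial_function[of "{-1..1::real}", OF _ _ e] by auto
    obtain a n where Pa: "P = (\<lambda>x. \<Sum>i\<le>n. a i * x ^ i)"
      using P(1) by (auto simp: real_polynomial_function_iff_sum)
    have app: "\<bar>q x - P (cos (pi * x))\<bar> \<le> e" if "x \<in> {0..1}" for x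
      using P(2)[of "cos (pi * x)"] that by (simp add: arccos_cos)
    have contP: "continuous_on {0..1} (\<lambda>x. P (cos (pi * x)))"
      unfolding Pa by (intro continuous_intros)
    have "integral {0..1} (\<lambda>x. q x * P (cos (pi * x)))
        = integral {0..1} (\<lambda>x. \<Sum>i\<le>n. a i * (h x * (sin (real 1 * pi * x) * cos (pi * x) ^ i)))"
      by (intro Henstock_Kurzweil_Integration.integral_cong)
         (simp add: Pa q_def sum_distrib_left mult_ac)
    also have "\<dots> = (\<Sum>i\<le>n. a i * integral {0..1} (\<lambda>x. h x * (sin (real 1 * pi * x) * cos (pi * x) ^ i)))"
      by (subst integral_sum) (intro int continuous_intros h finite_atMost | simp only: integral_mult_right)+
    also have "\<dots> = 0" by (simp only: pow) simp
    finally have zero: "integral {0..1} (\<lambda>x. q x * P (cos (pi * x))) = 0" .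
    have "integral {0..1} (\<lambda>x. (q x)\<^sup>2)
        = integral {0..1} (\<lambda>x. q x * (q x - P (cos (pi * x)))) + integral {0..1} (\<lambda>x. q x * P (cos (pi * x)))"
      by (subst Henstock_Kurzweil_Integration.integral_add[symmetric])
         (intro int continuous_intros q contP | simp add: power2_eq_square algebra_simps)+
    also have "\<dots> \<le> integral {0..1} (\<lambda>x. e * \<bar>q x\<bar>)"
      unfolding zero add_0_right
    proof (intro integral_le int continuous_intros q contP)
      fix x :: real assume "x \<in> {0..1}"
      have "q x * (q x - P (cos (pi * x))) \<le> \<bar>q x\<bar> * \<bar>q x - P (cos (pi * x))\<bar>"
        by (metis abs_ge_self abs_mult)
      also have "\<dots> \<le> \<bar>q x\<bar> * e" by (intro mult_left_mono app \<open>x \<in> {0..1}\<close>) auto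
      finally show "q x * (q x - P (cos (pi * x))) \<le> e * \<bar>q x\<bar>" by (simp add: mult.commute)
    qed
    finally show ?thesis by (simp add: K_def)
  qed
  have "integral {0..1} (\<lambda>x. (q x)\<^sup>2) \<le> 0"
  proof (rule field_le_epsilon)
    fix e :: real assume "0 < e"
    then have "integral {0..1} (\<lambda>x. (q x)\<^sup>2) \<le> (e / (K + 1)) * K"
      using K by (intro le) auto
    also have "\<dots> \<le> e" using \<open>0 < e\<close> K by (simp add: field_simps)
    finally show "integral {0..1} (\<lambda>x. (q x)\<^sup>2) \<le> 0 + e" by simp
  qed
  then have "integral {0..1} (\<lambda>x. (q x)\<^sup>2) = 0"
    using integral_nonneg[OF int, of "\<lambda>x. (q x)\<^sup>2"] continuous_on_power[OF q] by force
  then have q0: "q x = 0" if "x \<in> {0..1}" for x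
    using integral_eq_0_iff[of 0 1 "\<lambda>x. (q x)\<^sup>2"] continuous_on_power[OF q] that by auto
  have "h x = 0" if "x \<in> {0<..<1}" for x
    using q0[of x] that sin_gt_zero[of "pi * x"] by (auto simp: q_def)
  then show ?thesis
    using continuous_constant_on_closure[of "{0<..<1}" h 0 x] h x by simp
qed

lemma sine_series_uniform_limit:
  assumes "summable (\<lambda>n. \<bar>c n\<bar>)"
  shows "uniform_limit UNIV (\<lambda>n x. \<Sum>i<n. c i * sin (freq i * x))
     (\<lambda>x. \<Sum>i. c i * sin (freq i * x)) sequentially"
  by (rule Weierstrass_m_test[OF _ assms]) (simp add: abs_mult mult_left_le)

lemma summable_sine_series:
  assumes "summable (\<lambda>n. \<bar>c n\<bar>)"
  shows "summable (\<lambda>i. c i * sin (freq i * x))"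
  by (rule summable_comparison_test'[OF assms, of 0]) (simp add: abs_mult mult_left_le)

text \<open>The uniformly convergent sum of the series has the same coefficients as \<open>g\<close>, so completeness
  identifies it with \<open>g\<close>.\<close>

lemma sine_series_sums:
  assumes g: "continuous_on {0..1} g" and summ: "summable (\<lambda>n. \<bar>sine_coeff g (Suc n)\<bar>)"
    and x: "x \<in> {0..1}"
  shows "(\<lambda>n. sine_coeff g (Suc n) * sin (freq n * x)) sums g x"
proof -
  define c where "c n = sine_coeff g (Suc n)" for n
  have c: "summable (\<lambda>n. \<bar>c n\<bar>)" using summ by (simp add: c_def)
  define S where "S x = (\<Sum>i. c i * sin (freq i * x))" for x
  have S: "continuous_on {0..1} S"
    by (rule uniform_limit_theorem[OF _ uniform_limit_on_subset[OF sine_series_uniform_limit[OF c, folded S_def]]])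
       (auto intro!: always_eventually continuous_intros)
  have coeff: "((\<lambda>x. S x * sin (freq k * x)) has_integral c k / 2) {0..1}" for k
  proof -
    define F where "F n x = (\<Sum>i<n. c i * sin (freq i * x) * sin (freq k * x))" for n x
    have "uniform_limit {0..1} F (\<lambda>x. \<Sum>i. c i * sin (freq i * x) * sin (freq k * x)) sequentially"
      unfolding F_def
      by (rule Weierstrass_m_test[OF _ c]) (simp add: abs_mult mult_left_le mult_le_one mult.assoc)
    also have "(\<lambda>x. \<Sum>i. c i * sin (freq i * x) * sin (freq k * x))
       = (\<lambda>x. S x * sin (freq k * x))"
      unfolding S_def by (intro ext suminf_mult2[symmetric] summable_sine_series c)
    finally have u: "uniform_limit {0..1} F (\<lambda>x. S x * sin (freq k * x)) sequentially" .
    have Fc: "continuous_on {0..1} (F n)" for n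
      unfolding F_def by (intro continuous_intros)
    obtain I J where I: "\<And>n. (F n has_integral I n) {0..1}"
      and J: "((\<lambda>x. S x * sin (freq k * x)) has_integral J) {0..1}" and lim: "I \<longlonglongrightarrow> J"
      using uniform_limit_integral[OF u Fc] by auto
    have Fn: "(F n has_integral (\<Sum>i<n. c i * (if Suc i = Suc k then 1/2 else 0))) {0..1}" for n
    proof -
      have "((\<lambda>x. sin (freq i * x) * sin (freq k * x)) has_integral
          (if Suc i = Suc k then 1/2 else 0)) {0..1}" for i
        by (rule sine_orthogonal) auto
      then have "((\<lambda>x. \<Sum>i<n. c i * (sin (freq i * x) * sin (freq k * x))) has_integral
          (\<Sum>i<n. c i * (if Suc i = Suc k then 1/2 else 0))) {0..1}"
        by (intro has_integral_sum has_integral_mult_right finite_lessThan)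
      then show ?thesis by (simp only: F_def[abs_def] mult.assoc)
    qed
    have "I n = (if k < n then c k / 2 else 0)" for n
      using has_integral_unique[OF I Fn] by (simp add: if_distrib[of "\<lambda>u. c _ * u"] cong: if_cong)
    then have "\<forall>\<^sub>F n in sequentially. I n = c k / 2"
      by (intro eventually_sequentiallyI[of "Suc k"]) auto
    then have "J = c k / 2"
      using lim LIMSEQ_unique tendsto_eventually by blast
    then show ?thesis using J by (simp only:)
  qed
  have "S x - g x = 0"
  proof (rule sine_complete[OF _ _ x])
    show "continuous_on {0..1} (\<lambda>x. S x - g x)" by (intro continuous_intros S g)
    fix k
    have "((\<lambda>x. g x * sin (freq k * x)) has_integral c k / 2) {0..1}"
    proof -
      have "(\<lambda>x. g x * sin (freq k * x)) integrable_on {0..1}"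
        by (intro integrable_continuous_interval continuous_intros g)
      then show ?thesis
        by (simp add: c_def sine_coeff_continuous[OF g] has_integral_integral)
    qed
    from has_integral_diff[OF coeff[of k] this]
    show "integral {0..1} (\<lambda>x. (S x - g x) * sin (freq k * x)) = 0"
      by (simp add: left_diff_distrib integral_unique)
  qed
  then show ?thesis
    using summable_sums[OF summable_sine_series[OF c, of x]] by (simp add: S_def c_def)
qed

lemma summable_Suc_powr2: "summable (\<lambda>n. 1 / (real (Suc n))\<^sup>2)"
  using inverse_squares_sums by (simp add: sums_iff add.commute)

lemma sine_series_derivatives:
  assumes summ: "summable (\<lambda>n. (real (Suc n))\<^sup>2 * \<bar>c n\<bar>)"
  shows "((\<lambda>x. \<Sum>n. c n * sin (freq n * x)) has_real_derivative
            (\<Sum>n. c n * (freq n) * cos (freq n * x))) (at x)"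
    and "((\<lambda>x. \<Sum>n. c n * (freq n) * cos (freq n * x)) has_real_derivative
            (\<Sum>n. - (freq n)\<^sup>2 * c n * sin (freq n * x))) (at x)"
proof -
  have s2: "summable (\<lambda>n. pi\<^sup>2 * ((real (Suc n))\<^sup>2 * \<bar>c n\<bar>))" using summ by (rule summable_mult)
  have s1: "summable (\<lambda>n. pi * ((real (Suc n))\<^sup>2 * \<bar>c n\<bar>))" using summ by (rule summable_mult)
  have le: "real (Suc n) * \<bar>c n\<bar> \<le> (real (Suc n))\<^sup>2 * \<bar>c n\<bar>" for n
    by (intro mult_right_mono self_le_power) auto
  show "((\<lambda>x. \<Sum>n. c n * sin (freq n * x)) has_real_derivative
            (\<Sum>n. c n * (freq n) * cos (freq n * x))) (at x)"
  proof (rule has_field_derivative_series'(2)[where S = UNIV and ?x0.0 = 0])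
    show "uniformly_convergent_on UNIV (\<lambda>n x. \<Sum>i<n. c i * (freq i) * cos (freq i * x))"
    proof (rule Weierstrass_m_test'[OF _ s1])
      fix n x
      have "\<bar>c n * (freq n) * cos (freq n * x)\<bar> \<le> \<bar>c n * (freq n)\<bar>"
        unfolding abs_mult[of _ "cos _"] by (intro mult_left_le) auto
      also have "\<dots> = pi * (real (Suc n) * \<bar>c n\<bar>)" by (simp add: abs_mult)
      also have "\<dots> \<le> pi * ((real (Suc n))\<^sup>2 * \<bar>c n\<bar>)" by (intro mult_left_mono le) auto
      finally show "norm (c n * (freq n) * cos (freq n * x)) \<le> pi * ((real (Suc n))\<^sup>2 * \<bar>c n\<bar>)"
        by simp
    qed
  qed (auto intro!: derivative_eq_intros)
  show "((\<lambda>x. \<Sum>n. c n * (freq n) * cos (freq n * x)) has_real_derivative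
            (\<Sum>n. - (freq n)\<^sup>2 * c n * sin (freq n * x))) (at x)"
  proof (rule has_field_derivative_series'(2)[where S = UNIV and ?x0.0 = "1/2"])
    show "uniformly_convergent_on UNIV (\<lambda>n x. \<Sum>i<n. - (freq i)\<^sup>2 * c i * sin (freq i * x))"
    proof (rule Weierstrass_m_test'[OF _ s2])
      fix n x
      have "\<bar>- (freq n)\<^sup>2 * c n * sin (freq n * x)\<bar> \<le> \<bar>- (freq n)\<^sup>2 * c n\<bar>"
        unfolding abs_mult[of _ "sin _"] by (intro mult_left_le) auto
      also have "\<dots> = pi\<^sup>2 * ((real (Suc n))\<^sup>2 * \<bar>c n\<bar>)" by (simp add: abs_mult power_mult_distrib)
      finally show "norm (- (freq n)\<^sup>2 * c n * sin (freq n * x)) \<le> pi\<^sup>2 * ((real (Suc n))\<^sup>2 * \<bar>c n\<bar>)"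
        by simp
    qed
    show "summable (\<lambda>n. c n * (freq n) * cos (freq n * (1 / 2)))"
    proof (rule summable_comparison_test'[OF s1, of 0])
      fix n
      have "\<bar>c n * (freq n) * cos (freq n * (1/2))\<bar> \<le> \<bar>c n * (freq n)\<bar>"
        unfolding abs_mult[of _ "cos _"] by (intro mult_left_le) auto
      also have "\<dots> = pi * (real (Suc n) * \<bar>c n\<bar>)" by (simp add: abs_mult)
      also have "\<dots> \<le> pi * ((real (Suc n))\<^sup>2 * \<bar>c n\<bar>)" by (intro mult_left_mono le) auto
      finally show "norm (c n * (freq n) * cos (freq n * (1/2))) \<le> pi * ((real (Suc n))\<^sup>2 * \<bar>c n\<bar>)"
        by simp
    qed
  qed (auto intro!: derivative_eq_intros simp: power2_eq_square)
qed

subsection \<open>Decay of the coefficients\<close>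

text \<open>Fubini on the triangle \<open>0 \<le> y \<le> x \<le> 1\<close>.\<close>

lemma L1_derivative_by_parts:
  assumes g: "has_L1_derivative01 g g'"
    and \<phi>: "\<And>x. (\<phi> has_real_derivative \<phi>' x) (at x)" and cont: "continuous_on UNIV \<phi>'"
  shows "(LINT x:{0..1}|lborel. g x * \<phi>' x)
     = g 1 * \<phi> 1 - g 0 * \<phi> 0 - (LINT x:{0..1}|lborel. g' x * \<phi> x)"
proof -
  have int_g': "set_integrable lborel {0..1} g'"
    and gx: "\<And>x. x \<in> {0..1} \<Longrightarrow> g x = g 0 + (LINT y:{0..x}|lborel. g' y)"
    using g unfolding has_L1_derivative01_def by blast+
  have ftc: "(LINT x:{y..1}|lborel. \<phi>' x) = \<phi> 1 - \<phi> y" if "y \<le> 1" for y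
  proof -
    have "(LINT x:{y..1}|lborel. \<phi>' x) = integral {y..1} \<phi>'"
      by (intro set_borel_integral_eq_integral borel_integrable_atLeastAtMost' continuous_on_subset[OF cont]) auto
    also have "\<dots> = \<phi> 1 - \<phi> y"
      using \<phi> that by (intro integral_unique fundamental_theorem_of_calculus)
        (auto simp: has_real_derivative_iff_has_vector_derivative intro: has_vector_derivative_at_within)
    finally show ?thesis .
  qed
  have int\<phi>': "set_integrable lborel {y..1} \<phi>'" for y
    by (intro borel_integrable_atLeastAtMost' continuous_on_subset[OF cont]) auto
  define G P where "G y = indicator {0..1} y * g' y" and "P x = indicator {0..1} x * \<phi>' x" for x y :: real
  define H where "H y x = (if y \<le> x then G y * P x else 0)" for x y
  have G: "integrable lborel G" using int_g' by (simp add: set_integrable_def G_def[abs_def])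
  have P: "integrable lborel P" using int\<phi>'[of 0] by (simp add: set_integrable_def P_def[abs_def])
  have [measurable]: "G \<in> borel_measurable borel" "P \<in> borel_measurable borel"
    using borel_measurable_integrable[OF G] borel_measurable_integrable[OF P] by simp_all
  have GP: "integrable (lborel \<Otimes>\<^sub>M lborel) (\<lambda>(y, x). G y * P x)"
  proof (rule lborel_pair.Fubini_integrable)
    show "integrable lborel (\<lambda>y. LINT x|lborel. norm (case (y, x) of (y, x) \<Rightarrow> G y * P x))"
      using G by (simp add: abs_mult)
    show "AE y in lborel. integrable lborel (\<lambda>x. case (y, x) of (y, x) \<Rightarrow> G y * P x)"
      using P by simp
  qed measurable
  have "case_prod H \<in> borel_measurable (lborel \<Otimes>\<^sub>M lborel)"
    unfolding H_def by measurable
  then have H: "integrable (lborel \<Otimes>\<^sub>M lborel) (case_prod H)"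
    by (rule Bochner_Integration.integrable_bound[OF GP]) (auto intro!: AE_I2 simp: H_def split: prod.split)
  have Hx: "(LINT x|lborel. H y x) = indicator {0..1} y *\<^sub>R (g' y * (\<phi> 1 - \<phi> y))" for y
  proof (cases "y \<in> {0..1}")
    case True
    have "(LINT x|lborel. H y x) = (LINT x|lborel. g' y * (indicator {y..1} x *\<^sub>R \<phi>' x))"
      by (rule Bochner_Integration.integral_cong)
         (use True in \<open>auto simp: H_def G_def P_def indicator_def\<close>)
    also have "\<dots> = g' y * (\<phi> 1 - \<phi> y)"
      using ftc[of y] True by (simp add: set_lebesgue_integral_def)
    finally show ?thesis using True by simp
  next
    case False
    then have "H y x = 0" for x by (auto simp: H_def G_def)
    then show ?thesis using False by simp
  qed
  have Hy: "(LINT y|lborel. H y x) = indicator {0..1} x *\<^sub>R ((g x - g 0) * \<phi>' x)" for x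
  proof (cases "x \<in> {0..1}")
    case True
    have "(LINT y|lborel. H y x) = (LINT y|lborel. \<phi>' x * (indicator {0..x} y *\<^sub>R g' y))"
      by (rule Bochner_Integration.integral_cong)
         (use True in \<open>auto simp: H_def G_def P_def indicator_def\<close>)
    also have "\<dots> = \<phi>' x * (g x - g 0)"
    proof -
      have "g x - g 0 = (LINT y:{0..x}|lborel. g' y)" using gx[OF True] by linarith
      then show ?thesis by (simp only: set_lebesgue_integral_def integral_mult_right_zero)
    qed
    finally show ?thesis using True by (simp add: mult.commute)
  next
    case False
    then have "H y x = 0" for y by (auto simp: H_def P_def)
    then show ?thesis using False by simp
  qed
  have iH: "set_integrable lborel {0..1} (\<lambda>x. (g x - g 0) * \<phi>' x)"
    using lborel_pair.integrable_snd[OF H] by (simp add: Hy set_integrable_def)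
  have cont\<phi>U: "continuous_on UNIV \<phi>"
    by (rule DERIV_continuous_on[of _ _ \<phi>']) (rule \<phi>)
  have cont\<phi>: "continuous_on {0..1} \<phi>"
    by (rule continuous_on_subset[OF cont\<phi>U]) auto
  have ig\<phi>: "set_integrable lborel {0..1} (\<lambda>y. g' y * \<phi> y)"
  proof -
    obtain B where B: "\<And>y. y \<in> {0..1} \<Longrightarrow> \<bar>\<phi> y\<bar> \<le> B"
      using compact_imp_bounded[OF compact_continuous_image[OF cont\<phi> compact_Icc]]
      unfolding bounded_iff by (metis imageI real_norm_def)
    have meas: "(\<lambda>y. indicator {0..1} y *\<^sub>R (g' y * \<phi> y)) \<in> borel_measurable lborel"
    proof -
      have [measurable]: "\<phi> \<in> borel_measurable borel"
        by (rule borel_measurable_continuous_onI[OF cont\<phi>U])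
      have "(\<lambda>y. G y * \<phi> y) \<in> borel_measurable lborel" by measurable
      then show ?thesis by (simp add: G_def mult.assoc)
    qed
    have "integrable lborel (\<lambda>y. B * G y)" using G by simp
    then show ?thesis
      unfolding set_integrable_def
    proof (rule Bochner_Integration.integrable_bound[OF _ meas], intro AE_I2)
      fix y
      show "norm (indicator {0..1} y *\<^sub>R (g' y * \<phi> y)) \<le> norm (B * G y)"
      proof (cases "y \<in> {0..1}")
        case True
        have "\<bar>g' y\<bar> * \<bar>\<phi> y\<bar> \<le> \<bar>g' y\<bar> * \<bar>B\<bar>"
          using B[OF True] by (intro mult_left_mono) auto
        then show ?thesis using True by (simp add: G_def abs_mult mult.commute)
      qed (simp add: G_def)
    qed
  qed
  have "(LINT x:{0..1}|lborel. g x * \<phi>' x)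
      = (LINT x:{0..1}|lborel. g 0 * \<phi>' x + (g x - g 0) * \<phi>' x)"
    by (simp add: algebra_simps)
  also have "\<dots> = (LINT x:{0..1}|lborel. g 0 * \<phi>' x) + (LINT x:{0..1}|lborel. (g x - g 0) * \<phi>' x)"
    by (rule set_integral_add(2)) (use int\<phi>' iH in auto)
  also have "(LINT x:{0..1}|lborel. g 0 * \<phi>' x) = g 0 * (\<phi> 1 - \<phi> 0)"
    using ftc[of 0] by simp
  also have "(LINT x:{0..1}|lborel. (g x - g 0) * \<phi>' x) = (LINT y:{0..1}|lborel. g' y * (\<phi> 1 - \<phi> y))"
    using lborel_pair.Fubini_integral[OF H] by (simp add: Hx Hy set_lebesgue_integral_def)
  also have "\<dots> = (LINT y:{0..1}|lborel. g' y * \<phi> 1 - g' y * \<phi> y)"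
    by (simp add: algebra_simps)
  also have "\<dots> = (LINT y:{0..1}|lborel. g' y * \<phi> 1) - (LINT y:{0..1}|lborel. g' y * \<phi> y)"
    by (rule set_integral_diff(2)) (use int_g' ig\<phi> in auto)
  also have "(LINT y:{0..1}|lborel. g' y * \<phi> 1) = (g 1 - g 0) * \<phi> 1"
  proof -
    have "g 1 - g 0 = (LINT y:{0..1}|lborel. g' y)" using gx[of 1] by simp
    then show ?thesis by simp
  qed
  finally show ?thesis by (simp add: algebra_simps)
qed

lemma by_parts_sin:
  assumes g: "has_L1_derivative01 g g'" and bdry: "g 0 = 0" "g 1 = 0" and k: "k \<noteq> 0"
  shows "(LINT x:{0..1}|lborel. g x * sin (real k * pi * x))
     = (LINT x:{0..1}|lborel. g' x * cos (real k * pi * x)) / (real k * pi)"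
proof -
  define w where "w = real k * pi"
  have "((\<lambda>x. - cos (w * x) / w) has_real_derivative sin (w * x)) (at x)" for x
    using k by (auto intro!: derivative_eq_intros simp: w_def)
  moreover have "continuous_on UNIV (\<lambda>x. sin (w * x))" by (intro continuous_intros)
  ultimately have "(LINT x:{0..1}|lborel. g x * sin (w * x))
      = g 1 * (- cos (w * 1) / w) - g 0 * (- cos (w * 0) / w) - (LINT x:{0..1}|lborel. g' x * (- cos (w * x) / w))"
    by (rule L1_derivative_by_parts[OF g])
  then have "(LINT x:{0..1}|lborel. g x * sin (w * x)) = - (LINT x:{0..1}|lborel. g' x * (- cos (w * x) / w))"
    by (simp only: bdry mult_zero_left diff_0_right diff_0)
  then show ?thesis by (simp add: set_lebesgue_integral_def w_def)
qed

lemma by_parts_cos: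
  assumes g: "has_L1_derivative01 g g'" and k: "k \<noteq> 0"
  shows "(LINT x:{0..1}|lborel. g x * cos (real k * pi * x))
     = - (LINT x:{0..1}|lborel. g' x * sin (real k * pi * x)) / (real k * pi)"
proof -
  define w where "w = real k * pi"
  have "((\<lambda>x. sin (w * x) / w) has_real_derivative cos (w * x)) (at x)" for x
    using k by (auto intro!: derivative_eq_intros simp: w_def)
  moreover have "continuous_on UNIV (\<lambda>x. cos (w * x))" by (intro continuous_intros)
  ultimately have "(LINT x:{0..1}|lborel. g x * cos (w * x))
      = g 1 * (sin (w * 1) / w) - g 0 * (sin (w * 0) / w) - (LINT x:{0..1}|lborel. g' x * (sin (w * x) / w))"
    by (rule L1_derivative_by_parts[OF g])
  also have "\<dots> = - (LINT x:{0..1}|lborel. g' x * (sin (w * x) / w))"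
    by (simp add: w_def)
  finally have "(LINT x:{0..1}|lborel. g x * cos (w * x)) = - (LINT x:{0..1}|lborel. g' x * (sin (w * x) / w))" .
  then show ?thesis by (simp add: set_lebesgue_integral_def w_def)
qed

lemma Ck01_L1_derivative:
  assumes g: "g \<in> Ck01 n" and i: "i < n"
  shows "has_L1_derivative01 (nderiv01 i g) (nderiv01 (Suc i) g)"
proof -
  have cont: "continuous_on {0..1} (nderiv01 (Suc i) g)"
    and diff: "\<And>x. x \<in> {0..1} \<Longrightarrow> nderiv01 i g differentiable (at x within {0..1})"
    using g i unfolding Ck01_def by auto
  have der: "(nderiv01 i g has_vector_derivative nderiv01 (Suc i) g x) (at x within {0..1})" if "x \<in> {0..1}" for x
    using vector_derivative_works[THEN iffD1, OF diff[OF that]] by (simp add: nderiv01_def)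
  show ?thesis unfolding has_L1_derivative01_def
  proof (intro conjI ballI)
    show "set_integrable lborel {0..1} (nderiv01 (Suc i) g)"
      by (rule borel_integrable_atLeastAtMost'[OF cont])
    fix x :: real assume x: "x \<in> {0..1}"
    have "(LINT y:{0..x}|lborel. nderiv01 (Suc i) g y) = integral {0..x} (nderiv01 (Suc i) g)"
      by (intro set_borel_integral_eq_integral borel_integrable_atLeastAtMost' continuous_on_subset[OF cont]) (use x in auto)
    also have "\<dots> = nderiv01 i g x - nderiv01 i g 0"
      using x by (intro integral_unique fundamental_theorem_of_calculus)
        (auto intro: has_vector_derivative_within_subset[OF der])
    finally show "nderiv01 i g x = nderiv01 i g 0 + (LINT y:{0..x}|lborel. nderiv01 (Suc i) g y)" by simp
  qed
qed

text \<open>Integrating by parts four times.  The boundary terms vanish alternately because \<open>g\<close> and its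
  second derivative do and because \<open>sin (k \<pi> x)\<close> does.\<close>

lemma sine_coeff_fourth_derivative_bound:
  assumes g: "g \<in> Ck01 3" and bdry: "g 0 = 0" "g 1 = 0" "nderiv01 2 g 0 = 0" "nderiv01 2 g 1 = 0"
    and g4: "has_L1_derivative01 (nderiv01 3 g) g4" and k: "k \<noteq> 0"
  shows "\<bar>sine_coeff g k\<bar> \<le> 2 / (real k * pi) ^ 4 * (LINT x:{0..1}|lborel. \<bar>g4 x\<bar>)"
proof -
  define w where "w = real k * pi"
  have w: "0 < w" using k by (simp add: w_def)
  have d0: "has_L1_derivative01 g (nderiv01 1 g)"
    using Ck01_L1_derivative[OF g, of 0] by (simp add: nderiv01_def)
  have d1: "has_L1_derivative01 (nderiv01 1 g) (nderiv01 2 g)"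
    using Ck01_L1_derivative[OF g, of 1] by (simp add: numeral_2_eq_2)
  have d2: "has_L1_derivative01 (nderiv01 2 g) (nderiv01 3 g)"
    using Ck01_L1_derivative[OF g, of 2] by (simp add: numeral_3_eq_3 numeral_2_eq_2)
  have "(LINT x:{0..1}|lborel. g x * sin (real k * pi * x))
      = (LINT x:{0..1}|lborel. g4 x * sin (real k * pi * x)) / w ^ 4"
    unfolding by_parts_sin[OF d0 bdry(1,2) k] by_parts_cos[OF d1 k] by_parts_sin[OF d2 bdry(3,4) k]
      by_parts_cos[OF g4 k] w_def by (simp add: eval_nat_numeral)
  moreover have "\<bar>LINT x:{0..1}|lborel. g4 x * sin (real k * pi * x)\<bar> \<le> (LINT x:{0..1}|lborel. \<bar>g4 x\<bar>)"
  proof -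
    have int: "set_integrable lborel {0..1} g4" using g4 by (simp add: has_L1_derivative01_def)
    then have [measurable]: "(\<lambda>x. indicator {0..1} x * g4 x) \<in> borel_measurable borel"
      using borel_measurable_integrable by (force simp: set_integrable_def)
    have le: "norm (indicator {0..1} x *\<^sub>R (g4 x * sin (real k * pi * x))) \<le> indicator {0..1} x *\<^sub>R \<bar>g4 x\<bar>" for x
      by (auto simp: indicator_def abs_mult mult_left_le)
    have "norm (LINT x:{0..1}|lborel. g4 x * sin (real k * pi * x))
        \<le> (LINT x|lborel. norm (indicator {0..1} x *\<^sub>R (g4 x * sin (real k * pi * x))))"
      unfolding set_lebesgue_integral_def by (rule integral_norm_bound)
    also have "\<dots> \<le> (LINT x:{0..1}|lborel. \<bar>g4 x\<bar>)"
      unfolding set_lebesgue_integral_def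
    proof (rule integral_mono[OF _ _ le])
      show *: "integrable lborel (\<lambda>x. indicator {0..1} x *\<^sub>R \<bar>g4 x\<bar>)"
        using set_integrable_abs[OF int] by (simp add: set_integrable_def)
      have "(\<lambda>x. (indicator {0..1} x * g4 x) * sin (real k * pi * x)) \<in> borel_measurable lborel"
        by measurable
      then show "integrable lborel (\<lambda>x. norm (indicator {0..1} x *\<^sub>R (g4 x * sin (real k * pi * x))))"
        by (intro integrable_norm Bochner_Integration.integrable_bound[OF *])
           (use order_trans[OF le abs_ge_self] in \<open>auto simp: mult.assoc\<close>)
    qed
    finally show ?thesis by simp
  qed
  ultimately have "\<bar>LINT x:{0..1}|lborel. g x * sin (real k * pi * x)\<bar> \<le> (LINT x:{0..1}|lborel. \<bar>g4 x\<bar>) / w ^ 4"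
    using w by (simp add: divide_right_mono)
  then show ?thesis by (simp add: sine_coeff_def w_def abs_mult)
qed

text \<open>Expanding the square in \<open>0 \<le> \<integral> (g - \<Sum> 2 b\<^sub>n cos (n \<pi> x))\<^sup>2\<close> gives \<open>2 \<Sum> b\<^sub>n\<^sup>2 \<le> \<integral> g\<^sup>2\<close>.\<close>

lemma Bessel_cosine:
  assumes g: "set_integrable lborel {0..1} g" and g2: "set_integrable lborel {0..1} (\<lambda>x. (g x)\<^sup>2)"
  defines "b \<equiv> \<lambda>n. (LINT x:{0..1}|lborel. g x * cos (freq n * x))"
  shows "summable (\<lambda>n. (b n)\<^sup>2)"
proof -
  have [measurable]: "(\<lambda>x. indicator {0..1} x * g x) \<in> borel_measurable borel"
    using borel_measurable_integrable[OF g[unfolded set_integrable_def]] by simp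
  have gc: "set_integrable lborel {0..1} (\<lambda>x. g x * cos (freq n * x))" for n
  proof -
    have "(\<lambda>x. (indicator {0..1} x * g x) * cos (freq n * x)) \<in> borel_measurable lborel"
      by measurable
    then show ?thesis
      unfolding set_integrable_def
      by (intro Bochner_Integration.integrable_bound[OF g[unfolded set_integrable_def]])
         (auto simp: indicator_def abs_mult mult_left_le mult.assoc)
  qed
  have cc: "set_integrable lborel {0..1} (\<lambda>x. cos (freq n * x) * cos (freq m * x))" for n m
    by (intro borel_integrable_atLeastAtMost' continuous_intros)
  have ccv: "(LINT x:{0..1}|lborel. cos (freq n * x) * cos (freq m * x)) = (if n = m then 1/2 else 0)" for n m
    using set_borel_integral_eq_integral(2)[OF cc[of n m]] cosine_orthogonal[of "Suc n" "Suc m"]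
    by (simp add: integral_unique)
  have "(\<Sum>n<N. (b n)\<^sup>2) \<le> (LINT x:{0..1}|lborel. (g x)\<^sup>2) / 2" for N
  proof -
    have "0 \<le> (LINT x:{0..1}|lborel. (g x - (\<Sum>n<N. 2 * b n * cos (freq n * x)))\<^sup>2)"
      by (simp add: set_lebesgue_integral_def integral_nonneg_AE)
    also have "\<dots> = (LINT x:{0..1}|lborel. (g x)\<^sup>2 - (\<Sum>n<N. 4 * b n * (g x * cos (freq n * x)))
        + (\<Sum>n<N. \<Sum>m<N. 4 * b n * b m * (cos (freq n * x) * cos (freq m * x))))"
    proof -
      have "(u - (\<Sum>n<N. 2 * b n * c n))\<^sup>2 = u\<^sup>2 - (\<Sum>n<N. 4 * b n * (u * c n))
        + (\<Sum>n<N. \<Sum>m<N. 4 * b n * b m * (c n * c m))" for u and c :: "nat \<Rightarrow> real"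
      proof -
        have "(\<Sum>n<N. 2 * b n * c n) * (\<Sum>m<N. 2 * b m * c m) = (\<Sum>n<N. \<Sum>m<N. 4 * b n * b m * (c n * c m))"
          unfolding sum_product by (simp add: mult_ac)
        moreover have "2 * (u * (\<Sum>n<N. 2 * b n * c n)) = (\<Sum>n<N. 4 * b n * (u * c n))"
          unfolding sum_distrib_left by (simp add: mult_ac)
        ultimately show ?thesis by (simp add: power2_eq_square algebra_simps)
      qed
      then show ?thesis by simp
    qed
    also have "\<dots> = (LINT x:{0..1}|lborel. (g x)\<^sup>2) - (\<Sum>n<N. 4 * b n * b n)
        + (\<Sum>n<N. \<Sum>m<N. 4 * b n * b m * (if n = m then 1/2 else 0))"
    proof -
      have i1: "set_integrable lborel {0..1} (\<lambda>x. \<Sum>n<N. 4 * b n * (g x * cos (freq n * x)))"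
        using gc unfolding set_integrable_def scaleR_sum_right
        by (intro Bochner_Integration.integrable_sum) (simp add: mult.left_commute[of "indicator _ _"])
      have v1: "(LINT x:{0..1}|lborel. \<Sum>n<N. 4 * b n * (g x * cos (freq n * x))) = (\<Sum>n<N. 4 * b n * b n)"
        using gc unfolding set_lebesgue_integral_def scaleR_sum_right set_integrable_def
        by (subst Bochner_Integration.integral_sum)
           (simp_all add: mult.left_commute[of "indicator _ _"] b_def set_lebesgue_integral_def)
      have i2: "set_integrable lborel {0..1} (\<lambda>x. \<Sum>n<N. \<Sum>m<N. 4 * b n * b m * (cos (freq n * x) * cos (freq m * x)))"
        by (intro borel_integrable_atLeastAtMost' continuous_intros)
      have v2: "(LINT x:{0..1}|lborel. \<Sum>n<N. \<Sum>m<N. 4 * b n * b m * (cos (freq n * x) * cos (freq m * x)))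
          = (\<Sum>n<N. \<Sum>m<N. 4 * b n * b m * (if n = m then 1/2 else 0))"
      proof -
        define E where "E n m x = 4 * b n * b m * (indicator {0..1} x * (cos (freq n * x) * cos (freq m * x)))" for n m x
        have *: "integrable lborel (E n m)" for n m
          using cc[of n m] by (simp add: set_integrable_def E_def[abs_def])
        have **: "(LINT x|lborel. E n m x) = 4 * b n * b m * (if n = m then 1/2 else 0)" for n m
          using ccv[of n m] by (simp add: set_lebesgue_integral_def E_def)
        have "(\<lambda>x. indicator {0..1} x *\<^sub>R (\<Sum>n<N. \<Sum>m<N. 4 * b n * b m * (cos (freq n * x) * cos (freq m * x))))
           = (\<lambda>x. \<Sum>n<N. \<Sum>m<N. E n m x)"
          by (simp add: E_def sum_distrib_left mult_ac del: of_nat_Suc)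
        then show ?thesis
          unfolding set_lebesgue_integral_def
          by (simp add: * ** Bochner_Integration.integral_sum Bochner_Integration.integrable_sum del: of_nat_Suc)
      qed
      show ?thesis
        by (simp add: set_integral_add(2)[OF set_integral_diff(1)[OF g2 i1] i2] set_integral_diff(2)[OF g2 i1] v1 v2 del: of_nat_Suc)
    qed
    also have "(\<Sum>n<N. \<Sum>m<N. 4 * b n * b m * (if n = m then 1/2 else 0)) = (\<Sum>n<N. 2 * (b n)\<^sup>2)"
      by (simp add: power2_eq_square mult.assoc if_distrib[of "\<lambda>u. _ * u"] cong: if_cong)
    finally show ?thesis by (simp add: power2_eq_square mult.assoc flip: sum_distrib_left)
  qed
  from this[of "Suc _"] show ?thesis
    by (intro bounded_imp_summable[where B = "(LINT x:{0..1}|lborel. (g x)\<^sup>2) / 2"])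
       (simp_all only: lessThan_Suc_atMost zero_le_power2)
qed

text \<open>The \<open>n\<close>-th coefficient is \<open>2 / (n \<pi>)\<close> times the cosine coefficient of the derivative; a product of
  two square summable sequences is summable.\<close>

lemma summable_sine_coeff_H1:
  assumes g: "has_L1_derivative01 g g'" and bdry: "g 0 = 0" "g 1 = 0"
    and g2: "set_integrable lborel {0..1} (\<lambda>x. (g' x)\<^sup>2)"
  shows "summable (\<lambda>n. \<bar>sine_coeff g (Suc n)\<bar>)"
proof -
  define b where "b n = (LINT x:{0..1}|lborel. g' x * cos (freq n * x))" for n
  have b: "summable (\<lambda>n. (b n)\<^sup>2)"
    unfolding b_def by (rule Bessel_cosine[OF _ g2]) (use g in \<open>simp add: has_L1_derivative01_def\<close>)
  have "\<bar>sine_coeff g (Suc n)\<bar> \<le> 1 / (real (Suc n))\<^sup>2 + (b n)\<^sup>2" for n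
  proof -
    define d where "d = 1 / (freq n)"
    have d: "0 < d" by (simp add: d_def)
    have "\<bar>sine_coeff g (Suc n)\<bar> = 2 * (d * \<bar>b n\<bar>)"
      using by_parts_sin[OF g bdry, of "Suc n"] by (simp add: sine_coeff_def b_def d_def abs_mult)
    also have "\<dots> \<le> d\<^sup>2 + (b n)\<^sup>2"
      using sum_squares_bound[of d "\<bar>b n\<bar>"] by simp
    also have "d\<^sup>2 \<le> 1 / (real (Suc n))\<^sup>2"
    proof -
      have "real (Suc n) * 1 \<le> freq n"
        using pi_ge_two by (intro mult_left_mono) auto
      then have "d \<le> 1 / real (Suc n)"
        unfolding d_def by (intro divide_left_mono) auto
      then show ?thesis
        using power_mono[of d "1 / real (Suc n)" 2] d by (simp add: power_divide)
    qed
    finally show ?thesis by simp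
  qed
  then show ?thesis
    by (intro summable_comparison_test'[OF summable_add[OF summable_Suc_powr2 b], of 0]) auto
qed

section \<open>Superposition of relaxation modes\<close>

lemma continuous_on_sine_series:
  fixes c :: "nat \<Rightarrow> real \<Rightarrow> real"
  assumes c: "\<And>n. continuous_on S (c n)" and M: "\<And>n z. z \<in> S \<Longrightarrow> \<bar>c n z\<bar> \<le> M n" "summable M"
  shows "continuous_on (UNIV \<times> S) (\<lambda>(x, z). \<Sum>n. c n z * sin (freq n * x))"
proof -
  have "uniform_limit (UNIV \<times> S) (\<lambda>n w. \<Sum>i<n. c i (snd w) * sin (freq i * fst w))
     (\<lambda>w. \<Sum>i. c i (snd w) * sin (freq i * fst w)) sequentially"
  proof (rule Weierstrass_m_test[OF _ M(2)])
    fix n and w :: "real \<times> real" assume "w \<in> UNIV \<times> S"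
    then have "\<bar>c n (snd w)\<bar> \<le> M n" by (auto intro: M(1))
    then show "norm (c n (snd w) * sin (freq n * fst w)) \<le> M n"
      using mult_left_le[of "\<bar>sin (freq n * fst w)\<bar>" "\<bar>c n (snd w)\<bar>"] by (simp add: abs_mult)
  qed
  then have "continuous_on (UNIV \<times> S) (\<lambda>w. \<Sum>i. c i (snd w) * sin (freq i * fst w))"
  proof (rule uniform_limit_theorem[rotated])
    have "continuous_on (UNIV \<times> S) (\<lambda>w. c i (snd w))" for i
      by (rule continuous_on_compose2[OF c continuous_on_snd]) (auto intro: continuous_on_id)
    then show "\<forall>\<^sub>F n in sequentially. continuous_on (UNIV \<times> S) (\<lambda>w. \<Sum>i<n. c i (snd w) * sin (freq i * fst w))"
      by (intro always_eventually allI continuous_intros)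
  qed simp
  then show ?thesis by (simp add: case_prod_beta')
qed

text \<open>The majorants available for the series blow up at \<open>z = 0\<close>, so continuity is obtained on
  every strip \<open>{d<..<L}\<close> separately.\<close>

lemma continuous_on_strip_local:
  fixes g :: "real \<times> real \<Rightarrow> real"
  assumes "\<And>d. 0 < d \<Longrightarrow> continuous_on (UNIV \<times> {d<..<L}) g"
  shows "continuous_on (UNIV \<times> {0<..<L}) g"
proof -
  have "(UNIV :: real set) \<times> {0<..<L} = (\<Union>d\<in>{0<..}. UNIV \<times> {d<..<L})"
  proof (intro equalityI subsetI)
    fix w :: "real \<times> real" assume "w \<in> UNIV \<times> {0<..<L}"
    then have "w \<in> UNIV \<times> {snd w / 2<..<L}" "0 < snd w / 2" by (auto simp: mem_Times_iff)
    then show "w \<in> (\<Union>d\<in>{0<..}. UNIV \<times> {d<..<L})" by blast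
  qed auto
  moreover have "continuous_on (\<Union>d\<in>{0<..}. (UNIV :: real set) \<times> {d<..<L}) g"
    by (rule continuous_on_open_UN) (auto intro: open_Times assms)
  ultimately show ?thesis by simp
qed

lemma rl_int_uniform_limit:
  assumes b: "0 \<le> b" and z: "0 < z" and u: "uniform_limit {0..z} g h sequentially"
    and g: "\<And>n. continuous_on {0..z} (g n)"
  shows "(\<lambda>n. rl_int b (g n) z) \<longlonglongrightarrow> rl_int b h z"
proof (rule LIMSEQ_I)
  fix r :: real assume r: "0 < r"
  have h: "continuous_on {0..z} h"
    by (rule uniform_limit_theorem[OF _ u]) (auto intro!: always_eventually g)
  define e where "e = r / (2 * (pker (b + 1) z))"
  have pk: "0 < pker (b + 1) z" using b z by (intro pker_pos) auto
  then have e: "0 < e" using r by (simp add: e_def)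
  obtain N where N: "\<And>n s. \<lbrakk>N \<le> n; s \<in> {0..z}\<rbrakk> \<Longrightarrow> dist (g n s) (h s) < e"
    using u e unfolding uniform_limit_iff eventually_sequentially by meson
  have "norm (rl_int b (g n) z - rl_int b h z) < r" if "N \<le> n" for n
  proof -
    have "\<bar>rl_int b (\<lambda>s. g n s - h s) z\<bar> \<le> e * pker (b + 1) z"
      by (rule rl_int_bound[OF b z])
         (use N[OF that] in \<open>auto intro!: continuous_intros g h less_imp_le simp: dist_real_def\<close>)
    also have "\<dots> < r" using pk r by (simp add: e_def)
    also have "rl_int b (\<lambda>s. g n s - h s) z = rl_int b (g n) z - rl_int b h z"
      by (rule rl_int_diff[OF b z g h])
    finally show ?thesis by simp
  qed
  then show "\<exists>N. \<forall>n\<ge>N. norm (rl_int b (g n) z - rl_int b h z) < r" by blast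
qed

lemma rl_int_suminf:
  assumes b: "0 \<le> b" and z: "0 < z"
    and g: "\<And>n. continuous_on {0..z} (g n)" and M: "\<And>n s. s \<in> {0..z} \<Longrightarrow> \<bar>g n s\<bar> \<le> M n" "summable M"
  shows "(\<lambda>n. rl_int b (g n) z) sums rl_int b (\<lambda>s. \<Sum>n. g n s) z"
proof -
  have u: "uniform_limit {0..z} (\<lambda>n s. \<Sum>i<n. g i s) (\<lambda>s. \<Sum>n. g n s) sequentially"
    by (rule Weierstrass_m_test[OF _ M(2)]) (use M(1) in simp)
  have part: "rl_int b (\<lambda>s. \<Sum>i<n. g i s) z = (\<Sum>i<n. rl_int b (g i) z)" for n
  proof (induction n)
    case 0
    show ?case using rl_int_cmult[of b 0 "\<lambda>_. 0" z] by simp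
  next
    case (Suc n)
    then show ?case
      by (simp add: rl_int_add[OF b z continuous_on_sum[OF g] g])
  qed
  show ?thesis
    using rl_int_uniform_limit[OF b z u continuous_on_sum[OF g]] by (simp add: part sums_def)
qed

text \<open>The fundamental theorem of calculus for an integrand that may be singular at \<open>0\<close>: only the part
  of the integral beyond \<open>d > 0\<close> varies.\<close>

lemma conv_pker_1_derivative:
  assumes z: "0 < z" "z < L" and H: "continuous_on {0<..<L} H" and int: "conv_integrable (pker 1) H z'" and z': "z < z'" "z' < L"
  shows "(conv (pker 1) H has_real_derivative H z) (at z)"
proof -
  define d where "d = z / 2"
  have d: "0 < d" "d < z" using z by (auto simp: d_def)
  have intH: "set_integrable lborel {0<..<y} H" if "0 < y" "y \<le> z'" for y
  proof -
    have "set_integrable lborel {0<..<z'} H"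
      using int unfolding conv_integrable_def
      by (subst (asm) set_integrable_cong[where f' = H]) (auto simp: pker_1)
    then show ?thesis by (rule set_integrable_subset) (use that in auto)
  qed
  have cv: "conv (pker 1) H y = (LINT s:{0<..<y}|lborel. H s)" for y
    unfolding conv_def by (intro set_lebesgue_integral_cong) (auto simp: pker_1)
  have Hc: "continuous_on {d..z'} H" by (rule continuous_on_subset[OF H]) (use d z' in auto)
  have split: "conv (pker 1) H y = conv (pker 1) H d + integral {d..y} H" if y: "y \<in> {d<..<z'}" for y
  proof -
    have "set_integrable lborel {d..y} H"
      by (rule borel_integrable_atLeastAtMost'[OF continuous_on_subset[OF Hc]]) (use y in auto)
    moreover have "{0<..<y} = {0<..<d} \<union> {d..<y}" using y d by auto
    moreover have "{0<..<d} \<inter> {d..<y} = {}" by auto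
    moreover have "set_integrable lborel {d..<y} H"
      by (rule set_integrable_subset[OF intH[of y]]) (use y d in auto)
    moreover have "(LINT s:{d..<y}|lborel. H s) = (LINT s:{d..y}|lborel. H s)"
      unfolding set_lebesgue_integral_def
      by (rule integral_discrete_difference[of "{y}"]) (auto simp: indicator_def)
    ultimately show ?thesis
      using set_integral_Un[of "{0<..<d}" "{d..<y}" lborel H] intH[of d] y d
      by (simp add: cv set_borel_integral_eq_integral(2))
  qed
  have "((\<lambda>y. integral {d..y} H) has_real_derivative H z) (at z within {d..z'})"
    by (rule integral_has_real_derivative[OF Hc]) (use d z' in auto)
  then have "((\<lambda>y. integral {d..y} H) has_real_derivative H z) (at z)"
    using at_within_interior[of z "{d..z'}"] d z' by simp
  then have "((\<lambda>y. conv (pker 1) H d + integral {d..y} H) has_real_derivative H z) (at z)"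
    by (auto intro!: derivative_eq_intros)
  then show ?thesis
    by (rule has_field_derivative_transform_within_open[of _ _ _ "{d<..<z'}"]) (use d z' split in auto)
qed

text \<open>Mode number \<open>n\<close> belongs to the eigenvalue \<open>lam n\<close> of \<open>- d\<^sup>2/dx\<^sup>2\<close>; \<open>T n\<close> and \<open>F n\<close> are the
  coefficients of the initial value and of the source, and the constant \<open>c\<close> is the factor
  \<open>p powr (- \<alpha>)\<close> produced by the change of the time variable.\<close>

locale relaxation_modes =
  fixes \<alpha> c L \<nu> K :: real and T :: "nat \<Rightarrow> real" and F :: "nat \<Rightarrow> real \<Rightarrow> real"
  assumes \<alpha>: "0 < \<alpha>" "\<alpha> \<le> 1" and c: "0 < c" and L: "0 < L" and \<nu>: "- \<alpha> < \<nu>" "\<nu> \<le> 0"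
    and T: "summable (\<lambda>n. \<bar>T n\<bar>)"
    and F_cont: "\<And>n. continuous_on {0<..L} (F n)"
    and F_bound: "\<And>n z. \<lbrakk>0 < z; z \<le> L\<rbrakk> \<Longrightarrow> \<bar>F n z\<bar> \<le> K / real (Suc n) ^ 4 * z powr \<nu>"
begin

definition lam :: "nat \<Rightarrow> real" where "lam n = (freq n)\<^sup>2"
definition rate :: "nat \<Rightarrow> real" where "rate n = c * lam n"
definition E :: "nat \<Rightarrow> real \<Rightarrow> real" where
  "E n z = T n * mittag_leffler \<alpha> 1 (- rate n * z powr \<alpha>)"
definition G :: "nat \<Rightarrow> real \<Rightarrow> real" where
  "G n z = c * conv (mlk \<alpha> (rate n) \<alpha>) (F n) z"
definition U :: "nat \<Rightarrow> real \<Rightarrow> real" where "U n z = E n z + G n z"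
text \<open>Up to the factor \<open>c\<close>, the Caputo derivative that mode \<open>n\<close> has to have.\<close>

definition H :: "nat \<Rightarrow> real \<Rightarrow> real" where "H n z = F n z - lam n * U n z"

lemma lam_pos: "0 < lam n" and rate_pos: "0 < rate n"
  using c by (simp_all add: lam_def rate_def)

lemma K_nonneg: "0 \<le> K"
proof -
  have "0 \<le> K * L powr \<nu>" using order_trans[OF abs_ge_zero F_bound[OF L order_refl, of 0]] by simp
  then show ?thesis using L by (simp add: zero_le_mult_iff)
qed

lemma conv_powr_dominated:
  assumes b: "0 < b" and z: "0 < z" and A: "A \<in> borel_measurable borel" "\<And>s. \<lbrakk>0 < s; s < z\<rbrakk> \<Longrightarrow> \<bar>A s\<bar> \<le> pker b s"
    and g: "set_borel_measurable borel {0<..<z} g" "\<And>s. \<lbrakk>0 < s; s < z\<rbrakk> \<Longrightarrow> \<bar>g s\<bar> \<le> C * s powr \<nu>"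
  shows "conv_integrable A g z" and "\<bar>conv A g z\<bar> \<le> C * (Gamma (\<nu> + 1) * pker (b + \<nu> + 1) z)"
proof -
  have \<nu>1: "0 < \<nu> + 1" using \<nu> \<alpha> by simp
  have ci: "conv_integrable (pker b) (\<lambda>s. C * Gamma (\<nu> + 1) * pker (\<nu> + 1) s) z"
    and cv: "conv (pker b) (\<lambda>s. C * Gamma (\<nu> + 1) * pker (\<nu> + 1) s) z = C * (Gamma (\<nu> + 1) * pker (b + \<nu> + 1) z)"
    using conv_pker_pker[OF b \<nu>1 z] by (simp_all add: conv_cmult_right add.assoc)
  have gb: "\<bar>g s\<bar> \<le> C * Gamma (\<nu> + 1) * pker (\<nu> + 1) s" if "0 < s" "s < z" for s
    using g(2)[OF that] Gamma_real_pos[OF \<nu>1] by (simp add: pker_def)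
  show "conv_integrable A g z"
    by (rule conv_dominated(1)[OF A(1) g(1) A(2) gb ci])
  show "\<bar>conv A g z\<bar> \<le> C * (Gamma (\<nu> + 1) * pker (b + \<nu> + 1) z)"
    using conv_dominated(2)[OF A(1) g(1) A(2) gb ci] cv by simp
qed

lemma resolvent_abs_le:
  assumes "0 < s" shows "\<bar>mlk \<alpha> (rate n) \<alpha> s\<bar> \<le> pker \<alpha> s"
  using mlk_resolvent_pos[OF \<alpha> rate_pos assms, of n] mlk_resolvent_le[OF \<alpha> rate_pos assms, of n] by simp

lemma F_measurable: "z \<le> L \<Longrightarrow> set_borel_measurable borel {0<..<z} (F n)"
  by (rule continuous_imp_measurable[OF continuous_on_subset[OF F_cont]]) auto

definition CG :: real where "CG = c * K * Gamma (\<nu> + 1) * pker (\<alpha> + \<nu> + 1) L"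

lemma CG_nonneg: "0 \<le> CG"
  using c K_nonneg \<nu> \<alpha> by (simp add: CG_def less_imp_le)

lemma G_bound_powr:
  assumes z: "0 < z" "z \<le> L"
  shows "\<bar>G n z\<bar> \<le> c * (K / real (Suc n) ^ 4) * (Gamma (\<nu> + 1) * pker (\<alpha> + \<nu> + 1) z)"
proof -
  have "\<bar>conv (mlk \<alpha> (rate n) \<alpha>) (F n) z\<bar> \<le> K / real (Suc n) ^ 4 * (Gamma (\<nu> + 1) * pker (\<alpha> + \<nu> + 1) z)"
    by (rule conv_powr_dominated(2)[OF \<alpha>(1) z(1) mlk_measurable[OF \<alpha>(1) \<alpha>(1)] resolvent_abs_le F_measurable[OF z(2)] F_bound])
       (use z in auto)
  from mult_left_mono[OF this, of c] show ?thesis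
    using c by (simp add: G_def abs_mult mult.assoc)
qed

lemma G_bound:
  assumes z: "0 \<le> z" "z \<le> L"
  shows "\<bar>G n z\<bar> \<le> CG / real (Suc n) ^ 4"
proof (cases "z = 0")
  case True
  then show ?thesis using CG_nonneg by (simp add: G_def)
next
  case False
  then have "0 < z" using z by simp
  have "pker (\<alpha> + \<nu> + 1) z \<le> pker (\<alpha> + \<nu> + 1) L"
    using z \<nu> \<alpha> unfolding pker_def by (intro divide_right_mono powr_mono2) (auto simp: less_imp_le)
  then have "c * (K / real (Suc n) ^ 4) * (Gamma (\<nu> + 1) * pker (\<alpha> + \<nu> + 1) z)
      \<le> c * (K / real (Suc n) ^ 4) * (Gamma (\<nu> + 1) * pker (\<alpha> + \<nu> + 1) L)"
    using c K_nonneg \<nu> \<alpha> by (intro mult_left_mono) (auto simp: less_imp_le)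
  also have "\<dots> = CG / real (Suc n) ^ 4" by (simp add: CG_def)
  finally show ?thesis using G_bound_powr[OF \<open>0 < z\<close> z(2), of n] by simp
qed

lemma E_eq: "0 < z \<Longrightarrow> E n z = T n * mlk \<alpha> (rate n) 1 z"
  by (simp add: E_def mlk_def)

lemma E_0: "E n 0 = T n"
  using \<alpha> by (simp add: E_def mittag_leffler_0)

lemma E_bound: "0 \<le> z \<Longrightarrow> \<bar>E n z\<bar> \<le> \<bar>T n\<bar>"
  using relaxation_bounds[OF \<alpha> rate_pos, of z n]
  by (cases "z = 0") (auto simp: E_0 E_eq abs_mult mult_left_le)

text \<open>The decay of the relaxation function compensates the eigenvalue, at the price of a singularity at
  \<open>z = 0\<close>.\<close>

lemma lam_E_bound:
  assumes z: "0 < z" shows "lam n * \<bar>E n z\<bar> \<le> \<bar>T n\<bar> * (Gamma (\<alpha> + 1) / c * z powr (- \<alpha>))"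
proof -
  have "lam n * mlk \<alpha> (rate n) 1 z \<le> Gamma (\<alpha> + 1) / c * z powr (- \<alpha>)"
    using relaxation_decay[OF \<alpha> rate_pos z, of n] c by (simp add: rate_def field_simps)
  then have "\<bar>T n\<bar> * (lam n * mlk \<alpha> (rate n) 1 z) \<le> \<bar>T n\<bar> * (Gamma (\<alpha> + 1) / c * z powr (- \<alpha>))"
    by (rule mult_left_mono) simp
  then show ?thesis
    using relaxation_bounds(1)[OF \<alpha> rate_pos z, of n] by (simp add: E_eq z abs_mult mult_ac)
qed

lemma lam_G_bound:
  assumes z: "0 \<le> z" "z \<le> L" shows "lam n * \<bar>G n z\<bar> \<le> pi\<^sup>2 * CG * (1 / (real (Suc n))\<^sup>2)"
proof -
  have "lam n * \<bar>G n z\<bar> \<le> lam n * (CG / real (Suc n) ^ 4)"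
    using lam_pos[of n] by (intro mult_left_mono G_bound z) auto
  also have "\<dots> = pi\<^sup>2 * CG * (1 / (real (Suc n))\<^sup>2)"
    by (simp add: lam_def power_mult_distrib field_simps power4_eq_xxxx power2_eq_square del: of_nat_Suc)
  finally show ?thesis .
qed

lemma continuous_on_E: "continuous_on {0..} (E n)"
  unfolding E_def using \<alpha> by (intro continuous_intros continuous_on_powr') auto

text \<open>After rescaling, the integrands for \<open>z \<ge> d\<close> are dominated by the one belonging to \<open>d\<close>, up to
  a constant, because both power functions involved are nonincreasing.\<close>

lemma continuous_on_G: "continuous_on {0..L} (G n)"
proof -
  define r where "r = mlk \<alpha> (rate n) \<alpha>"
  define W where "W = conv r (F n)"
  define C where "C = K / real (Suc n) ^ 4"
  have C: "0 \<le> C" using K_nonneg by (simp add: C_def)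
  have rm: "r \<in> borel_measurable borel" unfolding r_def by (rule mlk_measurable[OF \<alpha>(1) \<alpha>(1)])
  have rb: "\<bar>r s\<bar> \<le> pker \<alpha> s" if "0 < s" for s unfolding r_def by (rule resolvent_abs_le[OF that])
  have ci: "conv_integrable r (F n) z" if "0 < z" "z \<le> L" for z
    by (rule conv_powr_dominated(1)[OF \<alpha>(1) that(1) rm rb F_measurable[OF that(2)] F_bound]) (use that in auto)
  have pos: "(\<lambda>i. W (u i)) \<longlonglongrightarrow> W z"
    if u: "\<And>i. d \<le> u i" "\<And>i. u i \<le> L" "u \<longlonglongrightarrow> z" and d: "0 < d" for u z d
  proof -
    have z: "d \<le> z" "z \<le> L"
      using u by (auto intro: LIMSEQ_le_const LIMSEQ_le_const2)
    define g where "g y \<sigma> = indicator {0<..<1} \<sigma> *\<^sub>R (r (y * (1 - \<sigma>)) * F n (y * \<sigma>))" for y \<sigma> :: real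
    have gi: "integrable lborel (g y)" if "d \<le> y" "y \<le> L" for y
      using ci[of y] conv_scaled(2)[of y r "F n"] that d by (simp add: g_def[abs_def] set_integrable_def)
    have Wg: "W y = y * (LINT \<sigma>|lborel. g y \<sigma>)" if "d \<le> y" "y \<le> L" for y
      using conv_scaled(1)[of y r "F n"] that d by (simp add: W_def g_def[abs_def] set_lebesgue_integral_def)
    define D where "D \<sigma> = indicator {0<..<1} \<sigma> *\<^sub>R (pker \<alpha> (d * (1 - \<sigma>)) * (C * (d * \<sigma>) powr \<nu>))" for \<sigma> :: real
    have "conv_integrable (pker \<alpha>) (\<lambda>s. C * s powr \<nu>) d"
      by (rule conv_powr_dominated(1)[OF \<alpha>(1) d, where C = C])
         (use C in \<open>auto intro!: continuous_imp_measurable continuous_intros simp: less_imp_le[OF \<alpha>(1)] pker_nonneg[OF \<alpha>(1)]\<close>)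
    then have D: "integrable lborel D"
      using conv_scaled(2)[OF d, of "pker \<alpha>" "\<lambda>s. C * s powr \<nu>"] by (simp add: D_def[abs_def] set_integrable_def)
    have "(\<lambda>i. LINT \<sigma>|lborel. g (u i) \<sigma>) \<longlonglongrightarrow> (LINT \<sigma>|lborel. g z \<sigma>)"
    proof (rule integral_dominated_convergence[OF _ _ D])
      show "g z \<in> borel_measurable lborel" "g (u i) \<in> borel_measurable lborel" for i
        using gi z u by (auto intro: borel_measurable_integrable)
      show "AE \<sigma> in lborel. (\<lambda>i. g (u i) \<sigma>) \<longlonglongrightarrow> g z \<sigma>"
      proof (rule AE_I2)
        fix \<sigma> :: real
        show "(\<lambda>i. g (u i) \<sigma>) \<longlonglongrightarrow> g z \<sigma>"
        proof (cases "\<sigma> \<in> {0<..<1}")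
          case True
          have dpos: "0 < d * \<sigma>" "0 < d * (1 - \<sigma>)" using d True by auto
          have rng: "0 < y * \<sigma>" "y * \<sigma> \<le> L" "0 < y * (1 - \<sigma>)" if "d \<le> y" "y \<le> L" for y
          proof -
            have "0 < y" using d that by simp
            then show "0 < y * \<sigma>" "0 < y * (1 - \<sigma>)" using True by auto
            have "y * \<sigma> \<le> y * 1" using True \<open>0 < y\<close> by (intro mult_left_mono) auto
            then show "y * \<sigma> \<le> L" using that by simp
          qed
          have "(\<lambda>i. r (u i * (1 - \<sigma>))) \<longlonglongrightarrow> r (z * (1 - \<sigma>))"
            by (rule continuous_on_tendsto_compose[OF continuous_on_mlk[OF \<alpha>(1) \<alpha>(1), of "rate n", folded r_def]])
               (use u z rng in \<open>auto intro!: tendsto_intros always_eventually\<close>)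
          moreover have "(\<lambda>i. F n (u i * \<sigma>)) \<longlonglongrightarrow> F n (z * \<sigma>)"
            by (rule continuous_on_tendsto_compose[OF F_cont])
               (use u z rng in \<open>auto intro!: tendsto_intros always_eventually\<close>)
          ultimately show ?thesis using True by (auto simp: g_def intro!: tendsto_mult)
        qed (simp add: g_def)
      qed
      show "AE \<sigma> in lborel. norm (g (u i) \<sigma>) \<le> D \<sigma>" for i
      proof (rule AE_I2)
        fix \<sigma> :: real
        show "norm (g (u i) \<sigma>) \<le> D \<sigma>"
        proof (cases "\<sigma> \<in> {0<..<1}")
          case True
          define y where "y = u i"
          have y: "d \<le> y" "y \<le> L" "0 < y" using u d by (auto simp: y_def intro: less_le_trans)
          have "\<bar>r (y * (1 - \<sigma>))\<bar> \<le> pker \<alpha> (y * (1 - \<sigma>))"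
            using y True by (intro rb) auto
          also have "\<dots> \<le> pker \<alpha> (d * (1 - \<sigma>))"
            using y d True \<alpha> unfolding pker_def
            by (intro divide_right_mono powr_mono2' mult_right_mono) (auto simp: less_imp_le)
          finally have 1: "\<bar>r (y * (1 - \<sigma>))\<bar> \<le> pker \<alpha> (d * (1 - \<sigma>))" .
          have "\<bar>F n (y * \<sigma>)\<bar> \<le> C * (y * \<sigma>) powr \<nu>"
          proof -
            have "y * \<sigma> \<le> y" using True y by (intro mult_right_le_one_le) auto
            then have "y * \<sigma> \<le> L" using y(2) by (rule order_trans)
            then show ?thesis unfolding C_def using y True by (intro F_bound) auto
          qed
          also have "\<dots> \<le> C * (d * \<sigma>) powr \<nu>"
            using y d True \<nu> C by (intro mult_left_mono powr_mono2' mult_right_mono) auto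
          finally have 2: "\<bar>F n (y * \<sigma>)\<bar> \<le> C * (d * \<sigma>) powr \<nu>" .
          have "\<bar>r (y * (1 - \<sigma>))\<bar> * \<bar>F n (y * \<sigma>)\<bar> \<le> pker \<alpha> (d * (1 - \<sigma>)) * (C * (d * \<sigma>) powr \<nu>)"
            by (intro mult_mono 1 2) (auto simp: pker_nonneg[OF \<alpha>(1)])
          then show ?thesis using True by (simp add: g_def D_def y_def abs_mult)
        qed (simp add: g_def D_def)
      qed
    qed
    then have "(\<lambda>i. u i * (LINT \<sigma>|lborel. g (u i) \<sigma>)) \<longlonglongrightarrow> z * (LINT \<sigma>|lborel. g z \<sigma>)"
      by (intro tendsto_mult u)
    then show ?thesis using Wg u z by simp
  qed
  have "continuous_on {0..L} W"
  proof (rule continuous_on_sequentiallyI)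
    fix u z assume u: "\<forall>i. u i \<in> {0..L}" and z: "z \<in> {0..L}" and lim: "u \<longlonglongrightarrow> z"
    show "(\<lambda>i. W (u i)) \<longlonglongrightarrow> W z"
    proof (cases "z = 0")
      case True
      define B where "B = C * (Gamma (\<nu> + 1) / Gamma (\<alpha> + \<nu> + 1))"
      have Wb: "\<bar>W y\<bar> \<le> B * y powr (\<alpha> + \<nu>)" if "y \<in> {0..L}" for y
      proof (cases "y = 0")
        case False
        then have y: "0 < y" "y \<le> L" using that by auto
        have "\<bar>W y\<bar> \<le> C * (Gamma (\<nu> + 1) * pker (\<alpha> + \<nu> + 1) y)"
          unfolding W_def
          by (rule conv_powr_dominated(2)[OF \<alpha>(1) y(1) rm rb F_measurable[OF y(2)] F_bound[where n = n, folded C_def]]) (use y in auto)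
        then show ?thesis by (simp add: B_def pker_def)
      qed (simp add: W_def)
      have "(\<lambda>i. B * u i powr (\<alpha> + \<nu>)) \<longlonglongrightarrow> B * 0 powr (\<alpha> + \<nu>)"
        using lim u \<nu> True by (intro tendsto_mult tendsto_const tendsto_powr') (auto intro!: always_eventually)
      then have "(\<lambda>i. B * u i powr (\<alpha> + \<nu>)) \<longlonglongrightarrow> 0" by simp
      then have "(\<lambda>i. W (u i)) \<longlonglongrightarrow> 0"
        by (rule Lim_null_comparison[rotated]) (use Wb u in \<open>auto intro!: always_eventually\<close>)
      then show ?thesis using True by (simp add: W_def)
    next
      case False
      then have z: "0 < z" "z \<le> L" using z by auto
      \<comment> \<open>eventually equal to \<open>u\<close>, but bounded away from \<open>0\<close> from the first term on\<close>
      define v where "v i = max (u i) (z / 2)" for i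
      have "v \<longlonglongrightarrow> max z (z / 2)"
        unfolding v_def by (intro tendsto_max lim tendsto_const)
      then have "v \<longlonglongrightarrow> z" using z by (simp add: max_def)
      then have "(\<lambda>i. W (v i)) \<longlonglongrightarrow> W z"
        by (rule pos[rotated 2, of _ _ "z / 2"]) (use u z in \<open>auto simp: v_def\<close>)
      moreover have "\<forall>\<^sub>F i in sequentially. W (v i) = W (u i)"
        using order_tendstoD(1)[OF lim, of "z / 2"] z by (auto elim!: eventually_mono simp: v_def max_def)
      ultimately show ?thesis by (rule Lim_transform_eventually)
    qed
  qed
  then show ?thesis unfolding G_def W_def r_def by (intro continuous_intros)
qed

lemma continuous_on_U: "continuous_on {0..L} (U n)"
  unfolding U_def by (intro continuous_intros continuous_on_G continuous_on_subset[OF continuous_on_E]) auto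

lemma U_bound: "\<lbrakk>0 \<le> z; z \<le> L\<rbrakk> \<Longrightarrow> \<bar>U n z\<bar> \<le> \<bar>T n\<bar> + CG * (1 / (real (Suc n))\<^sup>2)"
proof -
  assume z: "0 \<le> z" "z \<le> L"
  have "CG / real (Suc n) ^ 4 \<le> CG / (real (Suc n))\<^sup>2"
    using CG_nonneg by (intro divide_left_mono power_increasing) auto
  then show ?thesis
    using E_bound[OF z(1), of n] G_bound[OF z, of n] abs_triangle_ineq[of "E n z" "G n z"]
    by (simp add: U_def)
qed

lemma summable_U_bound: "summable (\<lambda>n. \<bar>T n\<bar> + CG * (1 / (real (Suc n))\<^sup>2))"
  by (intro summable_add T summable_mult summable_Suc_powr2)

lemma U_0: "U n 0 = T n"
  by (simp add: U_def E_0 G_def)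

lemma lam_U_bound:
  assumes z: "0 < z" "z \<le> L"
  shows "lam n * \<bar>U n z\<bar> \<le> \<bar>T n\<bar> * (Gamma (\<alpha> + 1) / c * z powr (- \<alpha>)) + pi\<^sup>2 * CG * (1 / (real (Suc n))\<^sup>2)"
proof -
  have "lam n * \<bar>U n z\<bar> \<le> lam n * (\<bar>E n z\<bar> + \<bar>G n z\<bar>)"
    using lam_pos[of n] by (intro mult_left_mono) (auto simp: U_def)
  then show ?thesis
    using lam_E_bound[OF z(1), of n] lam_G_bound[OF less_imp_le[OF z(1)] z(2), of n] by (simp add: distrib_left)
qed

text \<open>A bound that need not be summable in \<open>n\<close>, but integrable at \<open>z = 0\<close> for each single mode;
  \<open>1 \<le> L powr (- \<nu>) * z powr \<nu>\<close> absorbs the bounded terms into the weight.\<close>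

lemma H_bound_powr:
  assumes z: "0 < z" "z \<le> L"
  shows "\<bar>H n z\<bar> \<le> (K / real (Suc n) ^ 4 + lam n * (\<bar>T n\<bar> + CG * (1 / (real (Suc n))\<^sup>2)) * L powr (- \<nu>)) * z powr \<nu>"
proof -
  have "L powr \<nu> \<le> z powr \<nu>" using z \<nu> by (intro powr_mono2') auto
  then have "L powr (- \<nu>) * L powr \<nu> \<le> L powr (- \<nu>) * z powr \<nu>" by (intro mult_left_mono) auto
  then have 1: "1 \<le> L powr (- \<nu>) * z powr \<nu>" using L by (simp add: powr_minus)
  have "\<bar>H n z\<bar> \<le> \<bar>F n z\<bar> + lam n * \<bar>U n z\<bar>"
    using lam_pos[of n] abs_triangle_ineq4[of "F n z" "lam n * U n z"] by (simp add: H_def abs_mult)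
  also have "lam n * \<bar>U n z\<bar> \<le> lam n * (\<bar>T n\<bar> + CG * (1 / (real (Suc n))\<^sup>2)) * 1"
    using lam_pos[of n] U_bound[of z n] z by simp
  also have "\<dots> \<le> lam n * (\<bar>T n\<bar> + CG * (1 / (real (Suc n))\<^sup>2)) * (L powr (- \<nu>) * z powr \<nu>)"
    using lam_pos[of n] CG_nonneg by (intro mult_left_mono 1) auto
  finally show ?thesis using F_bound[OF z, of n] by (simp add: algebra_simps)
qed

lemma continuous_on_H: "continuous_on {0<..L} (H n)"
  unfolding H_def by (intro continuous_intros F_cont continuous_on_subset[OF continuous_on_U]) auto

lemma conv_integrable_H:
  assumes "0 < b" "0 < z" "z \<le> L"
  shows "conv_integrable (pker b) (H n) z" "conv_integrable (pker b) (\<lambda>s. \<bar>H n s\<bar>) z"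
proof -
  define C where "C = K / real (Suc n) ^ 4 + lam n * (\<bar>T n\<bar> + CG * (1 / (real (Suc n))\<^sup>2)) * L powr (- \<nu>)"
  have le: "\<bar>H n s\<bar> \<le> C * s powr \<nu>" if "0 < s" "s < z" for s
    unfolding C_def by (rule H_bound_powr) (use that assms in auto)
  have cont: "continuous_on {0<..<z} (H n)"
    by (rule continuous_on_subset[OF continuous_on_H]) (use assms in auto)
  show "conv_integrable (pker b) (H n) z"
    by (rule conv_powr_dominated(1)[OF assms(1,2) pker_measurable _ continuous_imp_measurable[OF cont] le])
       (use assms in auto)
  show "conv_integrable (pker b) (\<lambda>s. \<bar>H n s\<bar>) z"
    by (rule conv_powr_dominated(1)[OF assms(1,2) pker_measurable _ continuous_imp_measurable, where C = C])
       (use assms le in \<open>auto intro!: continuous_intros cont\<close>)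
qed

text \<open>Each mode solves its Volterra equation: the initial value contributes the relaxation function,
  the source its convolution with the resolvent.\<close>

lemma mode_equation:
  assumes z: "0 < z" "z \<le> L"
  shows "U n z - T n = c * conv (pker \<alpha>) (H n) z"
proof -
  define r where "r = mlk \<alpha> (rate n) \<alpha>"
  have rm: "r \<in> borel_measurable borel" unfolding r_def by (rule mlk_measurable[OF \<alpha>(1) \<alpha>(1)])
  have rb: "\<bar>r s\<bar> \<le> pker \<alpha> s" if "0 < s" for s unfolding r_def by (rule resolvent_abs_le[OF that])
  have Fi: "conv_integrable (pker \<alpha>) (F n) z"
    by (rule conv_powr_dominated(1)[OF \<alpha>(1) z(1) pker_measurable _ F_measurable[OF z(2)] F_bound])
       (use z \<alpha> in auto)
  have E1: "E n z - T n = - rate n * conv (pker \<alpha>) (E n) z" and E2: "conv_integrable (pker \<alpha>) (E n) z"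
  proof -
    have eq: "conv (pker \<alpha>) (E n) z = conv (pker \<alpha>) (\<lambda>s. T n * mlk \<alpha> (rate n) 1 s) z"
      by (rule conv_cong) (auto simp: E_eq)
    show "E n z - T n = - rate n * conv (pker \<alpha>) (E n) z"
    proof -
      have m: "mlk \<alpha> (rate n) 1 z = 1 - rate n * conv (pker \<alpha>) (mlk \<alpha> (rate n) 1) z"
        using mlk_recurrence[of \<alpha> 1 z "rate n"] conv_pker_mlk(2)[of \<alpha> 1 \<alpha> z "rate n"] z \<alpha>
        by (simp add: pker_1)
      show ?thesis
        unfolding eq conv_cmult_right(1) E_eq[OF z(1)] by (subst m) (simp add: algebra_simps)
    qed
    have "conv_integrable (pker \<alpha>) (\<lambda>s. T n * mlk \<alpha> (rate n) 1 s) z"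
      by (rule conv_cmult_right(2)[OF conv_pker_mlk(1)]) (use \<alpha> z in auto)
    then show "conv_integrable (pker \<alpha>) (E n) z"
      by (subst conv_integrable_cong[where A' = "pker \<alpha>" and B' = "\<lambda>s. T n * mlk \<alpha> (rate n) 1 s"]) (auto simp: E_eq)
  qed
  have G1: "conv r (F n) z = conv (pker \<alpha>) (F n) z - rate n * conv (pker \<alpha>) (conv r (F n)) z"
    and G2: "conv_integrable (pker \<alpha>) (conv r (F n)) z"
  proof -
    define C where "C = mlk \<alpha> (rate n) (2 * \<alpha>)"
    have Cm: "C \<in> borel_measurable borel" unfolding C_def by (rule mlk_measurable) (use \<alpha> in auto)
    have rC: "r s = pker \<alpha> s - rate n * C s" if "0 < s" for s
      using mlk_recurrence[of \<alpha> \<alpha> s "rate n"] \<alpha> that by (simp add: r_def C_def)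
    have "\<bar>rate n * C s\<bar> \<le> pker \<alpha> s" if "0 < s" for s
      using rC[OF that] rb[OF that] mlk_resolvent_pos[OF \<alpha> rate_pos that, of n] by (simp add: r_def)
    then have Ci: "conv_integrable (\<lambda>s. rate n * C s) (\<lambda>s. \<bar>F n s\<bar>) z"
      by (intro conv_powr_dominated(1)[OF \<alpha>(1) z(1), where C = "K / real (Suc n) ^ 4"])
         (use Cm F_bound z in \<open>auto intro!: continuous_imp_measurable continuous_intros continuous_on_subset[OF F_cont] borel_measurable_times\<close>)
    have Ci': "conv_integrable C (\<lambda>s. \<bar>F n s\<bar>) z"
      using conv_cmult_left(2)[OF Ci, of "1 / rate n"] rate_pos[of n] by simp
    have as: "conv_integrable (pker \<alpha>) (conv r (F n)) z" "conv (pker \<alpha>) (conv r (F n)) z = conv C (F n) z"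
    proof -
      have p: "conv_integrable (pker \<alpha>) r x" "conv (pker \<alpha>) r x = C x" if "0 < x" for x
        using conv_pker_mlk[of \<alpha> \<alpha> \<alpha> x "rate n"] \<alpha> that by (simp_all add: r_def C_def)
      show "conv_integrable (pker \<alpha>) (conv r (F n)) z" "conv (pker \<alpha>) (conv r (F n)) z = conv C (F n) z"
        by (rule conv_assoc[OF pker_measurable rm F_measurable[OF z(2)] _ _ p Ci'];
            use \<alpha> mlk_resolvent_pos[OF \<alpha> rate_pos, of _ n] in \<open>auto simp: r_def less_imp_le\<close>)+
    qed
    show "conv_integrable (pker \<alpha>) (conv r (F n)) z" by (rule as)
    have "conv_integrable C (F n) z"
      by (rule conv_dominated(1)[OF Cm F_measurable[OF z(2)], where A' = "\<lambda>s. \<bar>C s\<bar>" and B' = "\<lambda>s. \<bar>F n s\<bar>"])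
         (use set_integrable_abs[OF Ci'[unfolded conv_integrable_def]] in \<open>auto simp: conv_integrable_def abs_mult\<close>)
    then have "conv (\<lambda>s. pker \<alpha> s - rate n * C s) (F n) z = conv (pker \<alpha>) (F n) z - rate n * conv C (F n) z"
      using conv_diff_left(2)[OF Fi conv_cmult_left(2)] by (simp add: conv_cmult_left(1))
    moreover have "conv r (F n) z = conv (\<lambda>s. pker \<alpha> s - rate n * C s) (F n) z"
      by (rule conv_cong) (auto simp: rC)
    ultimately show "conv r (F n) z = conv (pker \<alpha>) (F n) z - rate n * conv (pker \<alpha>) (conv r (F n)) z"
      by (simp add: as)
  qed
  have Gr: "G n = (\<lambda>s. c * conv r (F n) s)" by (simp add: G_def r_def fun_eq_iff)
  have Gi: "conv_integrable (pker \<alpha>) (G n) z" unfolding Gr by (rule conv_cmult_right(2)[OF G2])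
  have Hz: "conv (pker \<alpha>) (H n) z = conv (pker \<alpha>) (F n) z - lam n * (conv (pker \<alpha>) (E n) z + conv (pker \<alpha>) (G n) z)"
    using conv_diff_right(2)[OF Fi conv_cmult_right(2)[OF conv_add_right(1)[OF E2 Gi], of "lam n"]]
      conv_add_right(2)[OF E2 Gi]
    by (simp add: H_def[abs_def] U_def conv_cmult_right(1))
  have GD: "conv (pker \<alpha>) (G n) z = c * conv (pker \<alpha>) (conv r (F n)) z"
    unfolding Gr by (rule conv_cmult_right(1))
  have Gz: "G n z = c * conv r (F n) z" by (simp add: Gr)
  have "c * conv (pker \<alpha>) (H n) z
      = - rate n * conv (pker \<alpha>) (E n) z + c * (conv (pker \<alpha>) (F n) z - rate n * conv (pker \<alpha>) (conv r (F n)) z)"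
    unfolding Hz GD rate_def by (simp add: algebra_simps)
  also have "\<dots> = (E n z - T n) + c * conv r (F n) z" by (simp only: E1 G1)
  finally show ?thesis by (simp add: U_def Gz)
qed

text \<open>Fractional integration of order \<open>1 - \<alpha>\<close> turns the kernel \<open>pker \<alpha>\<close> of the Volterra equation into
  \<open>pker 1\<close>, by the semigroup law.\<close>

lemma rl_int_mode:
  assumes z: "0 < z" "z \<le> L"
  shows "rl_int (1 - \<alpha>) (\<lambda>s. U n s - T n) z = c * conv (pker 1) (H n) z"
proof (cases "\<alpha> = 1")
  case True
  then show ?thesis using mode_equation[OF z, of n] by (simp add: rl_int_def)
next
  case False
  then have b: "0 < 1 - \<alpha>" using \<alpha> by simp
  have "rl_int (1 - \<alpha>) (\<lambda>s. U n s - T n) z = rl_int (1 - \<alpha>) (\<lambda>s. c * conv (pker \<alpha>) (H n) s) z"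
    by (rule rl_int_cong) (use mode_equation z in auto)
  also have "\<dots> = c * conv (pker (1 - \<alpha>)) (conv (pker \<alpha>) (H n)) z"
    using b by (simp add: rl_int_cmult) (simp add: rl_int_def)
  also have "conv (pker (1 - \<alpha>)) (conv (pker \<alpha>) (H n)) z = conv (pker 1) (H n) z"
  proof (rule conv_assoc(2)[OF pker_measurable pker_measurable])
    show "set_borel_measurable borel {0<..<z} (H n)"
      by (rule continuous_imp_measurable[OF continuous_on_subset[OF continuous_on_H]]) (use z in auto)
    show "conv_integrable (pker (1 - \<alpha>)) (pker \<alpha>) x" "conv (pker (1 - \<alpha>)) (pker \<alpha>) x = pker 1 x"
      if "0 < x" "x < z" for x
      using conv_pker_pker[OF b \<alpha>(1) that(1)] by simp_all
    show "conv_integrable (pker 1) (\<lambda>s. \<bar>H n s\<bar>) z"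
      by (rule conv_integrable_H) (use z in auto)
  qed (use \<alpha> b in auto)
  finally show ?thesis .
qed

lemma rl_int_mode_derivative:
  assumes z: "0 < z" "z < L"
  shows "(rl_int (1 - \<alpha>) (\<lambda>s. U n s - T n) has_real_derivative c * H n z) (at z)"
proof -
  define z' where "z' = (z + L) / 2"
  have z': "z < z'" "z' < L" using z by (auto simp: z'_def)
  have "(conv (pker 1) (H n) has_real_derivative H n z) (at z)"
    by (rule conv_pker_1_derivative[OF z _ _ z'])
       (use z z' in \<open>auto intro!: conv_integrable_H continuous_on_subset[OF continuous_on_H]\<close>)
  then have "((\<lambda>z. c * conv (pker 1) (H n) z) has_real_derivative c * H n z) (at z)"
    by (rule DERIV_cmult)
  then show ?thesis
    by (rule has_field_derivative_transform_within_open[of _ _ _ "{0<..<L}"]) (use z rl_int_mode in auto)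
qed

subsection \<open>The sum of the modes\<close>

definition sol :: "real \<Rightarrow> real \<Rightarrow> real" where
  "sol x z = (\<Sum>n. U n z * sin (freq n * x))"

definition sol_xx :: "real \<Rightarrow> real \<Rightarrow> real" where
  "sol_xx x z = (\<Sum>n. - lam n * U n z * sin (freq n * x))"

definition source :: "real \<Rightarrow> real \<Rightarrow> real" where
  "source x z = (\<Sum>n. F n z * sin (freq n * x))"

lemma sol_sums:
  assumes "0 \<le> z" "z \<le> L"
  shows "(\<lambda>n. U n z * sin (freq n * x)) sums sol x z"
  unfolding sol_def
  by (intro summable_sums summable_sine_series summable_comparison_test'[OF summable_U_bound, of 0])
     (use U_bound assms in auto)

lemma continuous_on_sol: "continuous_on (UNIV \<times> {0..L}) (\<lambda>(x, z). sol x z)"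
  unfolding sol_def
  by (rule continuous_on_sine_series[OF continuous_on_U _ summable_U_bound]) (use U_bound in auto)

definition lamU_bound :: "real \<Rightarrow> nat \<Rightarrow> real" where
  "lamU_bound d n = \<bar>T n\<bar> * (Gamma (\<alpha> + 1) / c * d powr (- \<alpha>)) + pi\<^sup>2 * CG * (1 / (real (Suc n))\<^sup>2)"

lemma summable_lamU_bound: "summable (lamU_bound d)"
  unfolding lamU_bound_def by (intro summable_add T summable_mult summable_mult2 summable_Suc_powr2)

lemma lamU_le:
  assumes "0 < d" "d \<le> z" "z \<le> L"
  shows "\<bar>lam n * U n z\<bar> \<le> lamU_bound d n"
proof -
  have "z powr (- \<alpha>) \<le> d powr (- \<alpha>)" using assms \<alpha> by (intro powr_mono2') auto
  then have "\<bar>T n\<bar> * (Gamma (\<alpha> + 1) / c * z powr (- \<alpha>)) \<le> \<bar>T n\<bar> * (Gamma (\<alpha> + 1) / c * d powr (- \<alpha>))"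
    using c \<alpha> by (intro mult_left_mono) auto
  then show ?thesis
    using lam_U_bound[of z n] assms lam_pos[of n] by (simp add: abs_mult lamU_bound_def)
qed

text \<open>The bound on \<open>lam n * U n z\<close> makes the twice differentiated series converge uniformly on the whole
  line.\<close>

lemma sol_x_derivatives:
  assumes z: "0 < z" "z \<le> L"
  shows "\<exists>s'. (\<forall>x. ((\<lambda>x. sol x z) has_real_derivative s' x) (at x)) \<and> (\<forall>x. (s' has_real_derivative sol_xx x z) (at x))"
proof -
  have "summable (\<lambda>n. (1 / pi\<^sup>2) * lamU_bound z n)"
    by (intro summable_mult summable_lamU_bound)
  then have "summable (\<lambda>n. (real (Suc n))\<^sup>2 * \<bar>U n z\<bar>)"
  proof (rule summable_comparison_test'[of _ 0])
    fix n
    have "pi\<^sup>2 * ((real (Suc n))\<^sup>2 * \<bar>U n z\<bar>) \<le> lamU_bound z n"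
      using lamU_le[of z z n] z by (simp add: lam_def abs_mult power_mult_distrib mult_ac)
    then show "norm ((real (Suc n))\<^sup>2 * \<bar>U n z\<bar>) \<le> (1 / pi\<^sup>2) * lamU_bound z n"
      by (simp add: field_simps)
  qed
  note der = sine_series_derivatives[OF this]
  show ?thesis
    unfolding sol_def sol_xx_def lam_def
    by (intro exI[of _ "\<lambda>x. \<Sum>n. U n z * (freq n) * cos (freq n * x)"] conjI allI der)
qed

lemma continuous_on_sol_xx: "continuous_on (UNIV \<times> {0<..<L}) (\<lambda>(x, z). sol_xx x z)"
proof (rule continuous_on_strip_local)
  fix d :: real assume d: "0 < d"
  show "continuous_on (UNIV \<times> {d<..<L}) (\<lambda>(x, z). sol_xx x z)"
    unfolding sol_xx_def
    by (rule continuous_on_sine_series[OF _ _ summable_lamU_bound[of d]])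
       (use lamU_le[OF d] in \<open>auto intro!: continuous_intros continuous_on_subset[OF continuous_on_U] simp: d less_imp_le less_trans[OF d]\<close>)
qed

definition F_sup :: "real \<Rightarrow> nat \<Rightarrow> real" where
  "F_sup d n = K * d powr \<nu> * (1 / (real (Suc n))\<^sup>2)"

lemma F_le:
  assumes "0 < d" "d \<le> z" "z \<le> L"
  shows "\<bar>F n z\<bar> \<le> F_sup d n"
proof -
  have "\<bar>F n z\<bar> \<le> K / real (Suc n) ^ 4 * z powr \<nu>" using assms by (intro F_bound) auto
  also have "\<dots> \<le> K / (real (Suc n))\<^sup>2 * d powr \<nu>"
    using assms \<nu> K_nonneg by (intro mult_mono divide_left_mono power_increasing powr_mono2') auto
  finally show ?thesis by (simp add: F_sup_def)
qed

lemma summable_F_sup: "summable (F_sup d)"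
  unfolding F_sup_def by (intro summable_mult summable_Suc_powr2)

lemma continuous_on_source: "continuous_on (UNIV \<times> {0<..<L}) (\<lambda>(x, z). source x z)"
proof (rule continuous_on_strip_local)
  fix d :: real assume d: "0 < d"
  show "continuous_on (UNIV \<times> {d<..<L}) (\<lambda>(x, z). source x z)"
    unfolding source_def
    by (rule continuous_on_sine_series[OF _ _ summable_F_sup[of d]])
       (use F_le[OF d] d in \<open>auto intro!: continuous_on_subset[OF F_cont]\<close>)
qed

text \<open>The Riemann--Liouville integral commutes with the uniformly convergent series on \<open>{0..L}\<close>.  The
  series of \<open>z\<close>-derivatives converges uniformly only away from \<open>0\<close>, which suffices for differentiating
  term by term at \<open>z\<close>.\<close>

lemma sol_equation:
  assumes z: "0 < z" "z < L"
  shows "(rl_int (1 - \<alpha>) (\<lambda>s. sol x s - sol x 0) has_real_derivative c * (sol_xx x z + source x z)) (at z)"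
proof -
  define w where "w n = sin (freq n * x)" for n
  have w: "\<bar>w n\<bar> \<le> 1" for n by (simp add: w_def)
  define d where "d = z / 2"
  define e where "e = (z + L) / 2"
  have de: "0 < d" "d < z" "z < e" "e < L" using z by (auto simp: d_def e_def)
  have sums: "(\<lambda>n. rl_int (1 - \<alpha>) (\<lambda>s. (U n s - T n) * w n) y) sums rl_int (1 - \<alpha>) (\<lambda>s. sol x s - sol x 0) y"
    if y: "0 < y" "y \<le> L" for y
  proof -
    have "(\<lambda>n. rl_int (1 - \<alpha>) (\<lambda>s. (U n s - T n) * w n) y) sums rl_int (1 - \<alpha>) (\<lambda>s. \<Sum>n. (U n s - T n) * w n) y"
    proof (rule rl_int_suminf)
      show "summable (\<lambda>n. 2 * \<bar>T n\<bar> + CG * (1 / (real (Suc n))\<^sup>2))"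
        by (intro summable_add T summable_mult summable_Suc_powr2)
      fix n s assume s: "s \<in> {0..y}"
      have "\<bar>(U n s - T n) * w n\<bar> \<le> \<bar>U n s - T n\<bar>"
        using w[of n] by (simp add: abs_mult mult_left_le)
      also have "\<dots> \<le> 2 * \<bar>T n\<bar> + CG * (1 / (real (Suc n))\<^sup>2)"
        using U_bound[of s n] s y by auto
      finally show "\<bar>(U n s - T n) * w n\<bar> \<le> 2 * \<bar>T n\<bar> + CG * (1 / (real (Suc n))\<^sup>2)" .
    qed (use \<alpha> y in \<open>auto intro!: continuous_intros continuous_on_subset[OF continuous_on_U]\<close>)
    moreover have "rl_int (1 - \<alpha>) (\<lambda>s. \<Sum>n. (U n s - T n) * w n) y = rl_int (1 - \<alpha>) (\<lambda>s. sol x s - sol x 0) y"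
    proof (rule rl_int_cong[OF _ y(1)])
      fix s assume "0 < s" "s \<le> y"
      then have "(\<lambda>n. U n s * w n - U n 0 * w n) sums (sol x s - sol x 0)"
        unfolding w_def using y L by (intro sums_diff sol_sums) auto
      then show "(\<Sum>n. (U n s - T n) * w n) = sol x s - sol x 0"
        by (simp add: sums_iff U_0 left_diff_distrib)
    qed
    ultimately show ?thesis by simp
  qed
  have termD: "((\<lambda>y. rl_int (1 - \<alpha>) (\<lambda>s. (U n s - T n) * w n) y) has_field_derivative c * H n y * w n) (at y within {d..e})"
    if "y \<in> {d..e}" for n y
  proof -
    have "((\<lambda>y. w n * rl_int (1 - \<alpha>) (\<lambda>s. U n s - T n) y) has_field_derivative w n * (c * H n y)) (at y)"
      by (rule DERIV_cmult[OF rl_int_mode_derivative]) (use that de in auto)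
    then show ?thesis
      using rl_int_cmult[of "1 - \<alpha>" "w n" "\<lambda>s. U n s - T n"]
      by (simp add: mult_ac has_field_derivative_at_within)
  qed
  have uc: "uniformly_convergent_on {d..e} (\<lambda>n y. \<Sum>i<n. c * H i y * w i)"
  proof (rule Weierstrass_m_test')
    show "summable (\<lambda>n. c * (F_sup d n + lamU_bound d n))"
      by (intro summable_mult summable_add summable_F_sup summable_lamU_bound)
    fix n y assume y: "y \<in> {d..e}"
    have "norm (c * H n y * w n) \<le> c * \<bar>H n y\<bar>"
      using w[of n] c by (simp add: abs_mult mult_left_le)
    also have "\<bar>H n y\<bar> \<le> F_sup d n + lamU_bound d n"
      using F_le[of d y n] lamU_le[of d y n] abs_triangle_ineq4[of "F n y" "lam n * U n y"] y de by (simp add: H_def)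
    finally show "norm (c * H n y * w n) \<le> c * (F_sup d n + lamU_bound d n)"
      using c by simp
  qed
  have "((\<lambda>y. \<Sum>n. rl_int (1 - \<alpha>) (\<lambda>s. (U n s - T n) * w n) y) has_field_derivative (\<Sum>n. c * H n z * w n)) (at z)"
    by (rule has_field_derivative_series'(2)[OF _ termD uc, of z])
       (use de z sums[of z] in \<open>auto simp: sums_iff\<close>)
  then have "((\<lambda>y. rl_int (1 - \<alpha>) (\<lambda>s. sol x s - sol x 0) y) has_real_derivative (\<Sum>n. c * H n z * w n)) (at z)"
    by (rule has_field_derivative_transform_within_open[of _ _ _ "{0<..<L}"]) (use z sums in \<open>auto simp: sums_iff\<close>)
  moreover have "(\<Sum>n. c * H n z * w n) = c * (sol_xx x z + source x z)"
  proof -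
    have 1: "(\<lambda>n. - lam n * U n z * w n) sums sol_xx x z"
      unfolding sol_xx_def w_def
      by (intro summable_sums summable_sine_series summable_comparison_test'[OF summable_lamU_bound[of z], of 0])
         (use lamU_le[of z z] z in auto)
    have 2: "(\<lambda>n. F n z * w n) sums source x z"
      unfolding source_def w_def
      by (intro summable_sums summable_sine_series summable_comparison_test'[OF summable_F_sup[of z], of 0])
         (use F_le[of z z] z in auto)
    have "(\<lambda>n. c * (- lam n * U n z * w n + F n z * w n)) sums (c * (sol_xx x z + source x z))"
      by (intro sums_mult sums_add 1 2)
    moreover have "(\<lambda>n. c * (- lam n * U n z * w n + F n z * w n)) = (\<lambda>n. c * H n z * w n)"
      by (simp add: H_def fun_eq_iff algebra_simps)
    ultimately show ?thesis by (metis sums_unique)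
  qed
  ultimately show ?thesis by simp
qed

end

section \<open>Uniqueness\<close>

lemma continuous_on_section:
  fixes V :: "real \<Rightarrow> real \<Rightarrow> real"
  assumes "continuous_on (S \<times> T) (\<lambda>(x, z). V x z)" "continuous_on A g" "continuous_on A h"
    and "\<And>a. a \<in> A \<Longrightarrow> g a \<in> S \<and> h a \<in> T"
  shows "continuous_on A (\<lambda>a. V (g a) (h a))"
  using continuous_on_compose2[OF assms(1) continuous_on_Pair[OF assms(2,3)]] assms(4) by auto

text \<open>Fubini, with the integrable majorant \<open>M * pker b (z - s)\<close> of the continuous integrand.\<close>

lemma rl_int_integral_swap:
  fixes V :: "real \<Rightarrow> real \<Rightarrow> real"
  assumes b: "0 \<le> b" and z: "0 < z"
    and V: "continuous_on ({0..1} \<times> {0..z}) (\<lambda>(x, s). V x s)" and \<phi>: "continuous_on {0..1} \<phi>"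
  shows "(\<lambda>x. \<phi> x * rl_int b (V x) z) integrable_on {0..1}"
    and "rl_int b (\<lambda>s. integral {0..1} (\<lambda>x. \<phi> x * V x s)) z = integral {0..1} (\<lambda>x. \<phi> x * rl_int b (V x) z)"
proof -
  have Vx: "continuous_on {0..1} (\<lambda>x. V x s)" if "s \<in> {0..z}" for s
    by (rule continuous_on_section[OF V]) ((intro continuous_intros)+, use that in auto)
  have *: "(\<lambda>x. \<phi> x * rl_int b (V x) z) integrable_on {0..1} \<and>
    rl_int b (\<lambda>s. integral {0..1} (\<lambda>x. \<phi> x * V x s)) z = integral {0..1} (\<lambda>x. \<phi> x * rl_int b (V x) z)"
  proof (cases "b = 0")
    case True
    then show ?thesis
      using z by (simp add: rl_int_def integrable_continuous_interval continuous_on_mult \<phi> Vx)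
  next
    case False
    then have b: "0 < b" using b by simp
    define h where "h s x = (if x \<in> {0..1} \<and> s \<in> {0..z} then \<phi> x * V x s else 0)" for s x
    have cont: "continuous_on ({0..z} \<times> {0..1}) (\<lambda>w. \<phi> (snd w) * V (snd w) (fst w))"
    proof (intro continuous_intros)
      show "continuous_on ({0..z} \<times> {0..1}) (\<lambda>w. \<phi> (snd w))"
        by (rule continuous_on_compose2[OF \<phi>]) ((intro continuous_intros)+, auto)
      show "continuous_on ({0..z} \<times> {0..1}) (\<lambda>w. V (snd w) (fst w))"
        by (rule continuous_on_section[OF V]) ((intro continuous_intros)+, auto)
    qed
    have "compact ({0..z} \<times> {0..1::real})" by (intro compact_Times compact_Icc)
    from compact_imp_bounded[OF compact_continuous_image[OF cont this]]
    obtain M where "\<forall>y\<in>(\<lambda>w. \<phi> (snd w) * V (snd w) (fst w)) ` ({0..z} \<times> {0..1}). norm y \<le> M"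
      unfolding bounded_iff by blast
    then have M: "\<bar>\<phi> (snd w) * V (snd w) (fst w)\<bar> \<le> M" if "w \<in> {0..z} \<times> {0..1}" for w
      using that by (simp only: ball_simps real_norm_def)
    have "(\<lambda>w. indicator ({0..z} \<times> {0..1}) w *\<^sub>R (\<phi> (snd w) * V (snd w) (fst w))) \<in> borel_measurable borel"
      by (rule borel_measurable_continuous_on_indicator[OF _ cont]) (intro borel_closed closed_Times closed_atLeastAtMost)
    also have "(\<lambda>w. indicator ({0..z} \<times> {0..1}) w *\<^sub>R (\<phi> (snd w) * V (snd w) (fst w))) = case_prod h"
      by (auto simp: fun_eq_iff h_def indicator_def)
    finally have [measurable]: "case_prod h \<in> borel_measurable (borel \<Otimes>\<^sub>M borel)"
      by (simp add: borel_prod)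
    define k where "k s = indicator {0<..<z} s *\<^sub>R pker b (z - s)" for s
    have k: "integrable lborel k"
      using integral_pker_reflected(1)[OF b z] by (simp add: set_integrable_def k_def[abs_def])
    have [measurable]: "k \<in> borel_measurable borel" using borel_measurable_integrable[OF k] by simp
    have bd: "integrable (lborel \<Otimes>\<^sub>M lborel) (\<lambda>(s, x). k s * (M * indicator {0..1::real} x))"
    proof (rule lborel_pair.Fubini_integrable)
      show "integrable lborel (\<lambda>s. LINT x|lborel. norm (case (s, x) of (s, x) \<Rightarrow> k s * (M * indicator {0..1::real} x)))"
        using k by (simp add: abs_mult)
    qed (auto simp: integrable_real_indicator)
    define Q where "Q s x = k s * h s x" for s x
    have Q: "integrable (lborel \<Otimes>\<^sub>M lborel) (case_prod Q)"
    proof (rule Bochner_Integration.integrable_bound[OF bd])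
      have "(\<lambda>(s, x). k s * h s x) \<in> borel_measurable (lborel \<Otimes>\<^sub>M lborel)" by measurable
      then show "case_prod Q \<in> borel_measurable (lborel \<Otimes>\<^sub>M lborel)" by (simp add: Q_def[abs_def])
      have "\<bar>k s * h s x\<bar> \<le> \<bar>k s * (M * indicator {0..1} x)\<bar>" for s x
        unfolding abs_mult[of "k s"] using M[of "(s, x)"]
        by (intro mult_left_mono) (auto simp: h_def indicator_def)
      then show "AE w in lborel \<Otimes>\<^sub>M lborel. norm (case_prod Q w) \<le> norm (case w of (s, x) \<Rightarrow> k s * (M * indicator {0..1::real} x))"
        by (intro AE_I2) (auto simp: Q_def split: prod.split)
    qed
    have Qx: "(LINT x|lborel. Q s x) = indicator {0<..<z} s *\<^sub>R (pker b (z - s) * integral {0..1} (\<lambda>x. \<phi> x * V x s))" for s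
    proof (cases "s \<in> {0<..<z}")
      case True
      have "(LINT x|lborel. Q s x) = (LINT x|lborel. pker b (z - s) * (indicator {0..1} x *\<^sub>R (\<phi> x * V x s)))"
        by (rule Bochner_Integration.integral_cong) (use True in \<open>auto simp: Q_def k_def h_def indicator_def\<close>)
      also have "\<dots> = pker b (z - s) * (LINT x:{0..1}|lborel. \<phi> x * V x s)"
        by (simp add: set_lebesgue_integral_def)
      also have "(LINT x:{0..1}|lborel. \<phi> x * V x s) = integral {0..1} (\<lambda>x. \<phi> x * V x s)"
        by (intro set_borel_integral_eq_integral borel_integrable_atLeastAtMost' continuous_intros \<phi> Vx) (use True in auto)
      finally show ?thesis using True by simp
    next
      case False
      then have "Q s x = 0" for x by (simp add: Q_def k_def)
      then show ?thesis using False by simp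
    qed
    have Qs: "(LINT s|lborel. Q s x) = indicator {0..1} x *\<^sub>R (\<phi> x * conv (pker b) (V x) z)" for x
    proof (cases "x \<in> {0..1}")
      case True
      have "(LINT s|lborel. Q s x) = (LINT s|lborel. \<phi> x * (indicator {0<..<z} s *\<^sub>R (pker b (z - s) * V x s)))"
        by (rule Bochner_Integration.integral_cong) (use True in \<open>auto simp: Q_def k_def h_def indicator_def\<close>)
      then show ?thesis using True by (simp add: conv_def set_lebesgue_integral_def)
    next
      case False
      then have "Q s x = 0" for s by (auto simp: Q_def h_def)
      then show ?thesis using False by simp
    qed
    have int: "set_integrable lborel {0..1} (\<lambda>x. \<phi> x * conv (pker b) (V x) z)"
      using lborel_pair.integrable_snd[OF Q] by (simp add: Qs set_integrable_def)
    have "conv (pker b) (\<lambda>s. integral {0..1} (\<lambda>x. \<phi> x * V x s)) z = (LINT x:{0..1}|lborel. \<phi> x * conv (pker b) (V x) z)"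
      using lborel_pair.Fubini_integral[OF Q]
      by (simp add: Qx Qs conv_def[of "pker b" "\<lambda>s. integral {0..1} (\<lambda>x. \<phi> x * V x s)"] set_lebesgue_integral_def)
    then show ?thesis
      using set_borel_integral_eq_integral[OF int] b by (simp add: rl_int_def)
  qed
  then show "(\<lambda>x. \<phi> x * rl_int b (V x) z) integrable_on {0..1}"
    "rl_int b (\<lambda>s. integral {0..1} (\<lambda>x. \<phi> x * V x s)) z = integral {0..1} (\<lambda>x. \<phi> x * rl_int b (V x) z)"
    by auto
qed

text \<open>Iterating the inequality \<open>\<bar>V\<bar> \<le> l (pker \<alpha> * \<bar>V\<bar>)\<close> bounds \<open>V\<close> by the terms of a convergent
  Mittag-Leffler series.\<close>

lemma volterra_zero:
  assumes \<alpha>: "0 < \<alpha>" and V: "continuous_on {0..Z} V"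
    and eq: "\<And>z. \<lbrakk>0 < z; z < Z\<rbrakk> \<Longrightarrow> V z = l * conv (pker \<alpha>) V z" and z: "0 < z" "z < Z"
  shows "V z = 0"
proof -
  obtain B where B: "\<And>s. s \<in> {0..Z} \<Longrightarrow> \<bar>V s\<bar> \<le> B"
    using compact_imp_bounded[OF compact_continuous_image[OF V compact_Icc]]
    unfolding bounded_iff by (metis imageI real_norm_def)
  have bound: "\<bar>V s\<bar> \<le> B * \<bar>l\<bar> ^ n * pker (\<alpha> * real n + 1) s" if "0 < s" "s < Z" for n s
    using that
  proof (induction n arbitrary: s)
    case 0
    then show ?case using B[of s] by (simp add: pker_1)
  next
    case (Suc n)
    have pos: "0 < \<alpha> * real n + 1" using \<alpha> by (simp add: add_nonneg_pos)
    have "\<bar>conv (pker \<alpha>) V s\<bar> \<le> conv (pker \<alpha>) (\<lambda>s. B * \<bar>l\<bar> ^ n * pker (\<alpha> * real n + 1) s) s"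
    proof (rule conv_dominated(2)[OF pker_measurable])
      show "set_borel_measurable borel {0<..<s} V"
        by (rule continuous_imp_measurable[OF continuous_on_subset[OF V]]) (use Suc.prems in auto)
      show "conv_integrable (pker \<alpha>) (\<lambda>s. B * \<bar>l\<bar> ^ n * pker (\<alpha> * real n + 1) s) s"
        by (rule conv_cmult_right(2)[OF conv_pker_pker(1)[OF \<alpha> pos Suc.prems(1)]])
    qed (use Suc \<alpha> in auto)
    also have "\<dots> = B * \<bar>l\<bar> ^ n * pker (\<alpha> * real (Suc n) + 1) s"
      using conv_pker_pker(2)[OF \<alpha> pos Suc.prems(1)] by (simp add: conv_cmult_right(1) algebra_simps)
    finally have "\<bar>l\<bar> * \<bar>conv (pker \<alpha>) V s\<bar> \<le> \<bar>l\<bar> * (B * \<bar>l\<bar> ^ n * pker (\<alpha> * real (Suc n) + 1) s)"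
      by (rule mult_left_mono) simp
    then show ?case using eq[OF Suc.prems] by (simp add: abs_mult mult_ac)
  qed
  have "(\<lambda>n. \<bar>(- l) ^ n * pker (\<alpha> * real n + 1) z\<bar>) \<longlonglongrightarrow> 0"
    by (rule summable_LIMSEQ_zero[OF mlk_sums(2)]) (use \<alpha> z in auto)
  then have "(\<lambda>n. B * \<bar>(- l) ^ n * pker (\<alpha> * real n + 1) z\<bar>) \<longlonglongrightarrow> B * 0"
    by (intro tendsto_mult tendsto_const)
  moreover have "B * \<bar>(- l) ^ n * pker (\<alpha> * real n + 1) z\<bar> = B * \<bar>l\<bar> ^ n * pker (\<alpha> * real n + 1) z" for n
    using \<alpha> by (simp add: abs_mult power_abs pker_nonneg add_nonneg_pos)
  ultimately have "(\<lambda>n. B * \<bar>l\<bar> ^ n * pker (\<alpha> * real n + 1) z) \<longlonglongrightarrow> 0" by simp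
  then have "\<bar>V z\<bar> \<le> 0"
    by (rule LIMSEQ_le_const) (use bound[OF z] in auto)
  then show ?thesis by simp
qed

text \<open>The situation of the difference of two solutions, in the variable \<open>z\<close>.\<close>

locale homogeneous_problem =
  fixes \<alpha> c L :: real and W W1 D :: "real \<Rightarrow> real \<Rightarrow> real"
  assumes \<alpha>: "0 < \<alpha>" "\<alpha> \<le> 1" and L: "0 < L"
    and W_cont: "continuous_on ({0..1} \<times> {0..L}) (\<lambda>(x, z). W x z)"
    and bdry: "\<And>z. z \<in> {0..L} \<Longrightarrow> W 0 z = 0 \<and> W 1 z = 0"
    and init: "\<And>x. x \<in> {0..1} \<Longrightarrow> W x 0 = 0"
    and W1: "\<And>x z. \<lbrakk>x \<in> {0<..<1}; z \<in> {0<..<L}\<rbrakk> \<Longrightarrow> ((\<lambda>x. W x z) has_real_derivative W1 x z) (at x)"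
    and D: "\<And>x z. \<lbrakk>x \<in> {0<..<1}; z \<in> {0<..<L}\<rbrakk> \<Longrightarrow> ((\<lambda>x. W1 x z) has_real_derivative D x z) (at x)"
    and D_cont: "continuous_on ({0<..<1} \<times> {0<..<L}) (\<lambda>(x, z). D x z)"
    and eq: "\<And>x z. \<lbrakk>x \<in> {0<..<1}; z \<in> {0<..<L}\<rbrakk> \<Longrightarrow> (rl_int (1 - \<alpha>) (W x) has_real_derivative c * D x z) (at z)"
begin

definition mode :: "nat \<Rightarrow> real \<Rightarrow> real" where
  "mode k z = integral {0..1} (\<lambda>x. sin (real k * pi * x) * W x z)"

text \<open>The second derivative need not be integrable up to the boundary, so the
  equation is tested on \<open>{\<epsilon>..1 - \<epsilon>}\<close>, parametrized by \<open>shrink \<epsilon>\<close> over \<open>{0..1}\<close>.\<close>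

definition shrink :: "real \<Rightarrow> real \<Rightarrow> real" where
  "shrink \<epsilon> x = \<epsilon> + (1 - 2 * \<epsilon>) * x"

definition inner_mode :: "nat \<Rightarrow> real \<Rightarrow> real \<Rightarrow> real" where
  "inner_mode k \<epsilon> z = integral {0..1} (\<lambda>x. sin (real k * pi * x) * W (shrink \<epsilon> x) z)"

lemma shrink_in: 
  assumes "0 < \<epsilon>" "\<epsilon> < 1 / 2" "x \<in> {0..1}"
  shows "shrink \<epsilon> x \<in> {\<epsilon>..1 - \<epsilon>}"
proof -
  have "(1 - 2 * \<epsilon>) * x \<le> (1 - 2 * \<epsilon>) * 1" "0 \<le> (1 - 2 * \<epsilon>) * x"
    using assms by (auto intro!: mult_left_mono)
  then show ?thesis by (simp add: shrink_def)
qed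

lemma shrink_close: "\<lbrakk>0 < \<epsilon>; x \<in> {0..1}\<rbrakk> \<Longrightarrow> \<bar>shrink \<epsilon> x - x\<bar> \<le> \<epsilon>"
proof -
  assume "0 < \<epsilon>" "x \<in> {0..1}"
  have "shrink \<epsilon> x - x = \<epsilon> * (1 - 2 * x)" by (simp add: shrink_def algebra_simps)
  moreover have "\<bar>1 - 2 * x\<bar> \<le> 1" using \<open>x \<in> {0..1}\<close> by auto
  ultimately show ?thesis using \<open>0 < \<epsilon>\<close> by (simp add: abs_mult mult_left_le)
qed

lemma W_shrink_cont:
  assumes "0 < \<epsilon>" "\<epsilon> < 1 / 2"
  shows "continuous_on ({0..1} \<times> {0..L}) (\<lambda>(x, z). W (shrink \<epsilon> x) z)"
proof -
  have "continuous_on ({0..1} \<times> {0..L}) (\<lambda>w. W (shrink \<epsilon> (fst w)) (snd w))"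
  proof (rule continuous_on_section[OF W_cont])
    show "continuous_on ({0..1} \<times> {0..L}) (\<lambda>w. shrink \<epsilon> (fst w))"
      unfolding shrink_def by (intro continuous_intros)
    fix w :: "real \<times> real" assume "w \<in> {0..1} \<times> {0..L}"
    then show "shrink \<epsilon> (fst w) \<in> {0..1} \<and> snd w \<in> {0..L}"
      using shrink_in[OF assms, of "fst w"] assms by auto
  qed (intro continuous_intros)
  then show ?thesis by (simp add: case_prod_beta')
qed

lemma mode_cont_aux:
  assumes "continuous_on ({0..1} \<times> {0..L}) (\<lambda>(x, z). V x z)"
  shows "continuous_on {0..L} (\<lambda>z. integral {0..1} (\<lambda>x. sin (real k * pi * x) * V x z))"
proof -
  have "continuous_on ({0..L} \<times> {0..1}) (\<lambda>w. V (snd w) (fst w))"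
    by (rule continuous_on_section[OF assms]) ((intro continuous_intros)+, auto)
  then have "continuous_on ({0..L} \<times> cbox 0 1) (\<lambda>(z, x). sin (real k * pi * x) * V x z)"
    by (auto simp: case_prod_beta' intro!: continuous_intros)
  from integral_continuous_on_param[OF this] show ?thesis by simp
qed

lemma mode_cont: "continuous_on {0..L} (mode k)"
  unfolding mode_def by (rule mode_cont_aux[OF W_cont])

lemma inner_mode_cont: "\<lbrakk>0 < \<epsilon>; \<epsilon> < 1 / 2\<rbrakk> \<Longrightarrow> continuous_on {0..L} (inner_mode k \<epsilon>)"
  unfolding inner_mode_def by (rule mode_cont_aux[OF W_shrink_cont])

text \<open>Two integrations by parts, in the form of an explicit antiderivative.\<close>

lemma inner_sine_D:
  assumes \<epsilon>: "0 < \<epsilon>" "\<epsilon> < 1 / 2" and z: "z \<in> {0<..<L}"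
  shows "(1 - 2 * \<epsilon>)\<^sup>2 * integral {0..1} (\<lambda>x. sin (real k * pi * x) * D (shrink \<epsilon> x) z)
    = - (real k * pi) * (cos (real k * pi) * W (1 - \<epsilon>) z - W \<epsilon> z) - (real k * pi)\<^sup>2 * inner_mode k \<epsilon> z"
proof -
  define q where "q = 1 - 2 * \<epsilon>"
  define w where "w = real k * pi"
  have q: "0 < q" using \<epsilon> by (simp add: q_def)
  have sh: "shrink \<epsilon> x \<in> {0<..<1}" if "x \<in> {0..1}" for x using shrink_in[OF \<epsilon> that] \<epsilon> by auto
  \<comment> \<open>an antiderivative of \<open>q\<^sup>2 sin (w x) D + w\<^sup>2 sin (w x) W\<close> at \<open>shrink \<epsilon> x\<close>\<close>
  define A where "A x = sin (w * x) * W1 (shrink \<epsilon> x) z * q - w * cos (w * x) * W (shrink \<epsilon> x) z" for x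
  have dsh: "(shrink \<epsilon> has_real_derivative q) (at x)" for x
    unfolding shrink_def q_def by (auto intro!: derivative_eq_intros)
  have "(A has_real_derivative q\<^sup>2 * (sin (w * x) * D (shrink \<epsilon> x) z) + w\<^sup>2 * (sin (w * x) * W (shrink \<epsilon> x) z)) (at x)"
    if x: "x \<in> {0..1}" for x
  proof -
    have dW1: "((\<lambda>x. W1 (shrink \<epsilon> x) z) has_real_derivative D (shrink \<epsilon> x) z * q) (at x)"
      using DERIV_chain2[OF D[OF sh[OF x] z] dsh] .
    have dW: "((\<lambda>x. W (shrink \<epsilon> x) z) has_real_derivative W1 (shrink \<epsilon> x) z * q) (at x)"
      using DERIV_chain2[OF W1[OF sh[OF x] z] dsh] .
    show ?thesis
    proof -
      have s: "((\<lambda>x. sin (w * x)) has_real_derivative w * cos (w * x)) (at x)"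
        and c: "((\<lambda>x. w * cos (w * x)) has_real_derivative - (w\<^sup>2 * sin (w * x))) (at x)"
        by (auto intro!: derivative_eq_intros simp: power2_eq_square)
      show ?thesis
        unfolding A_def
        by (rule DERIV_cong[OF DERIV_diff[OF DERIV_cmult_right[OF DERIV_mult[OF s dW1]] DERIV_mult[OF c dW]]])
           (simp add: power2_eq_square algebra_simps)
    qed
  qed
  then have I1: "((\<lambda>x. q\<^sup>2 * (sin (w * x) * D (shrink \<epsilon> x) z) + w\<^sup>2 * (sin (w * x) * W (shrink \<epsilon> x) z)) has_integral (A 1 - A 0)) {0..1}"
    by (intro fundamental_theorem_of_calculus)
       (auto simp flip: has_real_derivative_iff_has_vector_derivative intro: has_field_derivative_at_within)
  have "((\<lambda>x. w\<^sup>2 * (sin (w * x) * W (shrink \<epsilon> x) z)) has_integral w\<^sup>2 * inner_mode k \<epsilon> z) {0..1}"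
  proof -
    have "continuous_on {0..1} (\<lambda>x. W (shrink \<epsilon> x) z)"
      by (rule continuous_on_section[OF W_shrink_cont[OF \<epsilon>]]) ((intro continuous_intros)+, use z in auto)
    then have "(\<lambda>x. sin (w * x) * W (shrink \<epsilon> x) z) integrable_on {0..1}"
      by (intro integrable_continuous_interval continuous_intros)
    then show ?thesis
      unfolding inner_mode_def w_def by (intro has_integral_mult_right integrable_integral)
  qed
  from has_integral_diff[OF I1 this] have "((\<lambda>x. q\<^sup>2 * (sin (w * x) * D (shrink \<epsilon> x) z)) has_integral (A 1 - A 0 - w\<^sup>2 * inner_mode k \<epsilon> z)) {0..1}"
    by simp
  from integral_unique[OF this]
  have "q\<^sup>2 * integral {0..1} (\<lambda>x. sin (w * x) * D (shrink \<epsilon> x) z) = A 1 - A 0 - w\<^sup>2 * inner_mode k \<epsilon> z"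
    by (simp only: integral_mult_right)
  moreover have "A 1 - A 0 = - w * (cos w * W (1 - \<epsilon>) z - W \<epsilon> z)"
  proof -
    have "sin w = 0" "shrink \<epsilon> 1 = 1 - \<epsilon>" "shrink \<epsilon> 0 = \<epsilon>" by (simp_all add: w_def shrink_def)
    then show ?thesis unfolding A_def by (simp add: right_diff_distrib)
  qed
  ultimately show ?thesis by (simp add: q_def w_def)
qed

lemma inner_mode_equation:
  assumes \<epsilon>: "0 < \<epsilon>" "\<epsilon> < 1 / 2" and z: "0 < z1" "z1 \<le> z2" "z2 < L"
  shows "(1 - 2 * \<epsilon>)\<^sup>2 * (rl_int (1 - \<alpha>) (inner_mode k \<epsilon>) z2 - rl_int (1 - \<alpha>) (inner_mode k \<epsilon>) z1)
    = c * integral {z1..z2} (\<lambda>z. - (real k * pi) * (cos (real k * pi) * W (1 - \<epsilon>) z - W \<epsilon> z) - (real k * pi)\<^sup>2 * inner_mode k \<epsilon> z)"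
proof -
  define s where "s x = sin (real k * pi * x)" for x
  have sh: "shrink \<epsilon> x \<in> {0<..<1}" if "x \<in> {0..1}" for x using shrink_in[OF \<epsilon> that] \<epsilon> by auto
  have rl: "(\<lambda>x. s x * rl_int (1 - \<alpha>) (W (shrink \<epsilon> x)) z) integrable_on {0..1} \<and>
    rl_int (1 - \<alpha>) (inner_mode k \<epsilon>) z = integral {0..1} (\<lambda>x. s x * rl_int (1 - \<alpha>) (W (shrink \<epsilon> x)) z)"
    if "0 < z" "z \<le> L" for z
  proof -
    have "continuous_on ({0..1} \<times> {0..z}) (\<lambda>(x, z). W (shrink \<epsilon> x) z)"
      by (rule continuous_on_subset[OF W_shrink_cont[OF \<epsilon>]]) (use that in auto)
    moreover have "continuous_on {0..1} s" unfolding s_def by (intro continuous_intros)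
    ultimately show ?thesis
      using rl_int_integral_swap[of "1 - \<alpha>" z "\<lambda>x. W (shrink \<epsilon> x)" s] that \<alpha>
      by (simp add: inner_mode_def[abs_def] s_def)
  qed
  have Dc: "continuous_on (cbox (0, z1) (1, z2)) (\<lambda>(x, z). s x * D (shrink \<epsilon> x) z)"
  proof -
    have "continuous_on ({0..1} \<times> {z1..z2}) (\<lambda>w. D (shrink \<epsilon> (fst w)) (snd w))"
    proof (rule continuous_on_section[OF D_cont])
      show "continuous_on ({0..1} \<times> {z1..z2}) (\<lambda>w. shrink \<epsilon> (fst w))"
        unfolding shrink_def by (intro continuous_intros)
      fix w :: "real \<times> real" assume "w \<in> {0..1} \<times> {z1..z2}"
      then show "shrink \<epsilon> (fst w) \<in> {0<..<1} \<and> snd w \<in> {0<..<L}"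
        using sh[of "fst w"] z by auto
    qed (intro continuous_intros)
    then show ?thesis
      unfolding s_def by (auto simp: case_prod_beta' cbox_Pair_eq intro!: continuous_intros)
  qed
  have ftc: "rl_int (1 - \<alpha>) (W x) z2 - rl_int (1 - \<alpha>) (W x) z1 = c * integral {z1..z2} (D x)"
    if x: "x \<in> {0<..<1}" for x
  proof -
    have "((\<lambda>z. c * D x z) has_integral (rl_int (1 - \<alpha>) (W x) z2 - rl_int (1 - \<alpha>) (W x) z1)) {z1..z2}"
      using z eq[OF x] by (intro fundamental_theorem_of_calculus)
        (auto simp flip: has_real_derivative_iff_has_vector_derivative intro: has_field_derivative_at_within)
    then show ?thesis by (metis integral_mult_right integral_unique)
  qed
  have "rl_int (1 - \<alpha>) (inner_mode k \<epsilon>) z2 - rl_int (1 - \<alpha>) (inner_mode k \<epsilon>) z1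
     = integral {0..1} (\<lambda>x. s x * rl_int (1 - \<alpha>) (W (shrink \<epsilon> x)) z2 - s x * rl_int (1 - \<alpha>) (W (shrink \<epsilon> x)) z1)"
    using rl[of z1] rl[of z2] z by (simp add: Henstock_Kurzweil_Integration.integral_diff)
  also have "\<dots> = integral {0..1} (\<lambda>x. c * integral {z1..z2} (\<lambda>z. s x * D (shrink \<epsilon> x) z))"
  proof (rule Henstock_Kurzweil_Integration.integral_cong)
    fix x :: real assume "x \<in> {0..1}"
    then show "s x * rl_int (1 - \<alpha>) (W (shrink \<epsilon> x)) z2 - s x * rl_int (1 - \<alpha>) (W (shrink \<epsilon> x)) z1
       = c * integral {z1..z2} (\<lambda>z. s x * D (shrink \<epsilon> x) z)"
      using ftc[OF sh] by (simp add: right_diff_distrib[symmetric])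
  qed
  also have "\<dots> = c * integral {z1..z2} (\<lambda>z. integral {0..1} (\<lambda>x. s x * D (shrink \<epsilon> x) z))"
    using integral_swap_continuous[OF Dc] by simp
  finally have "(1 - 2 * \<epsilon>)\<^sup>2 * (rl_int (1 - \<alpha>) (inner_mode k \<epsilon>) z2 - rl_int (1 - \<alpha>) (inner_mode k \<epsilon>) z1)
      = c * integral {z1..z2} (\<lambda>z. (1 - 2 * \<epsilon>)\<^sup>2 * integral {0..1} (\<lambda>x. s x * D (shrink \<epsilon> x) z))"
    by simp
  also have "integral {z1..z2} (\<lambda>z. (1 - 2 * \<epsilon>)\<^sup>2 * integral {0..1} (\<lambda>x. s x * D (shrink \<epsilon> x) z))
     = integral {z1..z2} (\<lambda>z. - (real k * pi) * (cos (real k * pi) * W (1 - \<epsilon>) z - W \<epsilon> z) - (real k * pi)\<^sup>2 * inner_mode k \<epsilon> z)"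
    unfolding s_def using z by (intro Henstock_Kurzweil_Integration.integral_cong inner_sine_D[OF \<epsilon>]) auto
  finally show ?thesis .
qed

lemma W_uniform:
  assumes "0 < e"
  obtains d where "0 < d" "\<And>x y z. \<lbrakk>x \<in> {0..1}; y \<in> {0..1}; z \<in> {0..L}; \<bar>x - y\<bar> < d\<rbrakk> \<Longrightarrow> \<bar>W x z - W y z\<bar> < e"
proof -
  have "uniformly_continuous_on ({0..1} \<times> {0..L}) (\<lambda>(x, z). W x z)"
    by (rule compact_uniformly_continuous[OF W_cont]) (intro compact_Times compact_Icc)
  then obtain d where d: "0 < d" "\<And>v w. \<lbrakk>v \<in> {0..1} \<times> {0..L}; w \<in> {0..1} \<times> {0..L}; dist w v < d\<rbrakk>
      \<Longrightarrow> dist ((\<lambda>(x, z). W x z) w) ((\<lambda>(x, z). W x z) v) < e"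
    using assms unfolding uniformly_continuous_on_def by meson
  show thesis
  proof (rule that[OF d(1)])
    fix x y z assume "x \<in> {0..1}" "y \<in> {0..1}" "z \<in> {0..L}" "\<bar>x - y\<bar> < d"
    then show "\<bar>W x z - W y z\<bar> < e"
      using d(2)[of "(y, z)" "(x, z)"] by (simp add: dist_Pair_Pair dist_real_def)
  qed
qed

text \<open>As \<open>\<epsilon>\<close> tends to \<open>0\<close>, the boundary values \<open>W \<epsilon>\<close> and \<open>W (1 - \<epsilon>)\<close> tend to \<open>0\<close> uniformly in \<open>z\<close>,
  and the inner modes tend uniformly to the modes.\<close>

lemma mode_equation_between:
  assumes z: "0 < z1" "z1 \<le> z2" "z2 < L"
  shows "rl_int (1 - \<alpha>) (mode k) z2 - rl_int (1 - \<alpha>) (mode k) z1 = - c * (real k * pi)\<^sup>2 * integral {z1..z2} (mode k)"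
proof -
  \<comment> \<open>the shift by \<open>3\<close> keeps \<open>\<epsilon> n\<close> below \<open>1 / 2\<close>\<close>
  define \<epsilon> where "\<epsilon> n = 1 / real (n + 3)" for n
  have \<epsilon>: "0 < \<epsilon> n" "\<epsilon> n < 1 / 2" for n by (auto simp: \<epsilon>_def field_simps)
  have \<epsilon>0: "\<epsilon> \<longlonglongrightarrow> 0"
    unfolding \<epsilon>_def using LIMSEQ_ignore_initial_segment[OF lim_1_over_n, of 3] by simp
  have ev: "\<forall>\<^sub>F n in sequentially. \<forall>z\<in>{0..L}. \<forall>x\<in>{0..1}. \<bar>W (shrink (\<epsilon> n) x) z - W x z\<bar> < e" if e: "0 < e" for e
  proof -
    obtain d where d: "0 < d" "\<And>x y z. \<lbrakk>x \<in> {0..1}; y \<in> {0..1}; z \<in> {0..L}; \<bar>x - y\<bar> < d\<rbrakk> \<Longrightarrow> \<bar>W x z - W y z\<bar> < e"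
      using W_uniform[OF e] by blast
    have "\<forall>\<^sub>F n in sequentially. \<epsilon> n < d" by (rule order_tendstoD(2)[OF \<epsilon>0 d(1)])
    then show ?thesis
    proof eventually_elim
      fix n assume n: "\<epsilon> n < d"
      show "\<forall>z\<in>{0..L}. \<forall>x\<in>{0..1}. \<bar>W (shrink (\<epsilon> n) x) z - W x z\<bar> < e"
      proof (intro ballI)
        fix z x assume zx: "z \<in> {0..L}" "x \<in> {0..1::real}"
        have "shrink (\<epsilon> n) x \<in> {0..1}" using shrink_in[OF \<epsilon> zx(2), of n] \<epsilon>[of n] by auto
        then show "\<bar>W (shrink (\<epsilon> n) x) z - W x z\<bar> < e"
          using shrink_close[OF \<epsilon>(1) zx(2), of n] n zx by (intro d(2)) auto
      qed
    qed
  qed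
  have Wx: "continuous_on {0..1} (\<lambda>x. W x z)" if "z \<in> {0..L}" for z
    by (rule continuous_on_section[OF W_cont]) ((intro continuous_intros)+, use that in auto)
  have Wex: "continuous_on {0..1} (\<lambda>x. W (shrink (\<epsilon> n) x) z)" if "z \<in> {0..L}" for z n
    by (rule continuous_on_section[OF W_shrink_cont[OF \<epsilon>]]) ((intro continuous_intros)+, use that in auto)
  have u: "uniform_limit {0..L} (\<lambda>n. inner_mode k (\<epsilon> n)) (mode k) sequentially"
    unfolding uniform_limit_iff
  proof (intro allI impI)
    fix e :: real assume e: "0 < e"
    then have "0 < e / 2" by simp
    from ev[OF this] show "\<forall>\<^sub>F n in sequentially. \<forall>z\<in>{0..L}. dist (inner_mode k (\<epsilon> n) z) (mode k z) < e"
    proof eventually_elim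
      fix n assume n: "\<forall>z\<in>{0..L}. \<forall>x\<in>{0..1}. \<bar>W (shrink (\<epsilon> n) x) z - W x z\<bar> < e / 2"
      show "\<forall>z\<in>{0..L}. dist (inner_mode k (\<epsilon> n) z) (mode k z) < e"
      proof
        fix z assume z: "z \<in> {0..L}"
        have "inner_mode k (\<epsilon> n) z - mode k z
            = integral {0..1} (\<lambda>x. sin (real k * pi * x) * W (shrink (\<epsilon> n) x) z - sin (real k * pi * x) * W x z)"
          unfolding inner_mode_def mode_def
          by (rule Henstock_Kurzweil_Integration.integral_diff[symmetric])
             (intro integrable_continuous_interval continuous_intros Wx Wex z)+
        also have "norm \<dots> \<le> e / 2 * (1 - 0)"
        proof (rule integral_bound)
          show "continuous_on {0..1} (\<lambda>x. sin (real k * pi * x) * W (shrink (\<epsilon> n) x) z - sin (real k * pi * x) * W x z)"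
            by (intro continuous_intros Wx Wex z)
          fix x :: real assume x: "x \<in> {0..1}"
          have "\<bar>sin (real k * pi * x)\<bar> * \<bar>W (shrink (\<epsilon> n) x) z - W x z\<bar> \<le> 1 * (e / 2)"
            using n z x by (intro mult_mono) (auto simp: less_imp_le)
          then show "norm (sin (real k * pi * x) * W (shrink (\<epsilon> n) x) z - sin (real k * pi * x) * W x z) \<le> e / 2"
            by (simp add: right_diff_distrib[symmetric] abs_mult)
        qed simp
        finally show "dist (inner_mode k (\<epsilon> n) z) (mode k z) < e"
          using e by (simp add: dist_real_def)
      qed
    qed
  qed
  have rl: "(\<lambda>n. rl_int (1 - \<alpha>) (inner_mode k (\<epsilon> n)) z) \<longlonglongrightarrow> rl_int (1 - \<alpha>) (mode k) z" if "0 < z" "z \<le> L" for z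
    by (rule rl_int_uniform_limit[OF _ that(1) uniform_limit_on_subset[OF u] continuous_on_subset[OF inner_mode_cont[OF \<epsilon>]]])
       (use that \<alpha> in auto)
  have q: "(\<lambda>n. (1 - 2 * \<epsilon> n)\<^sup>2) \<longlonglongrightarrow> (1 - 2 * 0)\<^sup>2"
    by (intro tendsto_intros \<epsilon>0)
  have "(\<lambda>n. (1 - 2 * \<epsilon> n)\<^sup>2 * (rl_int (1 - \<alpha>) (inner_mode k (\<epsilon> n)) z2 - rl_int (1 - \<alpha>) (inner_mode k (\<epsilon> n)) z1))
     \<longlonglongrightarrow> (1 - 2 * 0)\<^sup>2 * (rl_int (1 - \<alpha>) (mode k) z2 - rl_int (1 - \<alpha>) (mode k) z1)"
    by (intro tendsto_mult tendsto_diff q rl) (use z in auto)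
  then have lim1: "(\<lambda>n. (1 - 2 * \<epsilon> n)\<^sup>2 * (rl_int (1 - \<alpha>) (inner_mode k (\<epsilon> n)) z2 - rl_int (1 - \<alpha>) (inner_mode k (\<epsilon> n)) z1))
     \<longlonglongrightarrow> rl_int (1 - \<alpha>) (mode k) z2 - rl_int (1 - \<alpha>) (mode k) z1" by simp
  define g where "g n z = - (real k * pi) * (cos (real k * pi) * W (1 - \<epsilon> n) z - W (\<epsilon> n) z) - (real k * pi)\<^sup>2 * inner_mode k (\<epsilon> n) z" for n z
  have bd: "uniform_limit {0..L} (\<lambda>n z. W (1 - \<epsilon> n) z) (\<lambda>z. 0) sequentially"
    "uniform_limit {0..L} (\<lambda>n z. W (\<epsilon> n) z) (\<lambda>z. 0) sequentially"
  proof -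
    have "\<forall>\<^sub>F n in sequentially. (\<forall>z\<in>{0..L}. dist (W (1 - \<epsilon> n) z) 0 < e) \<and> (\<forall>z\<in>{0..L}. dist (W (\<epsilon> n) z) 0 < e)" if "0 < e" for e
      using ev[OF that]
    proof eventually_elim
      fix n assume *: "\<forall>z\<in>{0..L}. \<forall>x\<in>{0..1}. \<bar>W (shrink (\<epsilon> n) x) z - W x z\<bar> < e"
      have s: "shrink (\<epsilon> n) 1 = 1 - \<epsilon> n" "shrink (\<epsilon> n) 0 = \<epsilon> n" by (simp_all add: shrink_def)
      show "(\<forall>z\<in>{0..L}. dist (W (1 - \<epsilon> n) z) 0 < e) \<and> (\<forall>z\<in>{0..L}. dist (W (\<epsilon> n) z) 0 < e)"
        using *[rule_format, of _ 1] *[rule_format, of _ 0] bdry by (auto simp: s dist_real_def)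
    qed
    then show "uniform_limit {0..L} (\<lambda>n z. W (1 - \<epsilon> n) z) (\<lambda>z. 0) sequentially"
      "uniform_limit {0..L} (\<lambda>n z. W (\<epsilon> n) z) (\<lambda>z. 0) sequentially"
      unfolding uniform_limit_iff eventually_conj_iff by blast+
  qed
  have "uniform_limit {0..L} g (\<lambda>z. - (real k * pi) * (cos (real k * pi) * 0 - 0) - (real k * pi)\<^sup>2 * mode k z) sequentially"
    unfolding g_def
    by (intro uniform_limit_minus bounded_linear.uniform_limit[OF bounded_linear_mult_right] bd u)
  then have gu: "uniform_limit {z1..z2} g (\<lambda>z. - (real k * pi)\<^sup>2 * mode k z) sequentially"
    using z by (auto intro: uniform_limit_on_subset)
  have Wz: "continuous_on {0..L} (W x)" if "x \<in> {0..1}" for x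
    by (rule continuous_on_section[OF W_cont]) ((intro continuous_intros)+, use that in auto)
  have gc: "continuous_on {z1..z2} (g n)" for n
    unfolding g_def
    by (intro continuous_intros continuous_on_subset[OF Wz] continuous_on_subset[OF inner_mode_cont[OF \<epsilon>]])
       (use z \<epsilon>[of n] in auto)
  obtain I J where IJ: "\<And>n. (g n has_integral I n) {z1..z2}"
    "((\<lambda>z. - (real k * pi)\<^sup>2 * mode k z) has_integral J) {z1..z2}" "I \<longlonglongrightarrow> J"
    using uniform_limit_integral[OF gu gc] by auto
  have "(1 - 2 * \<epsilon> n)\<^sup>2 * (rl_int (1 - \<alpha>) (inner_mode k (\<epsilon> n)) z2 - rl_int (1 - \<alpha>) (inner_mode k (\<epsilon> n)) z1) = c * I n" for n
    using inner_mode_equation[OF \<epsilon> z] integral_unique[OF IJ(1)] by (simp add: g_def[abs_def])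
  then have "(\<lambda>n. c * I n) \<longlonglongrightarrow> rl_int (1 - \<alpha>) (mode k) z2 - rl_int (1 - \<alpha>) (mode k) z1"
    using lim1 by simp
  moreover have "(\<lambda>n. c * I n) \<longlonglongrightarrow> c * J" by (intro tendsto_mult tendsto_const IJ)
  ultimately have "rl_int (1 - \<alpha>) (mode k) z2 - rl_int (1 - \<alpha>) (mode k) z1 = c * J"
    by (rule LIMSEQ_unique)
  also have "J = - (real k * pi)\<^sup>2 * integral {z1..z2} (mode k)"
    using IJ(2) by (metis integral_mult_right integral_unique)
  finally show ?thesis by simp
qed

lemma mode_0: "mode k 0 = 0"
proof -
  have "mode k 0 = integral {0..1} (\<lambda>x::real. 0)"
    unfolding mode_def by (rule Henstock_Kurzweil_Integration.integral_cong) (simp add: init)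
  then show ?thesis by simp
qed

text \<open>The lower end \<open>z1\<close> of the preceding identity tends to \<open>0\<close>.  The mode is continuous with value \<open>0\<close> at
  \<open>0\<close>, so its fractional integral tends to \<open>0\<close> there as well, even if the order \<open>1 - \<alpha>\<close> is \<open>0\<close>.\<close>

lemma mode_integrated_equation:
  assumes z: "0 < z" "z < L"
  shows "rl_int (1 - \<alpha>) (mode k) z = - c * (real k * pi)\<^sup>2 * integral {0..z} (mode k)"
proof -
  define C where "C = pker (1 - \<alpha> + 1) L + \<bar>c\<bar> * (real k * pi)\<^sup>2 * L"
  define R where "R = rl_int (1 - \<alpha>) (mode k) z + c * (real k * pi)\<^sup>2 * integral {0..z} (mode k)"
  have C: "0 \<le> C" using L \<alpha> by (simp add: C_def)
  have R: "\<bar>R\<bar> \<le> e * C" if e: "0 < e" for e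
  proof -
    \<comment> \<open>clamping extends the mode continuously to the whole line\<close>
    have "isCont (\<lambda>z. mode k (max 0 (min L z))) 0"
    proof -
      have "continuous_on UNIV (\<lambda>z. mode k (max 0 (min L z)))"
        by (rule continuous_on_compose2[OF mode_cont]) (use L in \<open>auto intro!: continuous_intros\<close>)
      then show ?thesis by (simp add: continuous_on_eq_continuous_at)
    qed
    moreover have "mode k (max 0 (min L 0)) = 0" using L by (simp add: mode_0)
    ultimately obtain d where d: "0 < d" "\<And>s. \<bar>s\<bar> < d \<Longrightarrow> \<bar>mode k (max 0 (min L s))\<bar> < e"
      using e unfolding continuous_at_eps_delta dist_real_def by (metis diff_0_right)
    define z1 where "z1 = min (d / 2) z"
    have z1: "0 < z1" "z1 \<le> z" "z1 < d" using d z by (auto simp: z1_def)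
    have small: "\<bar>mode k s\<bar> \<le> e" if "s \<in> {0..z1}" for s
    proof -
      have "max 0 (min L s) = s" "\<bar>s\<bar> < d" using that z1 z by auto
      then show ?thesis using d(2)[of s] by simp
    qed
    have cont: "continuous_on {a..b} (mode k)" if "0 \<le> a" "b \<le> z" for a b
      by (rule continuous_on_subset[OF mode_cont]) (use that z in auto)
    have "integral {0..z} (mode k) = integral {0..z1} (mode k) + integral {z1..z} (mode k)"
      by (rule Henstock_Kurzweil_Integration.integral_combine[symmetric])
         (use z1 in \<open>auto intro!: integrable_continuous_interval cont\<close>)
    then have "R = rl_int (1 - \<alpha>) (mode k) z1 + c * (real k * pi)\<^sup>2 * integral {0..z1} (mode k)"
      using mode_equation_between[OF z1(1,2) z(2), of k] by (simp add: R_def algebra_simps)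
    also have "\<bar>\<dots>\<bar> \<le> \<bar>rl_int (1 - \<alpha>) (mode k) z1\<bar> + \<bar>c\<bar> * (real k * pi)\<^sup>2 * \<bar>integral {0..z1} (mode k)\<bar>"
      using abs_triangle_ineq[of "rl_int (1 - \<alpha>) (mode k) z1" "c * (real k * pi)\<^sup>2 * integral {0..z1} (mode k)"] by (simp add: abs_mult)
    also have "\<bar>rl_int (1 - \<alpha>) (mode k) z1\<bar> \<le> e * pker (1 - \<alpha> + 1) z1"
      by (rule rl_int_bound) (use \<alpha> z1 z small in \<open>auto intro!: cont\<close>)
    also have "pker (1 - \<alpha> + 1) z1 \<le> pker (1 - \<alpha> + 1) L"
      unfolding pker_def using z1 z \<alpha> by (intro divide_right_mono powr_mono2) (auto simp: less_imp_le)
    also have "\<bar>integral {0..z1} (mode k)\<bar> \<le> e * L"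
    proof -
      have "norm (integral {0..z1} (mode k)) \<le> e * (z1 - 0)"
        by (rule integral_bound) (use z1 small in \<open>auto intro!: cont\<close>)
      also have "\<dots> \<le> e * L" using e z1 z by simp
      finally show ?thesis by simp
    qed
    finally have "\<bar>R\<bar> \<le> e * pker (1 - \<alpha> + 1) L + \<bar>c\<bar> * (real k * pi)\<^sup>2 * (e * L)"
      using e by (simp add: mult_left_mono)
    then show ?thesis by (simp add: C_def algebra_simps)
  qed
  have "\<bar>R\<bar> \<le> 0"
  proof (rule field_le_epsilon)
    fix e :: real assume "0 < e"
    have "\<bar>R\<bar> \<le> (e / (C + 1)) * C"
      using \<open>0 < e\<close> C by (intro R) auto
    also have "\<dots> \<le> e" using \<open>0 < e\<close> C by (simp add: field_simps)
    finally show "\<bar>R\<bar> \<le> 0 + e" by simp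
  qed
  then show ?thesis by (simp add: R_def)
qed

text \<open>Convolving the preceding equation with \<open>pker \<alpha>\<close> makes both sides expressions in the primitive \<open>V\<close> of
  the mode, for which it is a homogeneous Volterra equation.\<close>

lemma mode_zero:
  assumes z: "0 < z" "z < L"
  shows "mode k z = 0"
proof -
  define V where "V = conv (pker 1) (mode k)"
  define l where "l = - c * (real k * pi)\<^sup>2"
  have cont: "continuous_on {a..b} (mode k)" if "0 \<le> a" "b \<le> L" for a b
    by (rule continuous_on_subset[OF mode_cont]) (use that in auto)
  have ci: "conv_integrable (pker b) (mode k) y" if "0 < b" "0 < y" "y \<le> L" for b y
    by (rule continuous_conv_pker) (use that cont in auto)
  have Vi: "V y = integral {0..y} (mode k)" if "0 \<le> y" "y \<le> L" for y
  proof -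
    have "set_integrable lborel {0..y} (mode k)"
      by (rule borel_integrable_atLeastAtMost') (use that cont in auto)
    then have "integral {0..y} (mode k) = (LINT s:{0..y}|lborel. mode k s)"
      by (simp add: set_borel_integral_eq_integral(2))
    also have "\<dots> = V y"
      unfolding V_def conv_def set_integral_Icc_Ioo
      by (intro set_lebesgue_integral_cong) (auto simp: pker_1)
    finally show ?thesis by simp
  qed
  have Vc: "continuous_on {0..L} V"
  proof -
    have "continuous_on {0..L} (\<lambda>y. integral {0..y} (mode k))"
      by (rule indefinite_integral_continuous_1) (auto intro!: integrable_continuous_interval cont)
    then show ?thesis
      by (subst continuous_on_cong[OF refl Vi]) auto
  qed
  have rlV: "rl_int (1 - \<alpha>) (mode k) y = l * V y" if "0 < y" "y < L" for y
    using mode_integrated_equation[OF that, of k] Vi[of y] that by (simp add: l_def)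
  have V_eq: "V y = l * conv (pker \<alpha>) V y" if y: "0 < y" "y < L" for y
  proof -
    have "conv (pker \<alpha>) (rl_int (1 - \<alpha>) (mode k)) y = V y"
    proof (cases "\<alpha> = 1")
      case True
      then show ?thesis by (simp add: V_def rl_int_def[abs_def])
    next
      case False
      then have b: "0 < 1 - \<alpha>" using \<alpha> by simp
      have "conv (pker \<alpha>) (conv (pker (1 - \<alpha>)) (mode k)) y = conv (pker 1) (mode k) y"
      proof (rule conv_assoc(2)[OF pker_measurable pker_measurable])
        show "set_borel_measurable borel {0<..<y} (mode k)"
          by (rule continuous_imp_measurable[OF continuous_on_subset[OF mode_cont]]) (use y in auto)
        show "conv_integrable (pker \<alpha>) (pker (1 - \<alpha>)) x" "conv (pker \<alpha>) (pker (1 - \<alpha>)) x = pker 1 x"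
          if "0 < x" for x
          using conv_pker_pker[OF \<alpha>(1) b that] by simp_all
        show "conv_integrable (pker 1) (\<lambda>s. \<bar>mode k s\<bar>) y"
          by (rule continuous_conv_pker) (use y cont in \<open>auto intro!: continuous_intros\<close>)
      qed (use \<alpha> b in auto)
      then show ?thesis using b by (simp add: V_def rl_int_def[abs_def])
    qed
    moreover have "conv (pker \<alpha>) (rl_int (1 - \<alpha>) (mode k)) y = conv (pker \<alpha>) (\<lambda>s. l * V s) y"
      by (rule conv_cong) (use y rlV in auto)
    ultimately show ?thesis by (simp add: conv_cmult_right(1))
  qed
  have V0: "V y = 0" if "0 < y" "y < L" for y
    by (rule volterra_zero[OF \<alpha>(1) Vc V_eq that])
  define z' where "z' = (z + L) / 2"
  have z': "z < z'" "z' < L" using z by (auto simp: z'_def)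
  have "(V has_real_derivative mode k z) (at z)"
    unfolding V_def
    by (rule conv_pker_1_derivative[OF z continuous_on_subset[OF mode_cont] ci z']) (use z z' in auto)
  moreover have "(V has_real_derivative 0) (at z)"
    by (rule has_field_derivative_transform_within_open[OF DERIV_const, of "{0<..<L}" _ 0]) (use z V0 in auto)
  ultimately show ?thesis by (rule DERIV_unique)
qed

lemma W_zero:
  assumes x: "x \<in> {0..1}" and z: "z \<in> {0..L}"
  shows "W x z = 0"
proof -
  have inside: "W x z = 0" if "0 < z" "z < L" for z
  proof (rule sine_complete[OF _ _ x])
    show "continuous_on {0..1} (\<lambda>x. W x z)"
      by (rule continuous_on_section[OF W_cont]) ((intro continuous_intros)+, use that in auto)
    show "integral {0..1} (\<lambda>x. W x z * sin (freq k * x)) = 0" for k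
      using mode_zero[OF that, of "Suc k"] by (simp add: mode_def mult.commute)
  qed
  have "continuous_on {0..L} (W x)"
    by (rule continuous_on_section[OF W_cont]) ((intro continuous_intros)+, use x in auto)
  then show ?thesis
    using continuous_constant_on_closure[of "{0<..<L}" "W x" 0 z] inside z L by simp
qed

end

text \<open>The differentiability contained in the existence of the regularized operator passes to the
  Riemann--Liouville integral in \<open>z\<close>, whose derivative is then read off from the equation.\<close>

lemma solution_transformed:
  assumes sol: "is_solution \<theta> \<alpha> a T f \<tau> v"
    and \<alpha>: "0 < \<alpha>" "\<alpha> \<le> 1" and \<theta>: "\<theta> < 1" and p: "p = 1 - \<theta>" and aT: "0 \<le> a" "a < T"
  defines "V \<equiv> \<lambda>x z. v x (clock p a z)"
    and "Vxx \<equiv> \<lambda>x z. deriv (deriv (\<lambda>y. v y (clock p a z))) x"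
    and "L \<equiv> T powr p - a powr p"
  shows "continuous_on ({0..1} \<times> {0..L}) (\<lambda>(x, z). V x z)"
    and "continuous_on ({0<..<1} \<times> {0<..<L}) (\<lambda>(x, z). Vxx x z)"
    and "\<lbrakk>x \<in> {0<..<1}; z \<in> {0<..<L}\<rbrakk> \<Longrightarrow> ((\<lambda>x. V x z) has_real_derivative deriv (\<lambda>y. V y z) x) (at x)"
    and "\<lbrakk>x \<in> {0<..<1}; z \<in> {0<..<L}\<rbrakk> \<Longrightarrow> (deriv (\<lambda>y. V y z) has_real_derivative Vxx x z) (at x)"
    and "\<lbrakk>x \<in> {0<..<1}; z \<in> {0<..<L}\<rbrakk> \<Longrightarrow>
      (rl_int (1 - \<alpha>) (\<lambda>s. V x s - V x 0) has_real_derivative p powr (- \<alpha>) * (Vxx x z + f x (clock p a z))) (at z)"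
    and "z \<in> {0..L} \<Longrightarrow> V 0 z = 0 \<and> V 1 z = 0"
    and "x \<in> {0..1} \<Longrightarrow> V x 0 = \<tau> x"
proof -
  have p0: "0 < p" using \<theta> p by simp
  note sol' = sol[unfolded is_solution_def Let_def]
  have cl: "clock p a z \<in> {a..T}" if "z \<in> {0..L}" for z
    by (rule clock_in) (use that p0 aT in \<open>auto simp: L_def\<close>)
  have clo: "clock p a z \<in> {a<..<T}" if "z \<in> {0<..<L}" for z
    by (rule clock_in_open) (use that p0 aT in \<open>auto simp: L_def\<close>)
  have clc: "continuous_on S (clock p a)" if "S \<subseteq> {0..}" for S
    by (rule continuous_on_subset[OF continuous_on_clock[OF p0] that])
  have vc: "continuous_on ({0..1} \<times> {a..T}) (\<lambda>(x, t). v x t)" using sol' by simp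
  have ca: "clock p a 0 = a" by (rule clock_0[OF p0 aT(1)])
  have snd_c: "continuous_on (A \<times> S) (\<lambda>w. clock p a (snd w))" if "S \<subseteq> {0..}" for A :: "real set" and S
    by (rule continuous_on_compose2[OF clc[OF that]]) (auto intro: continuous_on_snd continuous_on_id)
  show "continuous_on ({0..1} \<times> {0..L}) (\<lambda>(x, z). V x z)"
  proof -
    have "continuous_on ({0..1} \<times> {0..L}) (\<lambda>w. v (fst w) (clock p a (snd w)))"
      by (rule continuous_on_section[OF vc])
         (use cl in \<open>auto intro!: snd_c continuous_on_fst continuous_on_id\<close>)
    then show ?thesis by (simp add: V_def case_prod_beta')
  qed
  show "continuous_on ({0<..<1} \<times> {0<..<L}) (\<lambda>(x, z). Vxx x z)"
  proof -
    have "continuous_on ({0<..<1} \<times> {0<..<L}) (\<lambda>w. deriv (deriv (\<lambda>y. v y (clock p a (snd w)))) (fst w))"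
      by (rule continuous_on_section[of "{0<..<1}" "{a<..<T}" "\<lambda>x t. deriv (deriv (\<lambda>y. v y t)) x"])
         (use sol' clo in \<open>auto intro!: snd_c continuous_on_fst continuous_on_id\<close>)
    then show ?thesis by (simp add: Vxx_def case_prod_beta')
  qed
  show "z \<in> {0..L} \<Longrightarrow> V 0 z = 0 \<and> V 1 z = 0" using sol' cl by (simp add: V_def)
  show "x \<in> {0..1} \<Longrightarrow> V x 0 = \<tau> x" using sol' by (simp add: V_def ca)
  assume x: "x \<in> {0<..<1}" and z: "z \<in> {0<..<L}"
  define t where "t = clock p a z"
  have t: "t \<in> {a<..<T}" using clo[OF z] by (simp add: t_def)
  have tz: "t powr p - a powr p = z" using z p0 by (simp add: t_def clock_powr)
  show "((\<lambda>x. V x z) has_real_derivative deriv (\<lambda>y. V y z) x) (at x)"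
    using sol' x t unfolding V_def t_def[symmetric]
    by (auto simp: DERIV_deriv_iff_real_differentiable)
  show "(deriv (\<lambda>y. V y z) has_real_derivative Vxx x z) (at x)"
    using sol' x t unfolding V_def Vxx_def t_def[symmetric]
    by (auto simp: DERIV_deriv_iff_real_differentiable)
  have vx: "continuous_on {a..T} (v x)"
    by (rule continuous_on_section[OF vc]) (use x in \<open>auto intro: continuous_on_const continuous_on_id\<close>)
  have "EK_integral p a 0 (1 - \<alpha>) (\<lambda>s. v x s - v x a) differentiable (at t)"
    using sol' x t by (auto simp: caputo_exists_on_iff[OF \<alpha>] p)
  then have "rl_int (1 - \<alpha>) (\<lambda>z. v x (clock p a z) - v x a) differentiable (at z)"
    using rl_differentiable_from_EK[OF p0 \<alpha> aT(1) _ _ vx, of t] t tz by simp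
  then obtain E where E: "(rl_int (1 - \<alpha>) (\<lambda>z. v x (clock p a z) - v x a) has_real_derivative E) (at z)"
    by (auto simp: real_differentiable_def)
  have "caputo_hyper_bessel \<theta> \<alpha> a (v x) t = p powr \<alpha> * E"
    by (rule caputo_from_rl_derivative(2)[OF \<theta> p \<alpha> aT(1) _ _ vx]) (use E t tz in auto)
  moreover have "caputo_hyper_bessel \<theta> \<alpha> a (v x) t - Vxx x z = f x t"
    using sol' x t by (auto simp: Vxx_def t_def)
  ultimately have "p powr \<alpha> * E = Vxx x z + f x t" by simp
  then have "E = p powr (- \<alpha>) * (Vxx x z + f x t)"
    using p0 by (simp add: powr_minus field_simps)
  then show "(rl_int (1 - \<alpha>) (\<lambda>s. V x s - V x 0) has_real_derivative p powr (- \<alpha>) * (Vxx x z + f x (clock p a z))) (at z)"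
    using E by (simp add: V_def ca t_def)
qed

lemma solutions_agree:
  assumes sol: "is_solution \<theta> \<alpha> a T f \<tau> u" "is_solution \<theta> \<alpha> a T f \<tau> v"
    and \<alpha>: "0 < \<alpha>" "\<alpha> \<le> 1" and \<theta>: "\<theta> < 1" and aT: "0 \<le> a" "a < T"
    and x: "x \<in> {0..1}" and t: "t \<in> {a..T}"
  shows "v x t = u x t"
proof -
  define p where "p = 1 - \<theta>"
  have p0: "0 < p" using \<theta> by (simp add: p_def)
  define L where "L = T powr p - a powr p"
  have L: "0 < L" using powr_less_mono2[of p a T] p0 aT by (simp add: L_def)
  define U where "U x z = u x (clock p a z)" for x z
  define V where "V x z = v x (clock p a z)" for x z
  define Uxx where "Uxx x z = deriv (deriv (\<lambda>y. u y (clock p a z))) x" for x z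
  define Vxx where "Vxx x z = deriv (deriv (\<lambda>y. v y (clock p a z))) x" for x z
  note U = solution_transformed[OF sol(1) \<alpha> \<theta> p_def aT, folded U_def Uxx_def L_def]
  note V = solution_transformed[OF sol(2) \<alpha> \<theta> p_def aT, folded V_def Vxx_def L_def]
  have cont: "continuous_on {0..L} (U x)" "continuous_on {0..L} (V x)" if "x \<in> {0..1}" for x
    by (rule continuous_on_section[OF U(1)] continuous_on_section[OF V(1)];
        use that in \<open>auto intro: continuous_on_const continuous_on_id\<close>)+
  interpret homogeneous_problem \<alpha> "p powr (- \<alpha>)" L "\<lambda>x z. V x z - U x z"
    "\<lambda>x z. deriv (\<lambda>y. V y z) x - deriv (\<lambda>y. U y z) x" "\<lambda>x z. Vxx x z - Uxx x z"
  proof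
    show "continuous_on ({0..1} \<times> {0..L}) (\<lambda>(x, z). V x z - U x z)"
      using continuous_on_diff[OF V(1) U(1)] by (simp add: case_prod_beta')
    show "continuous_on ({0<..<1} \<times> {0<..<L}) (\<lambda>(x, z). Vxx x z - Uxx x z)"
      using continuous_on_diff[OF V(2) U(2)] by (simp add: case_prod_beta')
    show "V 0 z - U 0 z = 0 \<and> V 1 z - U 1 z = 0" if "z \<in> {0..L}" for z
      using U(6)[OF that] V(6)[OF that] by simp
    show "V x 0 - U x 0 = 0" if "x \<in> {0..1}" for x
      using U(7)[OF that] V(7)[OF that] by simp
    fix x z :: real assume x: "x \<in> {0<..<1}" and z: "z \<in> {0<..<L}"
    show "((\<lambda>x. V x z - U x z) has_real_derivative deriv (\<lambda>y. V y z) x - deriv (\<lambda>y. U y z) x) (at x)"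
      by (intro DERIV_diff U V x z)
    show "((\<lambda>x. deriv (\<lambda>y. V y z) x - deriv (\<lambda>y. U y z) x) has_real_derivative Vxx x z - Uxx x z) (at x)"
      by (intro DERIV_diff U V x z)
    have "((\<lambda>z. rl_int (1 - \<alpha>) (\<lambda>s. V x s - V x 0) z - rl_int (1 - \<alpha>) (\<lambda>s. U x s - U x 0) z) has_real_derivative
       p powr (- \<alpha>) * (Vxx x z + f x (clock p a z)) - p powr (- \<alpha>) * (Uxx x z + f x (clock p a z))) (at z)"
      by (intro DERIV_diff U V x z)
    then show "(rl_int (1 - \<alpha>) (\<lambda>z. V x z - U x z) has_real_derivative p powr (- \<alpha>) * (Vxx x z - Uxx x z)) (at z)"
    proof (rule has_field_derivative_transform_within_open[of _ _ _ "{0<..<L}", THEN DERIV_cong])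
      fix y assume y: "y \<in> {0<..<L}"
      have "V x 0 = U x 0" using U(7)[of x] V(7)[of x] x by simp
      then have "(\<lambda>z. V x z - U x z) = (\<lambda>z. (V x z - V x 0) - (U x z - U x 0))" by (simp add: fun_eq_iff)
      moreover have "rl_int (1 - \<alpha>) (\<lambda>z. (V x z - V x 0) - (U x z - U x 0)) y
         = rl_int (1 - \<alpha>) (\<lambda>s. V x s - V x 0) y - rl_int (1 - \<alpha>) (\<lambda>s. U x s - U x 0) y"
        by (rule rl_int_diff)
           (use y x \<alpha> cont[of x] in \<open>auto intro!: continuous_on_diff continuous_on_const intro: continuous_on_subset\<close>)
      ultimately show "rl_int (1 - \<alpha>) (\<lambda>s. V x s - V x 0) y - rl_int (1 - \<alpha>) (\<lambda>s. U x s - U x 0) y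
         = rl_int (1 - \<alpha>) (\<lambda>z. V x z - U x z) y" by simp
    qed (use z in \<open>auto simp: algebra_simps\<close>)
  qed (use \<alpha> L in auto)
  define z where "z = t powr p - a powr p"
  have "z \<in> {0..L}"
    using t aT p0 powr_mono2[of p a t] powr_mono2[of p t T] by (auto simp: z_def L_def)
  moreover have "clock p a z = t" using t aT p0 by (simp add: z_def clock_inverse)
  ultimately show ?thesis using W_zero[OF x, of z] by (simp add: U_def V_def)
qed

section \<open>The source term\<close>

text \<open>Continuity in \<open>t\<close> is known for each \<open>x\<close> separately only; dominated convergence makes up for the missing
  joint continuity.\<close>

lemma continuous_on_sine_coeff:
  fixes f :: "real \<Rightarrow> real \<Rightarrow> real"
  assumes ft: "\<And>x. x \<in> {0..1} \<Longrightarrow> continuous_on S (f x)"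
    and fx: "\<And>t. t \<in> S \<Longrightarrow> continuous_on {0..1} (\<lambda>x. f x t)"
    and B: "continuous_on S B" "\<And>x t. \<lbrakk>x \<in> {0..1}; t \<in> S\<rbrakk> \<Longrightarrow> \<bar>f x t\<bar> \<le> B t"
  shows "continuous_on S (\<lambda>t. sine_coeff (\<lambda>x. f x t) k)"
proof (rule continuous_on_sequentiallyI)
  fix u t assume u: "\<forall>i. u i \<in> S" and t: "t \<in> S" and lim: "u \<longlonglongrightarrow> t"
  have "(\<lambda>i. B (u i)) \<longlonglongrightarrow> B t"
    by (rule continuous_on_tendsto_compose[OF B(1) lim t]) (use u in auto)
  then have "Bseq (\<lambda>i. B (u i))" by (intro convergent_imp_Bseq convergentI)
  then obtain C where C: "\<And>i. norm (B (u i)) \<le> C" by (meson BseqE)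
  have cont: "continuous_on {0..1} (\<lambda>x. f x s * sin (real k * pi * x))" if "s \<in> S" for s
    by (intro continuous_intros fx that)
  have "(\<lambda>i. LINT x:{0..1}|lborel. f x (u i) * sin (real k * pi * x)) \<longlonglongrightarrow> (LINT x:{0..1}|lborel. f x t * sin (real k * pi * x))"
    unfolding set_lebesgue_integral_def
  proof (rule integral_dominated_convergence)
    have m: "(\<lambda>x. indicator {0..1} x *\<^sub>R (f x s * sin (real k * pi * x))) \<in> borel_measurable lborel" if "s \<in> S" for s
      using borel_integrable_atLeastAtMost'[OF cont[OF that]] unfolding set_integrable_def by (rule borel_measurable_integrable)
    show "(\<lambda>x. indicator {0..1} x *\<^sub>R (f x t * sin (real k * pi * x))) \<in> borel_measurable lborel"
      by (rule m[OF t])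
    show "(\<lambda>x. indicator {0..1} x *\<^sub>R (f x (u i) * sin (real k * pi * x))) \<in> borel_measurable lborel" for i
      by (rule m) (use u in auto)
    show "integrable lborel (\<lambda>x. C * indicator {0..1::real} x)" by (simp add: integrable_real_indicator)
    show "AE x in lborel. (\<lambda>i. indicator {0..1} x *\<^sub>R (f x (u i) * sin (real k * pi * x))) \<longlonglongrightarrow> indicator {0..1} x *\<^sub>R (f x t * sin (real k * pi * x))"
    proof (rule AE_I2)
      fix x :: real
      have "(\<lambda>i. f x (u i)) \<longlonglongrightarrow> f x t" if "x \<in> {0..1}"
        by (rule continuous_on_tendsto_compose[OF ft[OF that] lim t]) (use u in auto)
      then show "(\<lambda>i. indicator {0..1} x *\<^sub>R (f x (u i) * sin (real k * pi * x))) \<longlonglongrightarrow> indicator {0..1} x *\<^sub>R (f x t * sin (real k * pi * x))"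
        by (cases "x \<in> {0..1}") (auto intro!: tendsto_intros)
    qed
    show "AE x in lborel. norm (indicator {0..1} x *\<^sub>R (f x (u i) * sin (real k * pi * x))) \<le> C * indicator {0..1} x" for i
    proof (rule AE_I2)
      fix x :: real
      have "\<bar>f x (u i) * sin (real k * pi * x)\<bar> \<le> C" if "x \<in> {0..1}"
      proof -
        have "\<bar>f x (u i) * sin (real k * pi * x)\<bar> \<le> \<bar>f x (u i)\<bar>" by (simp add: abs_mult mult_left_le)
        also have "\<dots> \<le> B (u i)" using B(2) that u by auto
        also have "\<dots> \<le> C" using C[of i] by simp
        finally show ?thesis .
      qed
      then show "norm (indicator {0..1} x *\<^sub>R (f x (u i) * sin (real k * pi * x))) \<le> C * indicator {0..1} x"
        by (cases "x \<in> {0..1}") auto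
    qed
  qed
  then show "(\<lambda>i. sine_coeff (\<lambda>x. f x (u i)) k) \<longlonglongrightarrow> sine_coeff (\<lambda>x. f x t) k"
    unfolding sine_coeff_def by (intro tendsto_mult tendsto_const)
qed

text \<open>The weight \<open>t powr q\<close> at \<open>t = clock p a z\<close>: bounded if \<open>a > 0\<close>, and \<open>z powr (q / p)\<close> with
  \<open>q / p > - \<alpha>\<close> if \<open>a = 0\<close>.\<close>

lemma weight_bound:
  assumes p: "0 < p" and \<alpha>: "0 < \<alpha>" and aT: "0 \<le> a" "a < T" and q: "a = 0 \<Longrightarrow> - \<alpha> * p < q"
  defines "L \<equiv> T powr p - a powr p"
  obtains \<nu> K where "- \<alpha> < \<nu>" "\<nu> \<le> 0" "0 \<le> K" "\<And>z. \<lbrakk>0 < z; z \<le> L\<rbrakk> \<Longrightarrow> clock p a z powr q \<le> K * z powr \<nu>"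
proof (cases "a = 0")
  case True
  define \<nu> where "\<nu> = min (q / p) 0"
  show thesis
  proof (rule that[of \<nu> "L powr (q / p - \<nu>)"])
    show "- \<alpha> < \<nu>" "\<nu> \<le> 0" using q[OF True] p \<alpha> by (auto simp: \<nu>_def field_simps)
    fix z assume z: "0 < z" "z \<le> L"
    have "clock p a z powr q = z powr (q / p - \<nu>) * z powr \<nu>"
      using z p by (simp add: clock_def True powr_powr powr_add[symmetric])
    also have "\<dots> \<le> L powr (q / p - \<nu>) * z powr \<nu>"
      using z by (intro mult_right_mono powr_mono2) (auto simp: \<nu>_def)
    finally show "clock p a z powr q \<le> L powr (q / p - \<nu>) * z powr \<nu>" .
  qed simp
next
  case False
  then have a: "0 < a" using aT by simp
  show thesis
  proof (rule that[of 0 "a powr q + T powr q"])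
    fix z assume z: "0 < z" "z \<le> L"
    have t: "clock p a z \<in> {a..T}" using clock_in[of p a z T] p aT z by (simp add: L_def)
    have "clock p a z powr q \<le> a powr q + T powr q"
    proof (cases "0 \<le> q")
      case True
      then have "clock p a z powr q \<le> T powr q" using t a by (intro powr_mono2) auto
      then show ?thesis by (simp add: add_increasing)
    next
      case False
      then have "clock p a z powr q \<le> a powr q" using t a by (intro powr_mono2') auto
      then show ?thesis by (simp add: add_increasing2)
    qed
    then show "clock p a z powr q \<le> (a powr q + T powr q) * z powr 0" using z by simp
  qed (use \<alpha> in auto)
qed

section \<open>Existence, uniqueness and the series formula\<close>

theorem theorem2p1:
  fixes \<alpha> \<theta> p a T \<mu> :: real
    and \<tau> \<tau>' :: "real \<Rightarrow> real"
    and f f4 :: "real \<Rightarrow> real \<Rightarrow> real"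
  assumes alpha: "0 < \<alpha>" "\<alpha> \<le> 1"
    and theta: "\<theta> < 1"
    and p: "p = 1 - \<theta>"
    and aT: "0 \<le> a" "a < T"
    \<comment> \<open>(i); \<open>\<tau>'\<close> is the derivative of \<open>\<tau>\<close>\<close>
    and tau_cont: "continuous_on {0..1} \<tau>"
    and tau_bdry: "\<tau> 0 = 0" "\<tau> 1 = 0"
    and tau_deriv: "has_L1_derivative01 \<tau> \<tau>'"
    and tau_L2: "set_integrable lborel {0..1} (\<lambda>x. (\<tau>' x)\<^sup>2)"
    \<comment> \<open>(ii); \<open>f4\<close> is the fourth derivative of \<open>f\<close> in the first variable\<close>
    and f_C3: "\<And>t. \<lbrakk>t \<in> {a..T}; 0 < t\<rbrakk> \<Longrightarrow> (\<lambda>x. f x t) \<in> Ck01 3"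
    and f_weighted: "\<And>x. x \<in> {0..1} \<Longrightarrow> f x \<in> weighted_C \<mu> a T"
    and f_bdry: "\<And>t. \<lbrakk>t \<in> {a..T}; 0 < t\<rbrakk> \<Longrightarrow>
         f 0 t = 0 \<and> f 1 t = 0 \<and>
         nderiv01 2 (\<lambda>x. f x t) 0 = 0 \<and> nderiv01 2 (\<lambda>x. f x t) 1 = 0"
    and f_deriv4: "\<And>t. \<lbrakk>t \<in> {a..T}; 0 < t\<rbrakk> \<Longrightarrow>
         has_L1_derivative01 (nderiv01 3 (\<lambda>x. f x t)) (\<lambda>x. f4 x t)"
    \<comment> \<open>the \<open>L\<^sup>1\<close> hypothesis is uniform in \<open>t\<close>, with the weight of the space \<open>C\<^sub>\<mu>\<close>\<close>
    and f_deriv4_unif: "\<exists>M q. \<mu> < q \<and>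
         (\<forall>t\<in>{a..T}. 0 < t \<longrightarrow> (LINT x:{0..1}|lborel. \<bar>f4 x t\<bar>) \<le> M * t powr q)"
    \<comment> \<open>for \<open>a = 0\<close> the weight may be singular at \<open>t = 0\<close>; for \<open>a > 0\<close> any real \<open>\<mu>\<close> is allowed\<close>
    and mu: "a = 0 \<Longrightarrow> - \<alpha> * p \<le> \<mu>"
  shows "\<exists>u. is_solution \<theta> \<alpha> a T f \<tau> u \<and>
           (\<forall>v. is_solution \<theta> \<alpha> a T f \<tau> v \<longrightarrow> (\<forall>x\<in>{0..1}. \<forall>t\<in>{a..T}. v x t = u x t)) \<and>
           (\<forall>x\<in>{0..1}. \<forall>t\<in>{a..T}.
              (\<lambda>n. let k = Suc n in
                 (sine_coeff \<tau> k *
                    mittag_leffler \<alpha> 1 (- ((real k * pi)\<^sup>2 / p powr \<alpha>) * (t powr p - a powr p) powr \<alpha>)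
                  + G_coeff p \<alpha> a f k t) * sin (real k * pi * x))
              sums u x t)"
proof -
  have p0: "0 < p" using theta p by simp
  define L where "L = T powr p - a powr p"
  have L: "0 < L" using powr_less_mono2[of p a T] p0 aT by (simp add: L_def)
  define c where "c = p powr (- \<alpha>)"
  have c: "0 < c" using p0 by (simp add: c_def)
  obtain M q where q: "\<mu> < q"
    and Mq: "\<And>t. \<lbrakk>t \<in> {a..T}; 0 < t\<rbrakk> \<Longrightarrow> (LINT x:{0..1}|lborel. \<bar>f4 x t\<bar>) \<le> M * t powr q"
    using f_deriv4_unif by blast
  define fk where "fk n t = sine_coeff (\<lambda>x. f x t) (Suc n)" for n t
  \<comment> \<open>\<open>M\<close> may be negative\<close>
  define M2 where "M2 = 2 * \<bar>M\<bar> / pi ^ 4"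
  have fk_bound: "\<bar>fk n t\<bar> \<le> M2 / real (Suc n) ^ 4 * t powr q" if t: "t \<in> {a..T}" "0 < t" for n t
  proof -
    have "\<bar>fk n t\<bar> \<le> 2 / (freq n) ^ 4 * (LINT x:{0..1}|lborel. \<bar>f4 x t\<bar>)"
      unfolding fk_def using f_bdry[OF t]
      by (intro sine_coeff_fourth_derivative_bound f_C3 f_deriv4 t) auto
    also have "\<dots> \<le> 2 / (freq n) ^ 4 * (\<bar>M\<bar> * t powr q)"
      using Mq[OF t] by (intro mult_left_mono order_trans[OF Mq[OF t]] mult_right_mono) auto
    also have "\<dots> = M2 / real (Suc n) ^ 4 * t powr q"
      by (simp add: M2_def power_mult_distrib mult_ac)
    finally show ?thesis .
  qed
  have summable4: "summable (\<lambda>n. M2 / real (Suc n) ^ 4 * s)" for s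
  proof (rule summable_comparison_test'[of "\<lambda>n. M2 * \<bar>s\<bar> * (1 / (real (Suc n))\<^sup>2)" 0])
    show "summable (\<lambda>n. M2 * \<bar>s\<bar> * (1 / (real (Suc n))\<^sup>2))"
      by (intro summable_mult summable_Suc_powr2)
    fix n
    have "M2 / real (Suc n) ^ 4 * \<bar>s\<bar> \<le> M2 / (real (Suc n))\<^sup>2 * \<bar>s\<bar>"
      by (intro mult_right_mono divide_left_mono power_increasing) (auto simp: M2_def)
    then show "norm (M2 / real (Suc n) ^ 4 * s) \<le> M2 * \<bar>s\<bar> * (1 / (real (Suc n))\<^sup>2)"
      by (simp add: abs_mult M2_def)
  qed
  have f_cont_x: "continuous_on {0..1} (\<lambda>x. f x t)" if "t \<in> {a..T}" "0 < t" for t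
    using f_C3[OF that] by (auto simp: Ck01_def nderiv01_def dest: spec[of _ "0::nat"])
  have f_series: "(\<lambda>n. fk n t * sin (freq n * x)) sums f x t"
    if t: "t \<in> {a..T}" "0 < t" and x: "x \<in> {0..1}" for x t
    unfolding fk_def
    by (rule sine_series_sums[OF f_cont_x[OF t] _ x])
       (use fk_bound[OF t] in \<open>auto intro!: summable_comparison_test'[OF summable4[of "t powr q"], of 0] simp: fk_def\<close>)
  define S4 where "S4 = (\<Sum>n. M2 / real (Suc n) ^ 4 * 1)"
  \<comment> \<open>the weights \<open>q\<close> in the hypothesis on \<open>f x\<close> depend on \<open>x\<close>; a bound uniform in \<open>x\<close> comes from the
    sine series instead\<close>
  have f_bound: "\<bar>f x t\<bar> \<le> S4 * t powr q" if t: "t \<in> {a..T}" "0 < t" and x: "x \<in> {0..1}" for x t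
  proof -
    have le: "norm (fk n t * sin (freq n * x)) \<le> M2 / real (Suc n) ^ 4 * t powr q" for n
      using order_trans[OF mult_left_le[of "\<bar>sin (freq n * x)\<bar>" "\<bar>fk n t\<bar>"] fk_bound[OF t]]
      by (simp add: abs_mult)
    have "norm (\<Sum>n. fk n t * sin (freq n * x)) \<le> (\<Sum>n. M2 / real (Suc n) ^ 4 * t powr q)"
      by (rule norm_suminf_le[OF le summable4])
    also have "\<dots> = S4 * t powr q"
      unfolding S4_def using suminf_mult2[OF summable4[of 1], of "t powr q"] by simp
    finally show ?thesis using f_series[OF t x] by (simp add: sums_iff)
  qed
  have f_cont_t: "continuous_on {a<..T} (f x)" if x: "x \<in> {0..1}" for x
  proof -
    obtain q' h where h: "continuous_on {a..T} h" "\<And>t. \<lbrakk>t \<in> {a..T}; 0 < t\<rbrakk> \<Longrightarrow> f x t = t powr q' * h t"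
      using f_weighted[OF x] unfolding weighted_C_def by blast
    have "continuous_on {a<..T} (\<lambda>t. t powr q' * h t)"
      by (intro continuous_intros continuous_on_subset[OF h(1)]) (use aT in auto)
    then show ?thesis
      by (subst continuous_on_cong[OF refl h(2)]) (use aT in auto)
  qed
  have fk_cont: "continuous_on {a<..T} (fk n)" for n
    unfolding fk_def
    by (rule continuous_on_sine_coeff[where B = "\<lambda>t. S4 * t powr q"])
       (use aT in \<open>auto intro!: f_cont_t f_cont_x f_bound continuous_intros\<close>)
  have muq: "- \<alpha> * p < q" if "a = 0" using mu[OF that] q by simp
  obtain \<nu> K where \<nu>: "- \<alpha> < \<nu>" "\<nu> \<le> 0" and K: "0 \<le> K"
    and weight: "\<And>z. \<lbrakk>0 < z; z \<le> L\<rbrakk> \<Longrightarrow> clock p a z powr q \<le> K * z powr \<nu>"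
    using weight_bound[OF p0 alpha(1) aT muq] unfolding L_def by blast
  have cl: "clock p a z \<in> {a<..T}" if "z \<in> {0<..L}" for z
    using clock_greater[of p a z] clock_in[of p a z T] that p0 aT by (auto simp: L_def)
  define F where "F n z = fk n (clock p a z)" for n z
  interpret R: relaxation_modes \<alpha> c L \<nu> "M2 * K" "\<lambda>n. sine_coeff \<tau> (Suc n)" F
  proof
    show "summable (\<lambda>n. \<bar>sine_coeff \<tau> (Suc n)\<bar>)"
      by (rule summable_sine_coeff_H1[OF tau_deriv tau_bdry tau_L2])
    show "continuous_on {0<..L} (F n)" for n
      unfolding F_def
      by (rule continuous_on_compose2[OF fk_cont continuous_on_subset[OF continuous_on_clock[OF p0]]]) (use cl in auto)
    fix n z assume z: "0 < z" "z \<le> L"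
    have "\<bar>F n z\<bar> \<le> M2 / real (Suc n) ^ 4 * clock p a z powr q"
      unfolding F_def by (rule fk_bound) (use cl[of z] z aT in auto)
    also have "\<dots> \<le> M2 / real (Suc n) ^ 4 * (K * z powr \<nu>)"
      by (intro mult_left_mono weight z) (auto simp: M2_def)
    finally show "\<bar>F n z\<bar> \<le> M2 * K / real (Suc n) ^ 4 * z powr \<nu>" by simp
  qed (use alpha c L \<nu> in auto)
  define u where "u x t = R.sol x (t powr p - a powr p)" for x t
  have zt: "t powr p - a powr p \<in> {0..L}" if "t \<in> {a..T}" for t
    using that aT p0 powr_mono2[of p a t] powr_mono2[of p t T] by (auto simp: L_def)
  have zto: "t powr p - a powr p \<in> {0<..<L}" if "t \<in> {a<..<T}" for t
    using that aT p0 powr_less_mono2[of p a t] powr_less_mono2[of p t T] by (auto simp: L_def)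
  have zc: "continuous_on (A \<times> S) (\<lambda>w. snd w powr p - a powr p)" if "S \<subseteq> {0..}" for A S :: "real set"
  proof -
    have "continuous_on {0..} (\<lambda>t. t powr p - a powr p)"
      by (intro continuous_intros continuous_on_powr') (use p0 in auto)
    then show ?thesis
      by (rule continuous_on_compose2[OF _ continuous_on_snd[OF continuous_on_id]]) (use that in auto)
  qed
  have source: "R.source x (t powr p - a powr p) = f x t" if "x \<in> {0<..<1}" "t \<in> {a<..<T}" for x t
  proof -
    have "F n (t powr p - a powr p) = fk n t" for n
      using that p0 aT by (simp add: F_def clock_inverse)
    then show ?thesis
      using f_series[of t x] that aT unfolding R.source_def by (simp add: sums_iff)
  qed
  have u_cont: "continuous_on ({0..1} \<times> {a..T}) (\<lambda>(x, t). u x t)"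
  proof -
    have "continuous_on ({0..1} \<times> {a..T}) (\<lambda>w. R.sol (fst w) (snd w powr p - a powr p))"
      by (rule continuous_on_section[OF R.continuous_on_sol])
         (use zt aT in \<open>auto intro!: zc continuous_on_fst continuous_on_id\<close>)
    then show ?thesis by (simp add: u_def case_prod_beta')
  qed
  have u_init: "u x a = \<tau> x" if "x \<in> {0..1}" for x
  proof -
    have "(\<lambda>n. R.U n 0 * sin (freq n * x)) sums R.sol x 0"
      by (rule R.sol_sums) (use L in auto)
    moreover have "(\<lambda>n. sine_coeff \<tau> (Suc n) * sin (freq n * x)) sums \<tau> x"
      by (rule sine_series_sums[OF tau_cont R.T that])
    ultimately show ?thesis by (simp add: u_def R.U_0 sums_iff)
  qed
  have u_bdry: "u 0 t = 0 \<and> u 1 t = 0" for t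
  proof -
    have "sin (freq n * 1) = 0" for n using sin_npi[of "Suc n"] by simp
    then show ?thesis by (simp add: u_def R.sol_def)
  qed
  have u_x: "(\<lambda>y. u y t) differentiable (at x)" "deriv (\<lambda>y. u y t) differentiable (at x)"
    "deriv (deriv (\<lambda>y. u y t)) x = R.sol_xx x (t powr p - a powr p)" if t: "t \<in> {a<..<T}" for x t
  proof -
    obtain s' where s': "\<And>x. ((\<lambda>x. u x t) has_real_derivative s' x) (at x)"
      "\<And>x. (s' has_real_derivative R.sol_xx x (t powr p - a powr p)) (at x)"
      using R.sol_x_derivatives[of "t powr p - a powr p"] zto[OF t] unfolding u_def by auto
    have d: "deriv (\<lambda>y. u y t) = s'" by (rule ext) (rule DERIV_imp_deriv[OF s'(1)])
    show "(\<lambda>y. u y t) differentiable (at x)" "deriv (\<lambda>y. u y t) differentiable (at x)"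
      unfolding d using s' by (auto simp: real_differentiable_def)
    show "deriv (deriv (\<lambda>y. u y t)) x = R.sol_xx x (t powr p - a powr p)"
      unfolding d by (rule DERIV_imp_deriv[OF s'(2)])
  qed
  have u_caputo: "EK_integral (1 - \<theta>) a (- \<alpha> + \<alpha>) (1 - \<alpha>) (\<lambda>s. u x s - u x a) differentiable (at t)"
    "caputo_hyper_bessel \<theta> \<alpha> a (u x) t = R.sol_xx x (t powr p - a powr p) + f x t"
    if x: "x \<in> {0<..<1}" and t: "t \<in> {a<..<T}" for x t
  proof -
    define z where "z = t powr p - a powr p"
    have z: "0 < z" "z < L" using zto[OF t] by (auto simp: z_def)
    have ux: "continuous_on {a..T} (u x)"
      by (rule continuous_on_section[OF u_cont]) (use x in \<open>auto intro: continuous_on_const continuous_on_id\<close>)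
    have D: "(rl_int (1 - \<alpha>) (\<lambda>z. u x (clock p a z) - u x a) has_real_derivative c * (R.sol_xx x z + R.source x z)) (at z)"
    proof (rule has_field_derivative_transform_within_open[OF R.sol_equation[OF z, of x], of "{0<..}"])
      fix y :: real assume "y \<in> {0<..}"
      then show "rl_int (1 - \<alpha>) (\<lambda>s. R.sol x s - R.sol x 0) y = rl_int (1 - \<alpha>) (\<lambda>z. u x (clock p a z) - u x a) y"
        using p0 by (intro rl_int_cong) (auto simp: u_def clock_powr)
    qed (use z in auto)
    note C = caputo_from_rl_derivative[OF theta p alpha aT(1) _ _ ux D[unfolded z_def]]
    show "EK_integral (1 - \<theta>) a (- \<alpha> + \<alpha>) (1 - \<alpha>) (\<lambda>s. u x s - u x a) differentiable (at t)"
      by (rule C(1)) (use t in auto)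
    have "caputo_hyper_bessel \<theta> \<alpha> a (u x) t = p powr \<alpha> * (c * (R.sol_xx x z + R.source x z))"
      unfolding z_def by (rule C(2)) (use t in auto)
    also have "\<dots> = R.sol_xx x z + R.source x z"
      using p0 by (simp add: c_def powr_minus)
    finally show "caputo_hyper_bessel \<theta> \<alpha> a (u x) t = R.sol_xx x (t powr p - a powr p) + f x t"
      using source[OF x t] by (simp add: z_def)
  qed
  have xx_cont: "continuous_on ({0<..<1} \<times> {a<..<T}) (\<lambda>w. R.sol_xx (fst w) (snd w powr p - a powr p))"
    by (rule continuous_on_section[OF R.continuous_on_sol_xx])
       (use zto aT in \<open>auto intro!: zc continuous_on_fst continuous_on_id\<close>)
  have source_cont: "continuous_on ({0<..<1} \<times> {a<..<T}) (\<lambda>w. R.source (fst w) (snd w powr p - a powr p))"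
    by (rule continuous_on_section[OF R.continuous_on_source])
       (use zto aT in \<open>auto intro!: zc continuous_on_fst continuous_on_id\<close>)
  have solution: "is_solution \<theta> \<alpha> a T f \<tau> u"
    unfolding is_solution_def Let_def
  proof (intro conjI)
    show "continuous_on ({0<..<1} \<times> {a<..<T}) (\<lambda>(x, t). deriv (deriv (\<lambda>y. u y t)) x)"
      using xx_cont by (rule continuous_on_eq) (auto simp: u_x)
    show "continuous_on ({0<..<1} \<times> {a<..<T}) (\<lambda>(x, t). caputo_hyper_bessel \<theta> \<alpha> a (u x) t)"
      using continuous_on_add[OF xx_cont source_cont]
      by (rule continuous_on_eq) (auto simp: u_caputo source)
    show "\<forall>x\<in>{0<..<1}. caputo_hyper_bessel_exists_on {a<..<T} \<theta> \<alpha> a (u x)"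
      using u_caputo(1) by (simp only: caputo_exists_on_iff[OF alpha]) blast
  qed (use u_cont u_x u_caputo u_bdry u_init in auto)
  have series: "(\<lambda>n. let k = Suc n in
         (sine_coeff \<tau> k * mittag_leffler \<alpha> 1 (- ((real k * pi)\<^sup>2 / p powr \<alpha>) * (t powr p - a powr p) powr \<alpha>)
          + G_coeff p \<alpha> a f k t) * sin (real k * pi * x)) sums u x t"
    if x: "x \<in> {0..1}" and t: "t \<in> {a..T}" for x t
  proof -
    define z where "z = t powr p - a powr p"
    have z: "0 \<le> z" "z \<le> L" using zt[OF t] by (auto simp: z_def)
    have rate: "R.rate n = (freq n)\<^sup>2 / p powr \<alpha>" for n
    proof -
      have "R.rate n = c * (freq n)\<^sup>2" by (simp only: R.rate_def R.lam_def)
      then show ?thesis by (simp add: c_def powr_minus_divide del: of_nat_Suc)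
    qed
    have G: "G_coeff p \<alpha> a f (Suc n) t = R.G n z" for n
    proof (cases "t = a")
      case True
      then have "z = 0" by (simp add: z_def)
      then show ?thesis
        unfolding True G_coeff_def R.G_def set_integral_Icc_Ioo by (simp add: set_lebesgue_integral_def)
    next
      case False
      then have t': "a < t" using t by simp
      have z': "0 < z" using powr_less_mono2[of p a t] p0 aT t' by (simp add: z_def)
      have "continuous_on {a<..<t} (fk n)"
        by (rule continuous_on_subset[OF fk_cont]) (use t in auto)
      then have m1: "set_borel_measurable borel {a<..<t} (\<lambda>s. sine_coeff (\<lambda>x. f x s) (Suc n))"
        unfolding fk_def by (rule continuous_imp_measurable)
      have m2: "set_borel_measurable borel {0<..<z} (F n)"
        by (rule R.F_measurable[OF z(2)])
      have i: "conv_integrable (pker \<alpha>) (\<lambda>z. \<bar>F n z\<bar>) z"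
      proof (rule R.conv_powr_dominated(1)[OF alpha(1) z' pker_measurable])
        show "set_borel_measurable borel {0<..<z} (\<lambda>s. \<bar>F n s\<bar>)"
          by (intro continuous_imp_measurable continuous_intros continuous_on_subset[OF R.F_cont]) (use z in auto)
        show "\<bar>\<bar>F n s\<bar>\<bar> \<le> M2 * K / real (Suc n) ^ 4 * s powr \<nu>" if "0 < s" "s < z" for s
          using R.F_bound[of s n] that z by simp
      qed (use alpha in auto)
      show ?thesis
      proof -
        have "F n = (\<lambda>z. sine_coeff (\<lambda>x. f x (clock p a z)) (Suc n))" by (simp add: F_def fk_def fun_eq_iff)
        then have "G_coeff p \<alpha> a f (Suc n) t = c * conv (mlk \<alpha> (R.rate n) \<alpha>) (F n) z"
          using G_coeff_eq_conv[OF p0 alpha aT(1) t' _ m1] m2 i by (simp add: rate z_def flip: c_def)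
        then show ?thesis by (simp only: R.G_def)
      qed
    qed
    have "(sine_coeff \<tau> (Suc n) * mittag_leffler \<alpha> 1 (- ((freq n)\<^sup>2 / p powr \<alpha>) * z powr \<alpha>)
        + G_coeff p \<alpha> a f (Suc n) t) = R.U n z" for n
      by (simp add: R.U_def R.E_def G rate)
    then show ?thesis
      using R.sol_sums[OF z, of x] by (simp add: Let_def u_def z_def)
  qed
  show ?thesis
  proof (intro exI[of _ u] conjI allI impI ballI)
    fix v x t assume "is_solution \<theta> \<alpha> a T f \<tau> v" "x \<in> {0..1::real}" "t \<in> {a..T}"
    then show "v x t = u x t"
      by (intro solutions_agree[OF solution _ alpha theta aT])
  qed (fact solution, fact series)
qed

end
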